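(* Let $X$ be a linear diffusion on $(0,+\infty[$ as described in the context. Let $\zeta,c>0$ with $c<\inf_{t<\zeta}q(\zeta-t,0,0)$, and let $f$ be the boundary defined by $$q(\zeta-t,f(t),0)=c,$$ for which $\zeta=\inf\{t\ge 0: f(t)=0\}$. Then the density of $G_f$ is given by $$\mathbb{P}_x(G_f\in dt)=-\frac{q(t,x,f(t))}{c\,s'(f(t))}\,\frac{\partial q(\zeta-t,y,0)}{\partial y}\Big|_{y=f(t)}\,dt\qquad(0<t<\zeta).$$
   Context: Setting: $(X_t,t\ge 0)$ is a linear regular conservative (infinite life-time) diffusion defined on $I=(0,+\infty[$ (left endpoint $\ell=0$), with $+\infty$ a natural boundary; $\mathbb{P}_x$ is its law started from $x$. Its speed measure is $m(dx)=\rho(x)dx$ (absolutely continuous), its scale function $s$ is of class $\mathcal{C}^2$, and its generator is $\mathcal{G}=\frac{1}{\rho(x)}\frac{\partial}{\partial x}\left(\frac{1}{s'(x)}\frac{\partial}{\partial x}\right)$. $X$ has a transition density $q(t,x,y)$ with respect to $m$, jointly continuous, symmetric in $(x,y)$, assumed of class $\mathcal{C}^{1,2,2}$ on $]0,+\infty[\times I\times I$; in particular, $\mathcal{G}q=\partial q/\partial t$ in the variables $(t,x)$ on $]0,+\infty[\times]0,+\infty[$. Properties used: for $x>0$, $\lim_{t\to 0}q(t,x,0)=0$; for every $t>0$, $y\mapsto q(t,y,0)$ is decreasing and tends to $0$ as $y\to+\infty$. Last passage time: $G_f:=\sup\{0\le t\le\zeta: X_t=f(t)\}$, with $G_f=0$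 if this set is empty. *)

theory Defs
  imports "HOL-Probability.Probability"
begin

section \<open>Continuous strong Markov families on the half-line\<close>

text \<open>
  Time is indexed by the reals, but only times \<open>t \<ge> 0\<close> are ever meaningful.  The state space is
  \<open>{0..}\<close>; it contains its left endpoint, since transition densities are evaluated at \<open>0\<close> and the
  smoothness assumptions on them include \<open>0\<close>.
\<close>

definition natural_filtration :: "'w measure \<Rightarrow> (real \<Rightarrow> 'w \<Rightarrow> real) \<Rightarrow> real \<Rightarrow> 'w measure" where
  "natural_filtration M X t =
     sigma (space M) {X u -` B \<inter> space M | u B. 0 \<le> u \<and> u \<le> t \<and> B \<in> sets borel}"

text \<open>The infimum is taken in \<^typ>\<open>ennreal\<close>, so it is \<open>\<infinity>\<close> when the set is never hit.\<close>

definition hitting_time :: "(real \<Rightarrow> 'w \<Rightarrow> real) \<Rightarrow> real set \<Rightarrow> 'w \<Rightarrow> ennreal" where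
  "hitting_time X A \<omega> = (INF t\<in>{t. 0 \<le> t \<and> X t \<omega> \<in> A}. ennreal t)"

text \<open>
  Stopping times in \<open>strong_markov\<close> are finite-valued.  This is equivalent to the usual
  formulation on \<open>{T < \<infinity>}\<close>: apply it to the truncations \<open>min T n\<close> and the events
  \<open>A \<inter> {T \<le> n}\<close>.  Since \<open>X\<close> is real-valued at all times, the family is conservative.
  In \<open>regular\<close> both points are interior: the boundary point \<open>0\<close> may be a point that is hit
  (a reflecting boundary) or one that is not (an entrance boundary).
\<close>

locale linear_diffusion =
  fixes M :: "'w measure"
    and P :: "real \<Rightarrow> 'w measure"
    and X :: "real \<Rightarrow> 'w \<Rightarrow> real"
  assumes kernel: "P \<in> restrict_space borel {0..} \<rightarrow>\<^sub>M prob_algebra M"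
    and measurable_X: "\<And>t. t \<ge> 0 \<Longrightarrow> X t \<in> borel_measurable M"
    and state_space: "\<And>t \<omega>. t \<ge> 0 \<Longrightarrow> \<omega> \<in> space M \<Longrightarrow> X t \<omega> \<ge> 0"
    and continuous_paths: "\<And>\<omega>. \<omega> \<in> space M \<Longrightarrow> continuous_on {0..} (\<lambda>t. X t \<omega>)"
    and start: "\<And>x. x \<ge> 0 \<Longrightarrow> AE \<omega> in P x. X 0 \<omega> = x"
    and strong_markov:
      "\<And>x T A t B. \<lbrakk> x \<ge> 0; stopping_time (natural_filtration M X) T; \<And>\<omega>. \<omega> \<in> space M \<Longrightarrow> T \<omega> \<ge> 0;
          A \<in> sets (filtration.pre_sigma (space M) (natural_filtration M X) T);
          t \<ge> 0; B \<in> sets borel \<rbrakk> \<Longrightarrow>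
        measure (P x) {\<omega> \<in> A. X (T \<omega> + t) \<omega> \<in> B} =
          (LINT \<omega>:A|P x. measure (P (X (T \<omega>) \<omega>)) {\<omega>' \<in> space M. X t \<omega>' \<in> B})"
    and regular:
      "\<And>x y. x > 0 \<Longrightarrow> y > 0 \<Longrightarrow> measure (P x) {\<omega> \<in> space M. hitting_time X {y} \<omega> < \<infinity>} > 0"

section \<open>Scale function, speed measure and generator\<close>

definition speed_measure :: "(real \<Rightarrow> real) \<Rightarrow> real measure" where
  "speed_measure \<rho> = density lborel (\<lambda>y. ennreal (\<rho> y) * indicator {0<..} y)"

text \<open>
  \<open>green_function s a b\<close> is the Green function of \<open>(1/\<rho>) d/dx ((1/s') d/dx)\<close> on \<open>]a, b[\<close> with
  Dirichlet conditions, relative to the speed measure.  It fixes the joint normalisation of scale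
  and speed (for Brownian motion: \<open>s x = x\<close> and \<open>\<rho> = 2\<close>).
\<close>

definition green_function :: "(real \<Rightarrow> real) \<Rightarrow> real \<Rightarrow> real \<Rightarrow> real \<Rightarrow> real \<Rightarrow> real" where
  "green_function s a b x y =
     (s (min x y) - s a) * (s b - s (max x y)) / (s b - s a)"

definition generator :: "(real \<Rightarrow> real) \<Rightarrow> (real \<Rightarrow> real) \<Rightarrow> (real \<Rightarrow> real) \<Rightarrow> real \<Rightarrow> real" where
  "generator \<rho> s u x = 1 / \<rho> x * deriv (\<lambda>z. 1 / deriv s z * deriv u z) x"

text \<open>
  Feller's classification: \<open>\<infinity>\<close> is natural if it is neither an exit boundary (first integral
  finite) nor an entrance boundary (second integral finite).
\<close>

definition natural_at_infinity :: "(real \<Rightarrow> real) \<Rightarrow> (real \<Rightarrow> real) \<Rightarrow> bool" where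
  "natural_at_infinity \<rho> s \<longleftrightarrow>
     (\<forall>z>0. (\<integral>\<^sup>+ a\<in>{z<..}. emeasure (speed_measure \<rho>) {z<..<a} * ennreal (deriv s a) \<partial>lborel) = \<infinity> \<and>
            (\<integral>\<^sup>+ a\<in>{z<..}. ennreal (s a - s z) \<partial>speed_measure \<rho>) = \<infinity>)"

text \<open>The scale function is only considered on \<open>{0<..}\<close>, because its limit at \<open>0\<close> may be \<open>-\<infinity>\<close>.\<close>

locale linear_diffusion_scale_speed = linear_diffusion M P X
  for M :: "'w measure" and P :: "real \<Rightarrow> 'w measure" and X :: "real \<Rightarrow> 'w \<Rightarrow> real" +
  fixes s :: "real \<Rightarrow> real"
    and \<rho> :: "real \<Rightarrow> real"
  assumes scale_C2:
      "\<And>x. x > 0 \<Longrightarrow> s differentiable (at x)"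
      "\<And>x. x > 0 \<Longrightarrow> deriv s differentiable (at x)"
      "continuous_on {0<..} (deriv (deriv s))"
    and scale_deriv_pos: "\<And>x. x > 0 \<Longrightarrow> deriv s x > 0"
    and scale:
      "\<And>a x b. 0 < a \<Longrightarrow> a < x \<Longrightarrow> x < b \<Longrightarrow>
         measure (P x) {\<omega> \<in> space M. hitting_time X {b} \<omega> < hitting_time X {a} \<omega>} =
           (s x - s a) / (s b - s a)"
    and speed_density_measurable: "\<rho> \<in> borel_measurable borel"
    and speed_density_pos: "\<And>x. x > 0 \<Longrightarrow> \<rho> x > 0"
    and speed_locally_finite:
      "\<And>a b. 0 < a \<Longrightarrow> a < b \<Longrightarrow> emeasure (speed_measure \<rho>) {a..b} < \<infinity>"
    and speed:
      "\<And>a x b. 0 < a \<Longrightarrow> a < x \<Longrightarrow> x < b \<Longrightarrow>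
         (\<integral>\<^sup>+ \<omega>. hitting_time X {a, b} \<omega> \<partial>P x) =
           (\<integral>\<^sup>+ y\<in>{a<..<b}. ennreal (green_function s a b x y) \<partial>speed_measure \<rho>)"
    and natural_infinity: "natural_at_infinity \<rho> s"

section \<open>Transition density\<close>

text \<open>
  The class \<open>C\<^sup>1\<^sup>,\<^sup>2\<^sup>,\<^sup>2\<close> on \<open>]0,\<infinity>[ \<times> [0,\<infinity>[ \<times> [0,\<infinity>[\<close>: one derivative in the first variable and two in
  each of the others, all jointly continuous; one-sided derivatives at the boundary point \<open>0\<close>.
\<close>

definition C122 :: "(real \<Rightarrow> real \<Rightarrow> real \<Rightarrow> real) \<Rightarrow> bool" where
  "C122 q \<longleftrightarrow>
     (\<exists>qt qx qxx qy qyy.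
        (\<forall>g\<in>{q, qt, qx, qxx, qy, qyy}.
           continuous_on ({0<..} \<times> {0..} \<times> {0..}) (\<lambda>(t, x, y). g t x y)) \<and>
        (\<forall>t>0. \<forall>x\<ge>0. \<forall>y\<ge>0.
           ((\<lambda>u. q u x y) has_real_derivative qt t x y) (at t) \<and>
           ((\<lambda>z. q t z y) has_real_derivative qx t x y) (at x within {0..}) \<and>
           ((\<lambda>z. qx t z y) has_real_derivative qxx t x y) (at x within {0..}) \<and>
           ((\<lambda>z. q t x z) has_real_derivative qy t x y) (at y within {0..}) \<and>
           ((\<lambda>z. qy t x z) has_real_derivative qyy t x y) (at y within {0..})))"

locale linear_diffusion_density = linear_diffusion_scale_speed M P X s \<rho>
  for M :: "'w measure" and P :: "real \<Rightarrow> 'w measure" and X :: "real \<Rightarrow> 'w \<Rightarrow> real"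
    and s :: "real \<Rightarrow> real" and \<rho> :: "real \<Rightarrow> real" +
  fixes q :: "real \<Rightarrow> real \<Rightarrow> real \<Rightarrow> real"
  assumes density_nonneg: "\<And>t x y. t > 0 \<Longrightarrow> x \<ge> 0 \<Longrightarrow> y \<ge> 0 \<Longrightarrow> q t x y \<ge> 0"
    and transition_density:
      "\<And>t x B. t > 0 \<Longrightarrow> x \<ge> 0 \<Longrightarrow> B \<in> sets borel \<Longrightarrow>
         emeasure (P x) {\<omega> \<in> space M. X t \<omega> \<in> B} =
           (\<integral>\<^sup>+ y\<in>B. ennreal (q t x y) \<partial>speed_measure \<rho>)"
    and density_symmetric: "\<And>t x y. t > 0 \<Longrightarrow> x \<ge> 0 \<Longrightarrow> y \<ge> 0 \<Longrightarrow> q t x y = q t y x"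
    and density_C122: "C122 q"
    and density_pde:
      "\<And>t x y. t > 0 \<Longrightarrow> x > 0 \<Longrightarrow> y \<ge> 0 \<Longrightarrow>
         generator \<rho> s (\<lambda>z. q t z y) x = deriv (\<lambda>u. q u x y) t"
    and density_small_time: "\<And>x. x > 0 \<Longrightarrow> ((\<lambda>t. q t x 0) \<longlongrightarrow> 0) (at_right 0)"
    and density_decreasing: "\<And>t. t > 0 \<Longrightarrow> antimono_on {0..} (\<lambda>y. q t y 0)"
    and density_at_infinity: "\<And>t. t > 0 \<Longrightarrow> ((\<lambda>y. q t y 0) \<longlongrightarrow> 0) at_top"

section \<open>Last passage time at a curve\<close>

definition last_passage_time ::
    "(real \<Rightarrow> 'w \<Rightarrow> real) \<Rightarrow> (real \<Rightarrow> real) \<Rightarrow> real \<Rightarrow> 'w \<Rightarrow> real" where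
  "last_passage_time X f \<zeta> \<omega> =
     (let S = {t \<in> {0..\<zeta>}. X t \<omega> = f t} in if S = {} then 0 else Sup S)"

text \<open>
  The equation \<open>q (\<zeta> - t) y 0 = c\<close> is taken to define \<open>f t\<close>: it has \<open>f t\<close> as its only
  solution \<open>y\<close> in the state space.
\<close>

definition boundary_defined_by ::
    "(real \<Rightarrow> real \<Rightarrow> real \<Rightarrow> real) \<Rightarrow> real \<Rightarrow> real \<Rightarrow> (real \<Rightarrow> real) \<Rightarrow> bool" where
  "boundary_defined_by q \<zeta> c f \<longleftrightarrow>
     (\<forall>t\<in>{0..<\<zeta>}. f t \<ge> 0 \<and> (\<forall>y\<ge>0. q (\<zeta> - t) y 0 = c \<longleftrightarrow> y = f t))"

end

theory Submission
  imports Defs "HOL-Real_Asymp.Real_Asymp"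
begin

text \<open>
  By the Markov property and the Chapman-Kolmogorov equations, \<open>Y t = q (\<zeta> - t) (X t) 0\<close> is a
  nonnegative continuous martingale on \<open>]0, \<zeta>[\<close>; it tends to \<open>0\<close> at \<open>\<zeta>\<close>, and \<open>X t = f t\<close> means
  \<open>Y t = c\<close>.  So \<open>G > t\<close> means that \<open>Y\<close> still reaches the level \<open>c\<close> after \<open>t\<close>, and Doob's maximal
  equality gives \<open>c * P(G > t) = E (min c (Y t)) = q \<zeta> x 0 - E (max 0 (Y t - c))\<close>.  The last
  expectation is an integral over \<open>]0, f t]\<close>; Green's formula turns its time derivative into a boundary
  term at \<open>f t\<close>, which is \<open>c\<close> times the claimed density.  The boundary term at \<open>0\<close> vanishes because
  no mass flows through \<open>\<infinity>\<close>, a natural boundary, so that by conservation of mass none flows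
  through \<open>0\<close> either.
\<close>

section \<open>The maximal equality for continuous martingales\<close>

text \<open>Positive times are essential throughout, since \<open>X t\<close> has a density only for
  \<open>t > 0\<close>. Three obstacles shape the proof. The Markov property yields the
  Chapman-Kolmogorov equations only for almost every end point, but the martingale property needs
  them at the end point \<open>0\<close>, a null set. Continuity of \<open>q\<close> and Fatou's
  lemma give one inequality there; a bound in L^2 gives the other. The behaviour at \<open>0\<close>
  is left open (reflecting or entrance), so no boundary condition can be read off there. The bound
  on \<open>c\<close> yields \<open>q \<zeta> 0 0 > 0\<close>, hence a finite speed measure near
  \<open>0\<close>; this is what gives a meaning to integrals over \<open>]0, b]\<close> of the time
  derivative of the density. Finally, \<open>f\<close> is given only implicitly: monotonicity makes
  it continuous, and its derivative is avoided by first treating the upper end point of the integral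
  as a variable independent of time. The density describes \<open>G\<close> inside
  \<open>]0, \<zeta>[\<close>; paths that never meet the curve contribute mass at
  \<open>0\<close>.\<close>

context prob_space begin

text \<open>Optional stopping at the first index where \<open>Z\<close> reaches \<open>c\<close>,
  unrolled into an induction over single steps. A discrete martingale may overshoot
  \<open>c\<close>, so the upper bound carries two errors: \<open>\<epsilon>\<close> for small
  overshoots, and the part of \<open>Z N\<close> on paths with an increment above
  \<open>\<epsilon>\<close>. The latter disappears when the grid of a continuous martingale is
  refined.\<close>

lemma discrete_maximal_bounds:
  fixes Z :: "nat \<Rightarrow> 'a \<Rightarrow> real" and F :: "nat \<Rightarrow> 'a measure"
  assumes sub: "\<And>n. n \<le> N \<Longrightarrow> subalgebra M (F n)"
    and meas: "\<And>i n. i \<le> n \<Longrightarrow> n \<le> N \<Longrightarrow> Z i \<in> borel_measurable (F n)"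
    and nonneg: "\<And>n \<omega>. n \<le> N \<Longrightarrow> \<omega> \<in> space M \<Longrightarrow> 0 \<le> Z n \<omega>"
    and int: "\<And>n. n \<le> N \<Longrightarrow> integrable M (Z n)"
    and mart: "\<And>n A. Suc n \<le> N \<Longrightarrow> A \<in> sets (F n) \<Longrightarrow>
      (LINT \<omega>:A|M. Z (Suc n) \<omega>) = (LINT \<omega>:A|M. Z n \<omega>)"
    and c: "0 < c" and e: "0 \<le> \<epsilon>"
  shows "c * prob {\<omega>\<in>space M. \<exists>i\<le>N. c \<le> Z i \<omega>} \<le> expectation (\<lambda>\<omega>. min c (Z 0 \<omega>))" (is ?thesis1)
    and "expectation (\<lambda>\<omega>. min c (Z 0 \<omega>)) \<le>
      (c + \<epsilon>) * prob {\<omega>\<in>space M. \<exists>i\<le>N. c \<le> Z i \<omega>}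
      + expectation (\<lambda>\<omega>. min c (Z N \<omega>))
      + (LINT \<omega>:{\<omega>\<in>space M. \<exists>i<N. \<epsilon> < Z (Suc i) \<omega> - Z i \<omega>}|M. Z N \<omega>)" (is ?thesis2)
proof -
  \<comment> \<open>The paths in \<open>B n\<close> have their first passage over \<open>c\<close>
    at step \<open>Suc n\<close>. \<open>E n\<close> and \<open>O' n\<close> single out passages
    that overshoot by more than \<open>\<epsilon>\<close>; these have to be followed up to time
    \<open>N\<close>, where their contribution can be controlled.\<close>
  define H where "H n = {\<omega>\<in>space M. \<forall>i\<le>n. Z i \<omega> < c}" for n
  define A where "A n = {\<omega>\<in>space M. \<exists>i\<le>n. c \<le> Z i \<omega>}" for n
  define B where "B n = H n \<inter> {\<omega>\<in>space M. c \<le> Z (Suc n) \<omega>}" for n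
  define O' where "O' n = {\<omega>\<in>space M. \<exists>i<n. (\<forall>j\<le>i. Z j \<omega> < c) \<and> c + \<epsilon> < Z (Suc i) \<omega>}" for n
  define E where "E n = H n \<inter> {\<omega>\<in>space M. c + \<epsilon> < Z (Suc n) \<omega>}" for n
  have spF: "space (F n) = space M" if "n \<le> N" for n
    using sub[OF that] by (simp add: subalgebra_def)
  have toM: "S \<in> sets M" if "S \<in> sets (F n)" "n \<le> N" for S n
    using sub[OF that(2)] that(1) by (auto simp: subalgebra_def)
  have ZM: "Z n \<in> borel_measurable M" if "n \<le> N" for n
    using int[OF that] by (rule borel_measurable_integrable)
  have H_F: "H n \<in> sets (F n)" if "n \<le> N" for n
  proof -
    have [measurable]: "Z i \<in> borel_measurable (F n)" if "i \<in> {..n}" for i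
      using meas that \<open>n \<le> N\<close> by auto
    have "{\<omega>\<in>space (F n). \<forall>i\<in>{..n}. Z i \<omega> < c} \<in> sets (F n)" by measurable
    also have "{\<omega>\<in>space (F n). \<forall>i\<in>{..n}. Z i \<omega> < c} = H n"
      by (auto simp: H_def spF[OF that])
    finally show ?thesis .
  qed
  have O_F: "O' n \<in> sets (F n)" if "n \<le> N" for n
  proof -
    have [measurable]: "Z i \<in> borel_measurable (F n)" if "i \<le> n" for i
      using meas that \<open>n \<le> N\<close> by auto
    have "{\<omega>\<in>space (F n). (\<forall>j\<in>{..i}. Z j \<omega> < c) \<and> c + \<epsilon> < Z (Suc i) \<omega>} \<in> sets (F n)" if "i < n" for i
    proof -
      have [measurable]: "Z (Suc i) \<in> borel_measurable (F n)" "\<And>j. j \<in> {..i} \<Longrightarrow> Z j \<in> borel_measurable (F n)"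
        using \<open>\<And>i. i \<le> n \<Longrightarrow> Z i \<in> borel_measurable (F n)\<close> that by auto
      show ?thesis by measurable
    qed
    hence "(\<Union>i\<in>{..<n}. {\<omega>\<in>space (F n). (\<forall>j\<in>{..i}. Z j \<omega> < c) \<and> c + \<epsilon> < Z (Suc i) \<omega>}) \<in> sets (F n)"
      by (intro sets.finite_UN) auto
    also have "(\<Union>i\<in>{..<n}. {\<omega>\<in>space (F n). (\<forall>j\<in>{..i}. Z j \<omega> < c) \<and> c + \<epsilon> < Z (Suc i) \<omega>}) = O' n"
      by (auto simp: O'_def spF[OF that])
    finally show ?thesis .
  qed
  have HM: "H n \<in> sets M" and OM: "O' n \<in> sets M" if "n \<le> N" for n
    using toM H_F O_F that by blast+
  have AM: "A n \<in> sets M" if "n \<le> N" for n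
  proof -
    have "A n = space M - H n" by (auto simp: A_def H_def not_less)
    thus ?thesis using HM[OF that] by simp
  qed
  have BM: "B n \<in> sets M" and EM: "E n \<in> sets M" if "Suc n \<le> N" for n
  proof -
    have [measurable]: "H n \<in> sets M" "Z (Suc n) \<in> borel_measurable M" using HM[of n] ZM that by auto
    show "B n \<in> sets M" "E n \<in> sets M" unfolding B_def E_def by measurable
  qed
  have si: "set_integrable M S (Z n)" if "S \<in> sets M" "n \<le> N" for S n
    unfolding set_integrable_def using int that by (intro integrable_mult_indicator) auto
  have ci: "set_integrable M S (\<lambda>_. d::real)" if "S \<in> sets M" for S d
    unfolding set_integrable_def using that by (intro integrable_mult_indicator) auto
  have cI: "(LINT \<omega>:S|M. d) = d * prob S" if "S \<in> sets M" for S and d :: real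
    using that by (simp add: set_lebesgue_integral_def)
  have A_Suc: "prob (A (Suc n)) = prob (A n) + prob (B n)" if "Suc n \<le> N" for n
  proof -
    have "A (Suc n) = A n \<union> B n" by (auto simp: A_def B_def H_def le_Suc_eq not_less)
    moreover have "A n \<inter> B n = {}" by (force simp: A_def B_def H_def)
    ultimately show ?thesis using AM[of n] BM[of n] that
      by (auto simp: finite_measure_Union)
  qed
  \<comment> \<open>The event \<open>H n\<close> is known at time \<open>n\<close>, so
    \<open>Z n\<close> may be replaced by \<open>Z (Suc n)\<close> on it; the event then splits
    according to whether this step crosses \<open>c\<close>.\<close>
  have H_Suc: "(LINT \<omega>:H n|M. Z n \<omega>) = (LINT \<omega>:H (Suc n)|M. Z (Suc n) \<omega>) + (LINT \<omega>:B n|M. Z (Suc n) \<omega>)"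
    if "Suc n \<le> N" for n
  proof -
    have "(LINT \<omega>:H n|M. Z n \<omega>) = (LINT \<omega>:H n|M. Z (Suc n) \<omega>)"
      using mart[OF that H_F[of n]] that by simp
    moreover have "H n = H (Suc n) \<union> B n" by (auto simp: B_def H_def le_Suc_eq not_less)
    moreover have "H (Suc n) \<inter> B n = {}" by (force simp: B_def H_def)
    ultimately show ?thesis using si HM[of "Suc n"] BM[of n] that
      by (simp add: set_integral_Un)
  qed
  \<comment> \<open>By the martingale property the integral over \<open>O' n\<close> is carried
    along unchanged, while new large overshoots are added. All of them end up in one integral of
    \<open>Z N\<close>.\<close>
  have O_Suc: "(LINT \<omega>:O' (Suc n)|M. Z (Suc n) \<omega>) = (LINT \<omega>:O' n|M. Z n \<omega>) + (LINT \<omega>:E n|M. Z (Suc n) \<omega>)"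
    if "Suc n \<le> N" for n
  proof -
    have "(LINT \<omega>:O' n|M. Z n \<omega>) = (LINT \<omega>:O' n|M. Z (Suc n) \<omega>)"
      using mart[OF that O_F[of n]] that by simp
    moreover have "O' (Suc n) = O' n \<union> E n" by (auto simp: O'_def E_def H_def less_Suc_eq)
    moreover have "O' n \<inter> E n = {}"
    proof -
      have False if "i < n" "c + \<epsilon> < Z (Suc i) \<omega>" "\<forall>i\<le>n. Z i \<omega> < c" for i \<omega>
        using that(2) that(3)[rule_format, of "Suc i"] that(1) e by simp
      thus ?thesis by (auto simp: O'_def H_def E_def)
    qed
    ultimately show ?thesis using si OM[of n] EM[of n] that
      by (simp add: set_integral_Un)
  qed
  have B_low: "c * prob (B n) \<le> (LINT \<omega>:B n|M. Z (Suc n) \<omega>)" if "Suc n \<le> N" for n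
  proof -
    have "(LINT \<omega>:B n|M. c) \<le> (LINT \<omega>:B n|M. Z (Suc n) \<omega>)"
      using BM that si ci by (intro set_integral_mono) (auto simp: B_def)
    thus ?thesis using cI BM that by simp
  qed
  have B_up: "(LINT \<omega>:B n|M. Z (Suc n) \<omega>) \<le> (c + \<epsilon>) * prob (B n) + (LINT \<omega>:E n|M. Z (Suc n) \<omega>)"
    if "Suc n \<le> N" for n
  proof -
    have "(LINT \<omega>:B n|M. Z (Suc n) \<omega>) = (LINT \<omega>|M. indicator (B n) \<omega> * Z (Suc n) \<omega>)"
      by (simp add: set_lebesgue_integral_def)
    also have "\<dots> \<le> (LINT \<omega>|M. indicator (B n) \<omega> * (c + \<epsilon>) + indicator (E n) \<omega> * Z (Suc n) \<omega>)"
    proof (rule integral_mono)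
      show "integrable M (\<lambda>\<omega>. indicator (B n) \<omega> * Z (Suc n) \<omega>)"
        using si[OF BM[OF that] that] by (simp add: set_integrable_def)
      show "integrable M (\<lambda>\<omega>. indicator (B n) \<omega> * (c + \<epsilon>) + indicator (E n) \<omega> * Z (Suc n) \<omega>)"
        using si[OF EM[OF that] that] ci[OF BM[OF that], of "c + \<epsilon>"]
        unfolding set_integrable_def by (intro Bochner_Integration.integrable_add) simp_all
      fix \<omega> assume "\<omega> \<in> space M"
      then show "indicator (B n) \<omega> * Z (Suc n) \<omega> \<le> indicator (B n) \<omega> * (c + \<epsilon>) + indicator (E n) \<omega> * Z (Suc n) \<omega>"
        using nonneg[OF that] c e by (auto simp: indicator_def B_def E_def)
    qed
    also have "\<dots> = (c + \<epsilon>) * prob (B n) + (LINT \<omega>:E n|M. Z (Suc n) \<omega>)"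
      using si[OF EM[OF that] that] ci[OF BM[OF that], of "c + \<epsilon>"] cI[OF BM[OF that], of "c + \<epsilon>"]
      unfolding set_integrable_def set_lebesgue_integral_def
      by (subst Bochner_Integration.integral_add) simp_all
    finally show ?thesis .
  qed
  have base: "expectation (\<lambda>\<omega>. min c (Z 0 \<omega>)) = c * prob (A 0) + (LINT \<omega>:H 0|M. Z 0 \<omega>)"
  proof -
    have "expectation (\<lambda>\<omega>. min c (Z 0 \<omega>)) = (LINT \<omega>|M. indicator (A 0) \<omega> * c + indicator (H 0) \<omega> * Z 0 \<omega>)"
      by (intro Bochner_Integration.integral_cong refl) (auto simp: indicator_def A_def H_def)
    also have "\<dots> = c * prob (A 0) + (LINT \<omega>:H 0|M. Z 0 \<omega>)"
      using si[OF HM[of 0], of 0] ci[OF AM[of 0], of c] cI[OF AM[of 0], of c]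
      unfolding set_integrable_def set_lebesgue_integral_def
      by (subst Bochner_Integration.integral_add) simp_all
    finally show ?thesis .
  qed
  have low: "c * prob (A n) + (LINT \<omega>:H n|M. Z n \<omega>) \<le> expectation (\<lambda>\<omega>. min c (Z 0 \<omega>))"
    if "n \<le> N" for n using that
  proof (induction n)
    case (Suc n)
    then show ?case using A_Suc[of n] H_Suc[of n] B_low[of n] by (simp add: algebra_simps)
  qed (simp add: base)
  have up: "expectation (\<lambda>\<omega>. min c (Z 0 \<omega>)) \<le>
      (c + \<epsilon>) * prob (A n) + (LINT \<omega>:H n|M. Z n \<omega>) + (LINT \<omega>:O' n|M. Z n \<omega>)"
    if "n \<le> N" for n using that
  proof (induction n)
    case 0
    have "O' 0 = {}" by (simp add: O'_def)
    then show ?case using e by (simp add: base set_lebesgue_integral_def distrib_right)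
  next
    case (Suc n)
    then show ?case using A_Suc[of n] H_Suc[of n] B_up[of n] O_Suc[of n]
      by (simp add: algebra_simps)
  qed
  have "0 \<le> (LINT \<omega>:H N|M. Z N \<omega>)"
    unfolding set_lebesgue_integral_def
    by (intro Bochner_Integration.integral_nonneg) (auto simp: nonneg indicator_def)
  with low[of N] show ?thesis1 by (simp add: A_def)
  have "(LINT \<omega>:H N|M. Z N \<omega>) \<le> expectation (\<lambda>\<omega>. min c (Z N \<omega>))"
    unfolding set_lebesgue_integral_def
  proof (rule integral_mono)
    show "integrable M (\<lambda>\<omega>. indicator (H N) \<omega> *\<^sub>R Z N \<omega>)"
      using si[OF HM[of N], of N] by (simp add: set_integrable_def)
    show "integrable M (\<lambda>\<omega>. min c (Z N \<omega>))" using int by simp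
    show "indicator (H N) \<omega> *\<^sub>R Z N \<omega> \<le> min c (Z N \<omega>)" if "\<omega> \<in> space M" for \<omega>
      using nonneg[of N \<omega>] c that by (auto simp: indicator_def H_def)
  qed
  \<comment> \<open>Passing from below \<open>c\<close> to above \<open>c + \<epsilon>\<close> in
    one step takes an increment above \<open>\<epsilon>\<close>; the larger event no longer refers
    to \<open>c\<close>.\<close>
  moreover have "(LINT \<omega>:O' N|M. Z N \<omega>) \<le> (LINT \<omega>:{\<omega>\<in>space M. \<exists>i<N. \<epsilon> < Z (Suc i) \<omega> - Z i \<omega>}|M. Z N \<omega>)"
    unfolding set_lebesgue_integral_def
  proof (rule integral_mono)
    have [measurable]: "Z n \<in> borel_measurable M" if "n \<le> N" for n using ZM that .
    have "{\<omega>\<in>space M. \<epsilon> < Z (Suc i) \<omega> - Z i \<omega>} \<in> sets M" if "i < N" for i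
    proof -
      have [measurable]: "Z i \<in> borel_measurable M" "Z (Suc i) \<in> borel_measurable M" using ZM that by auto
      show ?thesis by measurable
    qed
    hence "(\<Union>i\<in>{..<N}. {\<omega>\<in>space M. \<epsilon> < Z (Suc i) \<omega> - Z i \<omega>}) \<in> sets M"
      by (intro sets.finite_UN) auto
    also have "(\<Union>i\<in>{..<N}. {\<omega>\<in>space M. \<epsilon> < Z (Suc i) \<omega> - Z i \<omega>}) = {\<omega>\<in>space M. \<exists>i<N. \<epsilon> < Z (Suc i) \<omega> - Z i \<omega>}"
      by auto
    finally show "integrable M (\<lambda>\<omega>. indicator {\<omega>\<in>space M. \<exists>i<N. \<epsilon> < Z (Suc i) \<omega> - Z i \<omega>} \<omega> *\<^sub>R Z N \<omega>)"
      using si by (simp add: set_integrable_def)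
    show "integrable M (\<lambda>\<omega>. indicator (O' N) \<omega> *\<^sub>R Z N \<omega>)"
      using si[OF OM[of N], of N] by (simp add: set_integrable_def)
    show "indicator (O' N) \<omega> *\<^sub>R Z N \<omega> \<le> indicator {\<omega>\<in>space M. \<exists>i<N. \<epsilon> < Z (Suc i) \<omega> - Z i \<omega>} \<omega> *\<^sub>R Z N \<omega>"
      if "\<omega> \<in> space M" for \<omega>
      using nonneg[of N \<omega>] that by (force simp: indicator_def O'_def)
  qed
  ultimately show ?thesis2 using up[of N] by (simp add: A_def)
qed


text \<open>The discrete bounds are applied on grids of \<open>{a..T}\<close>; continuity removes
  the overshoot as the grid is refined, and then \<open>T\<close> tends to \<open>b\<close>. The
  mean of \<open>Y\<close> stays constant, so \<open>Y\<close> does not tend to \<open>0\<close> in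
  mean in general; it is the truncation \<open>min c\<close> that lets almost sure convergence
  suffice, with \<open>c\<close> as dominating constant.\<close>

lemma continuous_maximal_equality:
  fixes Y :: "real \<Rightarrow> 'a \<Rightarrow> real" and F :: "real \<Rightarrow> 'a measure"
  assumes ab: "a < b" and c: "0 < c"
    and sub: "\<And>u. a \<le> u \<Longrightarrow> u < b \<Longrightarrow> subalgebra M (F u)"
    and meas: "\<And>u v. a \<le> u \<Longrightarrow> u \<le> v \<Longrightarrow> v < b \<Longrightarrow> Y u \<in> borel_measurable (F v)"
    and nonneg: "\<And>u \<omega>. a \<le> u \<Longrightarrow> u < b \<Longrightarrow> \<omega> \<in> space M \<Longrightarrow> 0 \<le> Y u \<omega>"
    and int: "\<And>u. a \<le> u \<Longrightarrow> u < b \<Longrightarrow> integrable M (Y u)"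
    and mart: "\<And>u v A. a \<le> u \<Longrightarrow> u \<le> v \<Longrightarrow> v < b \<Longrightarrow> A \<in> sets (F u) \<Longrightarrow>
      (LINT \<omega>:A|M. Y v \<omega>) = (LINT \<omega>:A|M. Y u \<omega>)"
    and cont: "\<And>\<omega>. \<omega> \<in> space M \<Longrightarrow> continuous_on {a..<b} (\<lambda>u. Y u \<omega>)"
    and lim: "AE \<omega> in M. ((\<lambda>u. Y u \<omega>) \<longlongrightarrow> 0) (at_left b)"
  shows "{\<omega>\<in>space M. \<exists>u\<in>{a..<b}. c \<le> Y u \<omega>} \<in> events"
    and "c * prob {\<omega>\<in>space M. \<exists>u\<in>{a..<b}. c \<le> Y u \<omega>} = expectation (\<lambda>\<omega>. min c (Y a \<omega>))"
proof -
  define S where "S = {\<omega>\<in>space M. \<exists>u\<in>{a..<b}. c \<le> Y u \<omega>}"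
  define ST where "ST T = {\<omega>\<in>space M. \<exists>u\<in>{a..T}. c \<le> Y u \<omega>}" for T
  \<comment> \<open>\<open>Suc N\<close> steps: the denominator is never zero, and index
    \<open>Suc N\<close> is exactly \<open>T\<close>.\<close>
  define gr where "gr T N i = a + (T - a) * real i / real (Suc N)" for T N i
  define D where "D T N c' = {\<omega>\<in>space M. \<exists>i\<le>Suc N. c' \<le> Y (gr T N i) \<omega>}" for T N c'
  \<comment> \<open>The denominator starts at 2, so that already \<open>tn 0\<close> lies strictly
    above \<open>a\<close>.\<close>
  define tn where "tn n = b - (b - a) / real (Suc (Suc n))" for n
  have YM: "Y u \<in> borel_measurable M" if "a \<le> u" "u < b" for u
    using int[OF that] by (rule borel_measurable_integrable)
  have gr_le: "a \<le> gr T N i" if "a \<le> T" for T N i using that by (simp add: gr_def)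
  have gr_mono: "gr T N i \<le> gr T N j" if "a \<le> T" "i \<le> j" for T N i j
    using that by (simp add: gr_def divide_right_mono mult_left_mono)
  have gr_Suc: "gr T N (Suc N) = T" for T N by (simp add: gr_def)
  have gr_0: "gr T N 0 = a" for T N by (simp add: gr_def)
  have gr_T: "gr T N i \<le> T" if "a \<le> T" "i \<le> Suc N" for T N i
    using gr_mono[OF that, of N] by (simp add: gr_Suc)
  have DM: "D T N c' \<in> events" if "a \<le> T" "T < b" for T N c'
  proof -
    have "{\<omega>\<in>space M. c' \<le> Y (gr T N i) \<omega>} \<in> events" if "i \<le> Suc N" for i
    proof -
      have [measurable]: "Y (gr T N i) \<in> borel_measurable M"
        using YM gr_le gr_T \<open>a \<le> T\<close> \<open>T < b\<close> that by (meson le_less_trans)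
      show ?thesis by measurable
    qed
    hence "(\<Union>i\<in>{..Suc N}. {\<omega>\<in>space M. c' \<le> Y (gr T N i) \<omega>}) \<in> events"
      by (intro sets.finite_UN) auto
    also have "(\<Union>i\<in>{..Suc N}. {\<omega>\<in>space M. c' \<le> Y (gr T N i) \<omega>}) = D T N c'" by (auto simp: D_def)
    finally show ?thesis .
  qed
  have gr_step: "gr T N (Suc i) - gr T N i = (T - a) / real (Suc N)" for T N i
    by (simp add: gr_def distrib_left add_divide_distrib)
  have contT: "continuous_on {a..T} (\<lambda>u. Y u \<omega>)" if "T < b" "\<omega> \<in> space M" for T \<omega>
    using cont[OF that(2)] by (rule continuous_on_subset) (use that in auto)
  have step_small: "eventually (\<lambda>N. (T - a) / real (Suc N) < d) sequentially" if "0 < d" for T d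
  proof -
    have "(\<lambda>N. (T - a) / real (Suc N)) \<longlonglongrightarrow> 0" by real_asymp
    thus ?thesis using that by (rule order_tendstoD)
  qed
  have ev_D: "eventually (\<lambda>N. \<omega> \<in> D T N c') sequentially"
    if "\<omega> \<in> ST T" "a < T" "T < b" "c' < c" for \<omega> T c'
  proof -
    obtain u where u: "a \<le> u" "u \<le> T" "c \<le> Y u \<omega>" and w: "\<omega> \<in> space M" using \<open>\<omega> \<in> ST T\<close> by (auto simp: ST_def)
    have "continuous (at u within {a..T}) (\<lambda>u. Y u \<omega>)"
      using contT[OF \<open>T < b\<close> w] u by (simp add: continuous_on_eq_continuous_within)
    then obtain d where d: "0 < d" "\<And>v. v \<in> {a..T} \<Longrightarrow> dist v u < d \<Longrightarrow> dist (Y v \<omega>) (Y u \<omega>) < c - c'"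
      unfolding continuous_within_eps_delta using \<open>c' < c\<close> by (metis diff_gt_0_iff_gt)
    show ?thesis using step_small[OF d(1), of T]
    proof eventually_elim
      case (elim N)
      \<comment> \<open>Index of the last grid point not after \<open>u\<close>; it is less than one
        grid step away from \<open>u\<close>.\<close>
      define i where "i = nat \<lfloor>(u - a) / (T - a) * real (Suc N)\<rfloor>"
      define r where "r = (u - a) / (T - a) * real (Suc N)"
      have r: "0 \<le> r" "r \<le> real (Suc N)" using u that
        by (auto simp: r_def divide_simps mult_le_cancel_right)
      have i: "real i \<le> r" "r < real i + 1" using r(1) unfolding i_def r_def[symmetric] by linarith+
      have "i \<le> Suc N" using i r by linarith
      have "(T - a) * r / real (Suc N) = u - a"
        using that by (simp add: r_def del: of_nat_Suc)
      hence "u - gr T N i = (T - a) * r / real (Suc N) - (T - a) * real i / real (Suc N)"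
        by (simp add: gr_def)
      hence "u - gr T N i = (T - a) / real (Suc N) * (r - real i)"
        by (simp only: times_divide_eq_left right_diff_distrib[of "T - a"] diff_divide_distrib[of "(T - a) * r"])
      moreover have "(T - a) / real (Suc N) * (r - real i) \<le> (T - a) / real (Suc N) * 1"
        using i that by (intro mult_left_mono) auto
      moreover have "0 \<le> (T - a) / real (Suc N) * (r - real i)" using i that by (intro mult_nonneg_nonneg) auto
      ultimately have "dist (gr T N i) u < d" using elim by (simp add: dist_real_def)
      hence "dist (Y (gr T N i) \<omega>) (Y u \<omega>) < c - c'"
        using d(2) gr_le gr_T \<open>i \<le> Suc N\<close> that by simp
      hence "c' \<le> Y (gr T N i) \<omega>" using u by (simp add: dist_real_def)
      thus ?case using \<open>i \<le> Suc N\<close> w by (auto simp: D_def)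
    qed
  qed
  \<comment> \<open>Grid points detect only levels slightly below \<open>c\<close>. Conversely, the
    maximum of the path over the compact interval exceeds or equals every
    \<open>c - 1 / real (Suc k)\<close>, hence is at least \<open>c\<close>. Measurability of
    \<open>ST T\<close> follows.\<close>
  have ST_eq: "ST T = (\<Inter>k. \<Union>N. D T N (c - 1 / real (Suc k)))" if T: "a < T" "T < b" for T
  proof (intro equalityI subsetI INT_I)
    fix \<omega> k assume "\<omega> \<in> ST T"
    from ev_D[OF this T, of "c - 1 / real (Suc k)"] have "\<exists>N. \<omega> \<in> D T N (c - 1 / real (Suc k))"
      by (auto dest: eventually_happens)
    thus "\<omega> \<in> (\<Union>N. D T N (c - 1 / real (Suc k)))" by blast
  next
    fix \<omega> assume *: "\<omega> \<in> (\<Inter>k. \<Union>N. D T N (c - 1 / real (Suc k)))"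
    hence w: "\<omega> \<in> space M" by (auto simp: D_def)
    obtain u where u: "u \<in> {a..T}" "\<And>v. v \<in> {a..T} \<Longrightarrow> Y v \<omega> \<le> Y u \<omega>"
      using continuous_attains_sup[of "{a..T}" "\<lambda>u. Y u \<omega>"] contT[OF T(2) w] T by auto
    have "c - 1 / real (Suc k) \<le> Y u \<omega>" for k
    proof -
      from * obtain N where "\<omega> \<in> D T N (c - 1 / real (Suc k))" by blast
      then obtain i where "i \<le> Suc N" "c - 1 / real (Suc k) \<le> Y (gr T N i) \<omega>" by (auto simp: D_def)
      moreover have "Y (gr T N i) \<omega> \<le> Y u \<omega>" using u(2) gr_le gr_T T \<open>i \<le> Suc N\<close> by simp
      ultimately show ?thesis by linarith
    qed
    moreover have "(\<lambda>k. c - 1 / real (Suc k)) \<longlonglongrightarrow> c" by real_asymp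
    ultimately have "c \<le> Y u \<omega>" by (intro LIMSEQ_le_const2) auto
    thus "\<omega> \<in> ST T" using u w by (auto simp: ST_def)
  qed
  have STM: "ST T \<in> events" if T: "a < T" "T < b" for T
    unfolding ST_eq[OF T] using DM T by (intro sets.countable_INT sets.countable_UN) auto
  have tn: "a < tn n" "tn n < b" for n
  proof -
    have "(b - a) / real (Suc (Suc n)) < (b - a) / 1"
      using ab by (intro divide_strict_left_mono) auto
    thus "a < tn n" "tn n < b" using ab by (auto simp: tn_def)
  qed
  have tn_lim: "tn \<longlonglongrightarrow> b" unfolding tn_def by real_asymp
  have tn_mono: "tn m \<le> tn n" if "m \<le> n" for m n
    using that ab by (auto simp: tn_def intro!: divide_left_mono)
  have S_eq: "S = (\<Union>n. ST (tn n))"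
  proof (intro equalityI subsetI)
    fix \<omega> assume "\<omega> \<in> S"
    then obtain u where u: "a \<le> u" "u < b" "c \<le> Y u \<omega>" "\<omega> \<in> space M" by (auto simp: S_def)
    from order_tendstoD(1)[OF tn_lim u(2)] obtain n where "u < tn n"
      by (auto dest: eventually_happens)
    with u have "\<omega> \<in> ST (tn n)" unfolding ST_def by (intro CollectI conjI bexI[of _ u]) auto
    thus "\<omega> \<in> (\<Union>n. ST (tn n))" by blast
  next
    fix \<omega> assume "\<omega> \<in> (\<Union>n. ST (tn n))"
    then obtain n u where "u \<in> {a..tn n}" "c \<le> Y u \<omega>" "\<omega> \<in> space M" by (auto simp: ST_def)
    with tn(2)[of n] show "\<omega> \<in> S" unfolding S_def by (intro CollectI conjI bexI[of _ u]) auto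
  qed
  show SM: "{\<omega>\<in>space M. \<exists>u\<in>{a..<b}. c \<le> Y u \<omega>} \<in> events"
    using STM tn S_eq unfolding S_def[symmetric] by auto

  let ?e = "expectation (\<lambda>\<omega>. min c (Y a \<omega>))"
  have disc1: "c' * prob (D T N c') \<le> expectation (\<lambda>\<omega>. min c' (Y a \<omega>))"
    and disc2: "0 \<le> \<epsilon> \<Longrightarrow> expectation (\<lambda>\<omega>. min c' (Y a \<omega>)) \<le> (c' + \<epsilon>) * prob (D T N c')
      + expectation (\<lambda>\<omega>. min c' (Y T \<omega>))
      + (LINT \<omega>:{\<omega>\<in>space M. \<exists>i<Suc N. \<epsilon> < Y (gr T N (Suc i)) \<omega> - Y (gr T N i) \<omega>}|M. Y T \<omega>)"
    if T: "a < T" "T < b" and "0 < c'" for T N c' \<epsilon>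
  proof -
    have g: "a \<le> gr T N i" for i
      using gr_le[of T N i] T by auto
    have gm: "gr T N i \<le> gr T N j" if "i \<le> j" for i j
      using gr_mono[of T i j N] T that by auto
    have g': "gr T N i < b" if "i \<le> Suc N" for i
      using gr_T[of T i N] T that by auto
    show "c' * prob (D T N c') \<le> expectation (\<lambda>\<omega>. min c' (Y a \<omega>))"
      unfolding D_def
      by (rule discrete_maximal_bounds(1)[where Z="\<lambda>i. Y (gr T N i)" and F="\<lambda>i. F (gr T N i)" and \<epsilon>=0
            and N="Suc N" and c=c', unfolded gr_0 gr_Suc])
         (use g gm g' \<open>0 < c'\<close> in \<open>auto intro!: sub meas int mart nonneg\<close>)
    show "expectation (\<lambda>\<omega>. min c' (Y a \<omega>)) \<le> (c' + \<epsilon>) * prob (D T N c')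
      + expectation (\<lambda>\<omega>. min c' (Y T \<omega>))
      + (LINT \<omega>:{\<omega>\<in>space M. \<exists>i<Suc N. \<epsilon> < Y (gr T N (Suc i)) \<omega> - Y (gr T N i) \<omega>}|M. Y T \<omega>)"
      if "0 \<le> \<epsilon>"
      unfolding D_def
      by (rule discrete_maximal_bounds(2)[where Z="\<lambda>i. Y (gr T N i)" and F="\<lambda>i. F (gr T N i)" and \<epsilon>=\<epsilon>
            and N="Suc N" and c=c', unfolded gr_0 gr_Suc])
         (use g gm g' \<open>0 < c'\<close> that in \<open>auto intro!: sub meas int mart nonneg\<close>)
  qed

  \<comment> \<open>A path that merely touches \<open>c\<close> between grid points may be missed by
    every grid at level \<open>c\<close>. The bound is therefore taken at level \<open>z * c\<close>
    with \<open>z < 1\<close>, which fine grids do detect.\<close>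
  have low_T: "c * prob (ST T) \<le> ?e" if T: "a < T" "T < b" for T
  proof (rule field_le_mult_one_interval)
    fix z :: real assume z: "0 < z" "z < 1"
    have "(\<lambda>N. prob (ST T \<inter> D T N (z * c))) \<longlonglongrightarrow> prob (ST T)"
    proof -
      have "(\<lambda>N. expectation (indicator (ST T \<inter> D T N (z * c)) :: 'a \<Rightarrow> real)) \<longlonglongrightarrow> expectation (indicator (ST T))"
      proof (rule integral_dominated_convergence[where w="\<lambda>_. 1"])
        show "AE \<omega> in M. (\<lambda>N. indicator (ST T \<inter> D T N (z * c)) \<omega> :: real) \<longlonglongrightarrow> indicator (ST T) \<omega>"
        proof (rule AE_I2)
          fix \<omega>
          show "(\<lambda>N. indicator (ST T \<inter> D T N (z * c)) \<omega> :: real) \<longlonglongrightarrow> indicator (ST T) \<omega>"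
          proof (cases "\<omega> \<in> ST T")
            case True
            have "eventually (\<lambda>N. \<omega> \<in> D T N (z * c)) sequentially"
              using ev_D[OF True T, of "z * c"] z c by simp
            hence "eventually (\<lambda>N. (indicator (ST T \<inter> D T N (z * c)) \<omega> :: real) = indicator (ST T) \<omega>) sequentially"
              by eventually_elim (use True in auto)
            thus ?thesis by (rule tendsto_eventually)
          qed simp
        qed
      qed (use STM[OF T] DM[of T] T in \<open>auto simp: indicator_def\<close>)
      thus ?thesis using STM[OF T] DM[of T] T by (simp add: sets.Int)
    qed
    hence "(\<lambda>N. (z * c) * prob (ST T \<inter> D T N (z * c))) \<longlonglongrightarrow> (z * c) * prob (ST T)"
      by (intro tendsto_intros)
    moreover have "(z * c) * prob (ST T \<inter> D T N (z * c)) \<le> ?e" for N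
    proof -
      have "(z * c) * prob (ST T \<inter> D T N (z * c)) \<le> (z * c) * prob (D T N (z * c))"
        using z c DM[of T] T by (intro mult_left_mono finite_measure_mono) auto
      also have "\<dots> \<le> expectation (\<lambda>\<omega>. min (z * c) (Y a \<omega>))" using disc1[OF T] z c by simp
      also have "\<dots> \<le> ?e"
      proof (rule integral_mono)
        have "z * c \<le> c" using z c by simp
        thus "min (z * c) (Y a \<omega>) \<le> min c (Y a \<omega>)" for \<omega> by linarith
      qed (use int[of a] ab in auto)
      finally show ?thesis .
    qed
    ultimately have "(z * c) * prob (ST T) \<le> ?e" by (intro LIMSEQ_le_const2) auto
    thus "z * (c * prob (ST T)) \<le> ?e" by (simp add: mult.assoc)
  qed
  have "(\<lambda>n. prob (ST (tn n))) \<longlonglongrightarrow> prob (\<Union>n. ST (tn n))"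
  proof (rule finite_Lim_measure_incseq)
    show "incseq (\<lambda>n. ST (tn n))"
    proof (rule monoI)
      show "ST (tn m) \<subseteq> ST (tn n)" if "m \<le> n" for m n using tn_mono[OF that] by (force simp: ST_def)
    qed
  qed (use STM tn in auto)
  hence "(\<lambda>n. c * prob (ST (tn n))) \<longlonglongrightarrow> c * prob S" unfolding S_eq by (intro tendsto_intros)
  hence low: "c * prob S \<le> ?e" by (rule LIMSEQ_le_const2) (use low_T tn in auto)

  have up_T: "?e \<le> (c + \<epsilon>) * prob S + expectation (\<lambda>\<omega>. min c (Y T \<omega>))"
    if T: "a < T" "T < b" and e: "0 < \<epsilon>" for T \<epsilon>
  proof -
    define Os where "Os N = {\<omega>\<in>space M. \<exists>i<Suc N. \<epsilon> < Y (gr T N (Suc i)) \<omega> - Y (gr T N i) \<omega>}" for N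
    have OsM: "Os N \<in> events" for N
    proof -
      have "{\<omega>\<in>space M. \<epsilon> < Y (gr T N (Suc i)) \<omega> - Y (gr T N i) \<omega>} \<in> events" if "i < Suc N" for i
      proof -
        have [measurable]: "Y (gr T N i) \<in> borel_measurable M" "Y (gr T N (Suc i)) \<in> borel_measurable M"
          using YM gr_le[of T N] gr_T[of T i N] gr_T[of T "Suc i" N] T that by auto
        show ?thesis by measurable
      qed
      hence "(\<Union>i\<in>{..<Suc N}. {\<omega>\<in>space M. \<epsilon> < Y (gr T N (Suc i)) \<omega> - Y (gr T N i) \<omega>}) \<in> events"
        by (intro sets.finite_UN) auto
      also have "(\<Union>i\<in>{..<Suc N}. {\<omega>\<in>space M. \<epsilon> < Y (gr T N (Suc i)) \<omega> - Y (gr T N i) \<omega>}) = Os N"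
        by (auto simp: Os_def)
      finally show ?thesis .
    qed
    \<comment> \<open>By uniform continuity on \<open>{a..T}\<close>, each path leaves
      \<open>Os N\<close> once the grid is fine enough; \<open>Y T\<close> dominates.\<close>
    have "(\<lambda>N. LINT \<omega>:Os N|M. Y T \<omega>) \<longlonglongrightarrow> (LINT \<omega>|M. 0)"
      unfolding set_lebesgue_integral_def
    proof (rule integral_dominated_convergence[where w="Y T"])
      show "AE \<omega> in M. (\<lambda>N. indicator (Os N) \<omega> *\<^sub>R Y T \<omega>) \<longlonglongrightarrow> 0"
      proof (rule AE_I2)
        fix \<omega> assume w: "\<omega> \<in> space M"
        have "uniformly_continuous_on {a..T} (\<lambda>u. Y u \<omega>)"
          using contT[OF T(2) w] by (rule compact_uniformly_continuous) auto
        then obtain d where d: "0 < d"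
          "\<And>u v. u \<in> {a..T} \<Longrightarrow> v \<in> {a..T} \<Longrightarrow> dist v u < d \<Longrightarrow> dist (Y v \<omega>) (Y u \<omega>) < \<epsilon>"
          unfolding uniformly_continuous_on_def using e by metis
        have "eventually (\<lambda>N. indicator (Os N) \<omega> *\<^sub>R Y T \<omega> = 0) sequentially"
          using step_small[OF d(1), of T]
        proof eventually_elim
          case (elim N)
          have "\<not> \<epsilon> < Y (gr T N (Suc i)) \<omega> - Y (gr T N i) \<omega>" if "i < Suc N" for i
          proof -
            have "dist (gr T N (Suc i)) (gr T N i) < d"
              using elim T unfolding dist_real_def gr_step by simp
            hence "dist (Y (gr T N (Suc i)) \<omega>) (Y (gr T N i) \<omega>) < \<epsilon>"
              using gr_le[of T N] gr_T[of T i N] gr_T[of T "Suc i" N] T that by (intro d(2)) auto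
            thus ?thesis by (simp add: dist_real_def)
          qed
          hence "\<omega> \<notin> Os N" by (auto simp: Os_def)
          thus ?case by simp
        qed
        thus "(\<lambda>N. indicator (Os N) \<omega> *\<^sub>R Y T \<omega>) \<longlonglongrightarrow> 0" by (rule tendsto_eventually)
      qed
      show "AE \<omega> in M. norm (indicator (Os N) \<omega> *\<^sub>R Y T \<omega>) \<le> Y T \<omega>" for N
        using nonneg[of T] T by (intro AE_I2) (auto simp: indicator_def)
      show "(\<lambda>\<omega>. indicator (Os N) \<omega> *\<^sub>R Y T \<omega>) \<in> borel_measurable M" for N
        using OsM YM[of T] T by (intro borel_measurable_scaleR borel_measurable_indicator) auto
      show "integrable M (Y T)" using int[of T] T by simp
    qed simp
    hence "(\<lambda>N. (c + \<epsilon>) * prob S + expectation (\<lambda>\<omega>. min c (Y T \<omega>)) + (LINT \<omega>:Os N|M. Y T \<omega>))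
        \<longlonglongrightarrow> (c + \<epsilon>) * prob S + expectation (\<lambda>\<omega>. min c (Y T \<omega>)) + (LINT \<omega>|M. 0)"
      by (intro tendsto_intros)
    moreover have "?e \<le> (c + \<epsilon>) * prob S + expectation (\<lambda>\<omega>. min c (Y T \<omega>)) + (LINT \<omega>:Os N|M. Y T \<omega>)" for N
    proof -
      have "D T N c \<subseteq> S"
      proof
        fix \<omega> assume "\<omega> \<in> D T N c"
        then obtain i where "i \<le> Suc N" "c \<le> Y (gr T N i) \<omega>" "\<omega> \<in> space M" by (auto simp: D_def)
        thus "\<omega> \<in> S" using gr_le[of T N i] gr_T[of T i N] T unfolding S_def
          by (intro CollectI conjI bexI[of _ "gr T N i"]) auto
      qed
      hence "prob (D T N c) \<le> prob S" using SM by (intro finite_measure_mono) (auto simp: S_def)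
      hence "(c + \<epsilon>) * prob (D T N c) \<le> (c + \<epsilon>) * prob S" using c e by (intro mult_left_mono) auto
      thus ?thesis using disc2[OF T c, of \<epsilon> N] e by (simp add: Os_def)
    qed
    ultimately show ?thesis by (intro LIMSEQ_le_const[of _ _ ?e]) auto
  qed
  have "(\<lambda>n. expectation (\<lambda>\<omega>. min c (Y (tn n) \<omega>))) \<longlonglongrightarrow> (LINT \<omega>|M. 0)"
  proof (rule integral_dominated_convergence[where w="\<lambda>_. c"])
    show "AE \<omega> in M. (\<lambda>n. min c (Y (tn n) \<omega>)) \<longlonglongrightarrow> 0"
      using lim
    proof eventually_elim
      case (elim \<omega>)
      have "filterlim tn (at_left b) sequentially"
        unfolding filterlim_at using tn_lim tn(2) less_imp_neq[OF tn(2)] by simp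
      from filterlim_compose[OF elim this] have "(\<lambda>n. min c (Y (tn n) \<omega>)) \<longlonglongrightarrow> min c 0"
        by (intro tendsto_intros)
      thus ?case using c by simp
    qed
    show "AE \<omega> in M. norm (min c (Y (tn n) \<omega>)) \<le> c" for n
      using nonneg[of "tn n"] tn[of n] c by (intro AE_I2) (auto simp: min_def)
    show "(\<lambda>\<omega>. min c (Y (tn n) \<omega>)) \<in> borel_measurable M" for n
    proof -
      have [measurable]: "Y (tn n) \<in> borel_measurable M" using YM[of "tn n"] tn[of n] by auto
      show ?thesis by measurable
    qed
  qed auto
  hence lim0: "(\<lambda>n. (c + \<epsilon>) * prob S + expectation (\<lambda>\<omega>. min c (Y (tn n) \<omega>))) \<longlonglongrightarrow> (c + \<epsilon>) * prob S + 0" for \<epsilon>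
    by (intro tendsto_intros) simp
  have up_e: "?e \<le> (c + \<epsilon>) * prob S" if "0 < \<epsilon>" for \<epsilon>
    using LIMSEQ_le_const[OF lim0, of ?e \<epsilon>] up_T[OF tn that] by auto
  have "?e \<le> c * prob S"
  proof (rule field_le_epsilon)
    fix \<epsilon> :: real assume "0 < \<epsilon>"
    from up_e[OF this] have "?e \<le> c * prob S + \<epsilon> * prob S" by (simp add: algebra_simps)
    also have "\<epsilon> * prob S \<le> \<epsilon>" using \<open>0 < \<epsilon>\<close> by simp
    finally show "?e \<le> c * prob S + \<epsilon>" by simp
  qed
  with low show "c * prob {\<omega>\<in>space M. \<exists>u\<in>{a..<b}. c \<le> Y u \<omega>} = ?e" by (simp add: S_def)
qed

end

section \<open>Integrals and path functionals\<close>

text \<open>On the compact rectangle \<open>vt\<close> is bounded, and the mean value inequality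
  transfers the bound to the difference quotients; on a set of finite measure this is an integrable
  dominating function. Continuity is asked on the closed interval but differentiability only on
  \<open>S\<close>, to cover sets such as \<open>{0<..b}\<close>.\<close>

lemma has_real_derivative_set_integral:
  fixes v vt :: "real \<Rightarrow> real \<Rightarrow> real" and \<mu> :: "real measure"
  assumes sets_\<mu>: "sets \<mu> = sets borel" and S: "S \<in> sets borel" "S \<subseteq> {a..b}" "emeasure \<mu> S < \<infinity>"
    and e: "0 < e"
    and meas: "vt t \<in> borel_measurable borel"
    and cont: "continuous_on ({t-e..t+e} \<times> {a..b}) (\<lambda>(r, y). vt r y)"
    and deriv: "\<And>r y. r \<in> {t-e..t+e} \<Longrightarrow> y \<in> S \<Longrightarrow> ((\<lambda>r. v r y) has_real_derivative vt r y) (at r)"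
    and int: "\<And>r. r \<in> {t-e..t+e} \<Longrightarrow> set_integrable \<mu> S (v r)"
  shows "((\<lambda>r. LINT y:S|\<mu>. v r y) has_real_derivative (LINT y:S|\<mu>. vt t y)) (at t)"
    and "set_integrable \<mu> S (vt t)"
proof -
  have S\<mu> [measurable]: "S \<in> sets \<mu>" using S sets_\<mu> by simp
  have [measurable]: "vt t \<in> borel_measurable \<mu>" using meas measurable_cong_sets[OF sets_\<mu> refl] by blast
  have "bounded ((\<lambda>(r, y). vt r y) ` ({t-e..t+e} \<times> {a..b}))"
    by (intro compact_imp_bounded compact_continuous_image cont compact_Times) auto
  then obtain C where C: "\<And>r y. r \<in> {t-e..t+e} \<Longrightarrow> y \<in> {a..b} \<Longrightarrow> norm (vt r y) \<le> C"
    unfolding bounded_iff by force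
  have ind: "integrable \<mu> (\<lambda>y. indicator S y * C)"
    using S(3) by (intro integrable_mult_left) (auto simp: integrable_indicator_iff)
  show vi: "set_integrable \<mu> S (vt t)"
    unfolding set_integrable_def
    by (rule Bochner_Integration.integrable_bound[OF ind])
       (use S e in \<open>auto intro!: AE_I2 order_trans[OF C[of t, unfolded real_norm_def] abs_ge_self] simp: indicator_def\<close>)
  show "((\<lambda>r. LINT y:S|\<mu>. v r y) has_real_derivative (LINT y:S|\<mu>. vt t y)) (at t)"
    unfolding has_field_derivative_iff tendsto_at_iff_sequentially
  proof (intro allI impI)
    fix T :: "nat \<Rightarrow> real" assume T: "\<forall>i. T i \<in> UNIV - {t}" "T \<longlonglongrightarrow> t"
    have "eventually (\<lambda>n. dist (T n) t < e) sequentially" using T(2) e by (rule tendstoD)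
    then obtain N where N: "\<And>n. n \<ge> N \<Longrightarrow> dist (T n) t < e" by (auto simp: eventually_sequentially)
    \<comment> \<open>Dropping finitely many terms keeps every \<open>R n\<close> in the window
      where the bound \<open>C\<close> is valid.\<close>
    define R where "R n = T (n + N)" for n
    have R: "R n \<noteq> t" "R n \<in> {t-e..t+e}" for n
      using T(1) N[of "n + N"] by (auto simp: R_def dist_real_def abs_if split: if_splits)
    have R_lim: "R \<longlonglongrightarrow> t" unfolding R_def using T(2) by (rule LIMSEQ_ignore_initial_segment)
    define g where "g n y = indicator S y * ((v (R n) y - v t y) / (R n - t))" for n y
    have tin: "t \<in> {t-e..t+e}" using e by simp
    have gi: "integrable \<mu> (g n)"
      and gI: "(LINT y|\<mu>. g n y) = ((LINT y:S|\<mu>. v (R n) y) - (LINT y:S|\<mu>. v t y)) / (R n - t)" for n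
    proof -
      have i: "integrable \<mu> (\<lambda>y. indicator S y * v (R n) y)" "integrable \<mu> (\<lambda>y. indicator S y * v t y)"
        using int[OF R(2)] int[OF tin] by (simp_all add: set_integrable_def)
      have g_eq: "g n = (\<lambda>y. (indicator S y * v (R n) y - indicator S y * v t y) / (R n - t))"
        by (auto simp: g_def fun_eq_iff right_diff_distrib)
      show "integrable \<mu> (g n)" unfolding g_eq using i by auto
      show "(LINT y|\<mu>. g n y) = ((LINT y:S|\<mu>. v (R n) y) - (LINT y:S|\<mu>. v t y)) / (R n - t)"
        unfolding g_eq set_lebesgue_integral_def using i by simp
    qed
    have "(\<lambda>n. LINT y|\<mu>. g n y) \<longlonglongrightarrow> (LINT y|\<mu>. indicator S y * vt t y)"
    proof (rule integral_dominated_convergence[OF _ _ ind])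
      show "(\<lambda>y. indicator S y * vt t y) \<in> borel_measurable \<mu>" by measurable
      show "g n \<in> borel_measurable \<mu>" for n using gi by (rule borel_measurable_integrable)
      show "AE y in \<mu>. (\<lambda>n. g n y) \<longlonglongrightarrow> indicator S y * vt t y"
      proof (rule AE_I2)
        fix y show "(\<lambda>n. g n y) \<longlonglongrightarrow> indicator S y * vt t y"
        proof (cases "y \<in> S")
          case True
          from deriv[OF tin True] have "((\<lambda>r. (v r y - v t y) / (r - t)) \<longlongrightarrow> vt t y) (at t)"
            by (simp add: has_field_derivative_iff)
          moreover have "filterlim R (at t) sequentially"
            unfolding filterlim_at using R_lim R(1) by simp
          ultimately have "(\<lambda>n. (v (R n) y - v t y) / (R n - t)) \<longlonglongrightarrow> vt t y"
            by (rule filterlim_compose)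
          with True show ?thesis by (simp add: g_def)
        qed (simp add: g_def)
      qed
      show "AE y in \<mu>. norm (g n y) \<le> indicator S y * C" for n
      proof (rule AE_I2)
        fix y show "norm (g n y) \<le> indicator S y * C"
        proof (cases "y \<in> S")
          case True
          have "norm (v (R n) y - v t y) \<le> C * norm (R n - t)"
          proof (rule field_differentiable_bound[where S="{t-e..t+e}"])
            show "((\<lambda>r. v r y) has_field_derivative vt r y) (at r within {t-e..t+e})" if "r \<in> {t-e..t+e}" for r
              using deriv[OF that True] by (rule has_field_derivative_at_within)
            show "norm (vt r y) \<le> C" if "r \<in> {t-e..t+e}" for r
              using C[OF that, of y] True S(2) by auto
          qed (use R(2) tin in auto)
          thus ?thesis using R(1)[of n] True by (simp add: g_def divide_le_eq)
        qed (simp add: g_def)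
      qed
    qed
    hence "(\<lambda>n. ((LINT y:S|\<mu>. v (T (n + N)) y) - (LINT y:S|\<mu>. v t y)) / (T (n + N) - t)) \<longlonglongrightarrow> (LINT y:S|\<mu>. vt t y)"
      unfolding gI R_def set_lebesgue_integral_def by simp
    from LIMSEQ_offset[OF this]
    show "((\<lambda>r. ((LINT y:S|\<mu>. v r y) - (LINT y:S|\<mu>. v t y)) / (r - t)) \<circ> T) \<longlonglongrightarrow> (LINT y:S|\<mu>. vt t y)"
      by (simp add: o_def)
  qed
qed

text \<open>The law of \<open>G\<close> restricted to \<open>]a, b[\<close> and the measure with
  density \<open>g\<close> agree on intervals by the fundamental theorem, hence on all Borel sets.
  Nonnegativity of \<open>g\<close> comes from the monotone survival function, integrability from a
  total mass of at most 1. \<open>G\<close> may have mass outside \<open>]a, b[\<close>, which is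
  why both measures are cut down first.\<close>

lemma (in prob_space) density_from_survival_function:
  fixes G :: "'a \<Rightarrow> real" and F g :: "real \<Rightarrow> real"
  assumes G [measurable]: "G \<in> borel_measurable M"
    and F: "\<And>t. a < t \<Longrightarrow> t < b \<Longrightarrow> prob {\<omega>\<in>space M. t < G \<omega>} = F t"
    and deriv: "\<And>t. a < t \<Longrightarrow> t < b \<Longrightarrow> (F has_real_derivative - g t) (at t)"
    and g: "(\<lambda>t. indicator {a<..<b} t * g t) \<in> borel_measurable borel"
  shows "set_integrable lborel {a<..<b} g"
    and "A \<in> sets borel \<Longrightarrow> A \<subseteq> {a<..<b} \<Longrightarrow> prob {\<omega>\<in>space M. G \<omega> \<in> A} = (LINT t:A|lborel. g t)"
proof -
  define h where "h t = indicator {a<..<b} t * g t" for t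
  have h_m [measurable]: "h \<in> borel_measurable borel" using g by (simp add: h_def[abs_def])
  have prob_Ioc: "prob {\<omega>\<in>space M. u < G \<omega> \<and> G \<omega> \<le> v} = F u - F v" if "a < u" "u \<le> v" "v < b" for u v
  proof -
    have "{\<omega>\<in>space M. u < G \<omega> \<and> G \<omega> \<le> v} = {\<omega>\<in>space M. u < G \<omega>} - {\<omega>\<in>space M. v < G \<omega>}" by auto
    also have "prob \<dots> = F u - F v"
      using that by (subst finite_measure_Diff) (auto simp: F)
    finally show ?thesis .
  qed
  have h_nonneg: "0 \<le> h t" for t
  proof (cases "a < t \<and> t < b")
    case True
    have "mono_on {a<..<b} (\<lambda>t. - F t)"
    proof (rule mono_onI)
      fix u v assume "u \<in> {a<..<b}" "v \<in> {a<..<b}" "u \<le> v"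
      hence "0 \<le> F u - F v" using prob_Ioc[of u v] by (metis greaterThanLessThan_iff measure_nonneg)
      thus "- F u \<le> - F v" by simp
    qed
    moreover have "((\<lambda>t. - F t) has_real_derivative g t) (at t)"
      using DERIV_minus[OF deriv[of t]] True by simp
    ultimately have "0 \<le> g t"
      by (rule mono_on_imp_deriv_nonneg) (use True in simp)
    thus ?thesis by (simp add: h_def)
  qed (auto simp: h_def indicator_def)
  define \<mu> where "\<mu> = density (distr M borel G) (indicator {a<..<b})"
  define \<nu> where "\<nu> = density lborel (\<lambda>t. ennreal (h t))"
  have \<mu>: "emeasure \<mu> A = emeasure M {\<omega>\<in>space M. G \<omega> \<in> A \<and> a < G \<omega> \<and> G \<omega> < b}"
    if [measurable]: "A \<in> sets borel" for A
  proof -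
    have "emeasure \<mu> A = (\<integral>\<^sup>+t. indicator (A \<inter> {a<..<b}) t \<partial>distr M borel G)"
      unfolding \<mu>_def by (subst emeasure_density)
        (auto intro!: nn_integral_cong simp: indicator_inter_arith[symmetric] mult.commute Int_commute split: split_indicator)
    also have "\<dots> = emeasure M (G -` (A \<inter> {a<..<b}) \<inter> space M)"
      by (subst nn_integral_indicator) (auto simp: emeasure_distr)
    also have "G -` (A \<inter> {a<..<b}) \<inter> space M = {\<omega>\<in>space M. G \<omega> \<in> A \<and> a < G \<omega> \<and> G \<omega> < b}" by auto
    finally show ?thesis .
  qed
  have \<nu>: "emeasure \<nu> A = (\<integral>\<^sup>+t. ennreal (h t) * indicator A t \<partial>lborel)" if "A \<in> sets borel" for A
    unfolding \<nu>_def using that by (subst emeasure_density) auto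
  have Ioc: "emeasure \<mu> {u<..v} = emeasure \<nu> {u<..v}" if "a < u" "v < b" for u v
  proof (cases "u \<le> v")
    case True
    have "{\<omega>\<in>space M. G \<omega> \<in> {u<..v} \<and> a < G \<omega> \<and> G \<omega> < b} = {\<omega>\<in>space M. u < G \<omega> \<and> G \<omega> \<le> v}"
      using that by auto
    hence "emeasure \<mu> {u<..v} = ennreal (F u - F v)"
      using that True by (subst \<mu>) (simp_all add: emeasure_eq_measure prob_Ioc)
    moreover have "emeasure \<nu> {u<..v} = (\<integral>\<^sup>+t. ennreal (h t) * indicator {u..v} t \<partial>lborel)"
      unfolding \<nu>[OF greaterThanAtMost_borel]
      by (rule nn_integral_cong_AE) (use AE_lborel_singleton[of u] in \<open>eventually_elim, auto simp: indicator_def\<close>)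
    moreover have "\<dots> = ennreal (- F v - - F u)"
    proof (rule nn_integral_FTC_Icc)
      fix t assume "t \<in> {u..v}"
      with that have t: "a < t" "t < b" by auto
      show "((\<lambda>t. - F t) has_real_derivative h t) (at t)"
        using DERIV_minus[OF deriv[OF t]] t by (simp add: h_def)
    qed (use h_nonneg True in auto)
    ultimately show ?thesis by simp
  qed simp
  have eq: "\<mu> = \<nu>"
  proof (rule measure_eqI_lessThan)
    show "sets \<mu> = sets borel" "sets \<nu> = sets borel" by (auto simp: \<mu>_def \<nu>_def)
    show "emeasure \<mu> {z<..} < \<infinity>" for z
      by (subst \<mu>) (auto simp: emeasure_eq_measure)
    show "emeasure \<mu> {z<..} = emeasure \<nu> {z<..}" for z
    proof -
      \<comment> \<open>Intervals that keep away from \<open>a\<close> and \<open>b\<close>, where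
        \<open>F\<close> is not controlled; they increase to the part of \<open>]a, b[\<close> above
        \<open>z\<close>.\<close>
      define I where "I n = {max z (a + 1 / real (Suc n)) <.. b - 1 / real (Suc n)}" for n
      have I_inc: "incseq I"
      proof (rule monoI)
        fix i j :: nat assume "i \<le> j"
        hence "1 / real (Suc j) \<le> 1 / real (Suc i)" by (intro divide_left_mono) auto
        thus "I i \<subseteq> I j" by (auto simp: I_def)
      qed
      have I_m: "I n \<in> sets borel" for n by (simp add: I_def)
      have I_eq: "emeasure \<mu> (I n) = emeasure \<nu> (I n)" for n
        unfolding I_def by (rule Ioc) (auto simp: less_max_iff_disj)
      have I_un: "(\<Union>n. I n) = {z<..} \<inter> {a<..<b}"
      proof (intro equalityI subsetI)
        fix t assume t: "t \<in> {z<..} \<inter> {a<..<b}"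
        then obtain n where "inverse (real (Suc n)) < min (t - a) (b - t)"
          using reals_Archimedean[of "min (t - a) (b - t)"] by auto
        hence "t \<in> I n" using t by (auto simp: I_def inverse_eq_divide)
        thus "t \<in> (\<Union>n. I n)" by blast
      next
        fix t assume "t \<in> (\<Union>n. I n)"
        then obtain n where n: "t \<in> I n" by blast
        define e where "e = 1 / real (Suc n)"
        have "0 < e" by (simp add: e_def)
        moreover have "z < t" "a + e < t" "t \<le> b - e" using n unfolding I_def e_def[symmetric] by auto
        ultimately show "t \<in> {z<..} \<inter> {a<..<b}" by auto
      qed
      have "emeasure \<mu> {z<..} = emeasure \<mu> ({z<..} \<inter> {a<..<b})"
        by (subst (1 2) \<mu>) (auto intro!: arg_cong[where f="emeasure M"])
      also have "\<dots> = (SUP n. emeasure \<mu> (I n))"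
        unfolding I_un[symmetric] using I_inc I_m by (intro SUP_emeasure_incseq[symmetric]) (auto simp: \<mu>_def)
      also have "\<dots> = (SUP n. emeasure \<nu> (I n))" by (simp add: I_eq)
      also have "\<dots> = emeasure \<nu> ({z<..} \<inter> {a<..<b})"
        unfolding I_un[symmetric] using I_inc I_m by (intro SUP_emeasure_incseq) (auto simp: \<nu>_def)
      also have "\<dots> = emeasure \<nu> {z<..}"
        by (subst (1 2) \<nu>) (auto intro!: nn_integral_cong simp: h_def indicator_def)
      finally show ?thesis .
    qed
  qed
  have h_int: "integrable lborel h"
  proof (rule integrableI_nonneg)
    have "(\<integral>\<^sup>+t. ennreal (h t) \<partial>lborel) = emeasure \<nu> UNIV" by (subst \<nu>) auto
    also have "\<dots> < \<infinity>" unfolding eq[symmetric] by (subst \<mu>) (auto simp: emeasure_eq_measure)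
    finally show "(\<integral>\<^sup>+t. ennreal (h t) \<partial>lborel) < \<infinity>" .
  qed (use h_nonneg in auto)
  show "set_integrable lborel {a<..<b} g"
    using h_int by (simp add: set_integrable_def h_def[abs_def])
  show "prob {\<omega>\<in>space M. G \<omega> \<in> A} = (LINT t:A|lborel. g t)" if A: "A \<in> sets borel" "A \<subseteq> {a<..<b}"
  proof -
    have Ai: "integrable lborel (\<lambda>t. h t * indicator A t)"
      using h_int A by (intro integrable_mult_indicator[where 'b=real, simplified, unfolded mult.commute[of "indicator _ _"]]) auto
    have "{\<omega>\<in>space M. G \<omega> \<in> A} = {\<omega>\<in>space M. G \<omega> \<in> A \<and> a < G \<omega> \<and> G \<omega> < b}" using A by auto
    hence "ennreal (prob {\<omega>\<in>space M. G \<omega> \<in> A}) = emeasure \<nu> A"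
      unfolding eq[symmetric] using A by (simp add: \<mu> emeasure_eq_measure)
    also have "\<dots> = (\<integral>\<^sup>+t. ennreal (h t * indicator A t) \<partial>lborel)"
      unfolding \<nu>[OF A(1)] by (intro nn_integral_cong) (auto simp: indicator_def)
    also have "\<dots> = ennreal (LINT t|lborel. h t * indicator A t)"
      by (rule nn_integral_eq_integral[OF Ai]) (simp add: h_nonneg)
    finally have "prob {\<omega>\<in>space M. G \<omega> \<in> A} = (LINT t|lborel. h t * indicator A t)"
      using h_nonneg by (subst (asm) ennreal_inj) auto
    also have "\<dots> = (LINT t:A|lborel. g t)"
      unfolding set_lebesgue_integral_def
      using A by (intro Bochner_Integration.integral_cong) (auto simp: h_def indicator_def)
    finally show ?thesis .
  qed
qed

text \<open>On a compact interval a continuous path attains \<open>c\<close> as soon as it comes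
  arbitrarily close to \<open>c\<close>, and closeness can be tested at rational times.\<close>

lemma sets_path_attains:
  fixes Z :: "real \<Rightarrow> 'a \<Rightarrow> real"
  assumes "a < b" and meas: "\<And>s. s \<in> {a..b} \<Longrightarrow> Z s \<in> borel_measurable M"
    and cont: "\<And>\<omega>. \<omega> \<in> space M \<Longrightarrow> continuous_on {a..b} (\<lambda>s. Z s \<omega>)"
  shows "{\<omega>\<in>space M. \<exists>s\<in>{a..b}. Z s \<omega> = c} \<in> sets M"
proof -
  define B where "B k = (\<Union>r\<in>\<rat> \<inter> {a..b}. {\<omega>\<in>space M. \<bar>Z r \<omega> - c\<bar> < 1 / real (Suc k)})" for k
  have "B k \<in> sets M" for k
  proof -
    have "{\<omega>\<in>space M. \<bar>Z r \<omega> - c\<bar> < 1 / real (Suc k)} \<in> sets M" if "r \<in> \<rat> \<inter> {a..b}" for r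
    proof -
      have [measurable]: "Z r \<in> borel_measurable M" using meas that by auto
      show ?thesis by measurable
    qed
    thus ?thesis unfolding B_def
      by (intro sets.countable_UN') (auto intro: countable_subset[OF _ countable_rat])
  qed
  moreover have "{\<omega>\<in>space M. \<exists>s\<in>{a..b}. Z s \<omega> = c} = (\<Inter>k. B k)"
  proof (intro equalityI subsetI INT_I)
    fix \<omega> k assume "\<omega> \<in> {\<omega>\<in>space M. \<exists>s\<in>{a..b}. Z s \<omega> = c}"
    then obtain u where w: "\<omega> \<in> space M" and u: "u \<in> {a..b}" "Z u \<omega> = c" by auto
    have "continuous (at u within {a..b}) (\<lambda>s. Z s \<omega>)"
      using cont[OF w] u by (simp add: continuous_on_eq_continuous_within)
    moreover have "0 < 1 / real (Suc k)" by simp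
    ultimately obtain d where d: "0 < d" "\<And>v. v \<in> {a..b} \<Longrightarrow> dist v u < d \<Longrightarrow> dist (Z v \<omega>) (Z u \<omega>) < 1 / real (Suc k)"
      unfolding continuous_within_eps_delta by metis
    have "max a (u - d) < min b (u + d)" using u d(1) \<open>a < b\<close> by auto
    from Rats_dense_in_real[OF this] obtain r where "r \<in> \<rat>" "max a (u - d) < r" "r < min b (u + d)" by blast
    hence "r \<in> \<rat> \<inter> {a..b}" "dist r u < d" by (auto simp: dist_real_def)
    with d(2)[of r] u w show "\<omega> \<in> B k" unfolding B_def by (auto simp: dist_real_def)
  next
    fix \<omega> assume B: "\<omega> \<in> (\<Inter>k. B k)"
    hence w: "\<omega> \<in> space M" by (auto simp: B_def)
    have "continuous_on {a..b} (\<lambda>s. \<bar>Z s \<omega> - c\<bar>)" using cont[OF w] by (intro continuous_intros)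
    then obtain u where u: "u \<in> {a..b}" "\<And>v. v \<in> {a..b} \<Longrightarrow> \<bar>Z u \<omega> - c\<bar> \<le> \<bar>Z v \<omega> - c\<bar>"
      using continuous_attains_inf[of "{a..b}" "\<lambda>s. \<bar>Z s \<omega> - c\<bar>"] \<open>a < b\<close> by auto
    have "Z u \<omega> = c"
    proof (rule ccontr)
      assume "Z u \<omega> \<noteq> c"
      then obtain k where k: "inverse (real (Suc k)) < \<bar>Z u \<omega> - c\<bar>" using reals_Archimedean[of "\<bar>Z u \<omega> - c\<bar>"] by auto
      from B have "\<omega> \<in> B k" by blast
      then obtain r where "r \<in> {a..b}" "\<bar>Z r \<omega> - c\<bar> < inverse (real (Suc k))" by (auto simp: B_def inverse_eq_divide)
      with u(2)[of r] k show False by simp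
    qed
    with u w show "\<omega> \<in> {\<omega>\<in>space M. \<exists>s\<in>{a..b}. Z s \<omega> = c}" by auto
  qed
  ultimately show ?thesis by (simp add: sets.countable_INT)
qed

section \<open>Transition density and Markov property\<close>

context linear_diffusion_density begin

abbreviation m :: "real measure" where "m \<equiv> speed_measure \<rho>"

text \<open>Extended to the whole line by constants, the density becomes jointly measurable.\<close>

definition p :: "real \<Rightarrow> real \<Rightarrow> real \<Rightarrow> real" where
  "p t x y = q t (max 0 x) (max 0 y)"

section \<open>The speed measure and its null sets\<close>

lemma sets_m [measurable_cong]: "sets m = sets borel"
  by (simp add: speed_measure_def)

lemma rho_measurable [measurable]: "\<rho> \<in> borel_measurable borel"
  by (rule speed_density_measurable)

lemma AE_m_iff:
  "(AE y in m. Q y) \<longleftrightarrow> (AE y in lborel. 0 < y \<longrightarrow> Q y)"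
proof -
  have "(0 < ennreal (\<rho> y) * indicator {0<..} y) = (0 < y)" for y :: real
    using speed_density_pos[of y] by (auto simp: indicator_def)
  thus ?thesis unfolding speed_measure_def by (subst AE_density) auto
qed

lemma AE_m_pos: "AE y in m. 0 < y"
  by (simp add: AE_m_iff)

text \<open>Positivity of \<open>\<rho>\<close> makes \<open>m\<close> charge every interval of
  \<open>]0, \<infinity>[\<close>. An almost sure property thus holds at points arbitrarily close to
  any \<open>z\<close>, including the null point \<open>z = 0\<close>.\<close>

lemma AE_m_dense:
  assumes "AE y in m. Q y" "0 \<le> z" "z < b"
  shows "\<exists>y. z < y \<and> y < b \<and> Q y"
proof (rule ccontr)
  assume *: "\<not> ?thesis"
  have "AE y in lborel. y \<notin> {z<..<b}"
    using assms(1) unfolding AE_m_iff by eventually_elim (use * assms(2) in auto)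
  hence "emeasure lborel {z<..<b} = 0" by (subst (asm) AE_iff_measurable[where N="{z<..<b}"]) auto
  with \<open>z < b\<close> show False by simp
qed

lemma sigma_finite_m: "sigma_finite_measure m"
  unfolding speed_measure_def
  by (subst sigma_finite_measure.sigma_finite_iff_density_finite'[OF sigma_finite_lborel])
     (auto simp: indicator_def)

section \<open>Positivity, continuity and measurability of the extended density\<close>

lemma p_nonneg: "t > 0 \<Longrightarrow> 0 \<le> p t x y"
  unfolding p_def by (rule density_nonneg) auto

lemma p_sym: "t > 0 \<Longrightarrow> p t x y = p t y x"
  unfolding p_def by (rule density_symmetric) auto

lemma p_eq: "0 \<le> x \<Longrightarrow> 0 \<le> y \<Longrightarrow> p t x y = q t x y"
  by (simp add: p_def)

lemma continuous_on_q: "continuous_on ({0<..} \<times> {0..} \<times> {0..}) (\<lambda>(t, x, y). q t x y)"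
  using density_C122 unfolding C122_def by blast

lemma continuous_on_p [continuous_intros]:
  fixes f g h :: "'b::topological_space \<Rightarrow> real"
  assumes "continuous_on S f" "continuous_on S g" "continuous_on S h" "\<And>w. w \<in> S \<Longrightarrow> 0 < f w"
  shows "continuous_on S (\<lambda>w. p (f w) (g w) (h w))"
proof -
  have "continuous_on S (\<lambda>w. (\<lambda>(t, x, y). q t x y) (f w, max 0 (g w), max 0 (h w)))"
    by (rule continuous_on_compose2[OF continuous_on_q]) (use assms in \<open>auto intro!: continuous_intros\<close>)
  thus ?thesis by (simp add: p_def)
qed

lemma tendsto_p:
  assumes "(f \<longlongrightarrow> x) F" "(g \<longlongrightarrow> y) F" "t > 0"
  shows "((\<lambda>w. p t (f w) (g w)) \<longlongrightarrow> p t x y) F"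
proof -
  have "continuous_on UNIV (\<lambda>w. p t (fst w) (snd w))" using assms by (intro continuous_intros) auto
  hence "isCont (\<lambda>w. p t (fst w) (snd w)) (x, y)" by (simp add: continuous_on_eq_continuous_at)
  from isCont_tendsto_compose[OF this tendsto_Pair[OF assms(1,2)]] show ?thesis by simp
qed

lemma measurable_p:
  assumes "t > 0" and [measurable]: "f \<in> borel_measurable N" "g \<in> borel_measurable N"
  shows "(\<lambda>w. p t (f w) (g w)) \<in> borel_measurable N"
proof -
  have "continuous_on UNIV (\<lambda>w. p t (fst w) (snd w))" using assms by (intro continuous_intros) auto
  hence "(\<lambda>w. p t (fst w) (snd w)) \<in> borel_measurable borel" by (rule borel_measurable_continuous_onI)
  hence [measurable]: "(\<lambda>w. p t (fst w) (snd w)) \<in> borel_measurable (borel \<Otimes>\<^sub>M borel)" by (simp add: borel_prod)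
  have "(\<lambda>w. (\<lambda>w. p t (fst w) (snd w)) (f w, g w)) \<in> borel_measurable N" by measurable
  thus ?thesis by simp
qed

section \<open>The law of the process at a fixed time\<close>

lemma prob_space_P: "x \<ge> 0 \<Longrightarrow> prob_space (P x)"
  and sets_P: "x \<ge> 0 \<Longrightarrow> sets (P x) = sets M"
  using measurable_space[OF kernel, of x] by (auto simp: space_prob_algebra space_restrict_space)

lemma space_P: "x \<ge> 0 \<Longrightarrow> space (P x) = space M"
  by (rule sets_eq_imp_space_eq[OF sets_P])

lemma measurable_X_P: "x \<ge> 0 \<Longrightarrow> t \<ge> 0 \<Longrightarrow> X t \<in> borel_measurable (P x)"
  using measurable_X[of t] measurable_cong_sets[OF sets_P[of x] refl] by blast

lemma emeasure_X:
  assumes "t > 0" "x \<ge> 0" "B \<in> sets borel"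
  shows "emeasure (P x) {\<omega> \<in> space M. X t \<omega> \<in> B} = (\<integral>\<^sup>+ y. ennreal (p t x y) * indicator B y \<partial>m)"
  unfolding transition_density[OF assms]
  by (rule nn_integral_cong_AE) (use AE_m_pos in \<open>eventually_elim, use assms in \<open>auto simp: p_eq\<close>\<close>)

lemma distr_X:
  assumes t: "t > 0" and x: "x \<ge> 0"
  shows "distr (P x) borel (X t) = density m (\<lambda>y. ennreal (p t x y))"
proof (rule measure_eqI)
  show "sets (distr (P x) borel (X t)) = sets (density m (\<lambda>y. ennreal (p t x y)))" by (simp add: sets_m)
next
  fix B assume "B \<in> sets (distr (P x) borel (X t))"
  hence B: "B \<in> sets borel" by simp
  have [measurable]: "p t x \<in> borel_measurable borel" using t by (intro measurable_p) auto
  have [measurable]: "X t \<in> borel_measurable (P x)" using measurable_X_P t x by simp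
  have "X t -` B \<inter> space (P x) = {\<omega> \<in> space M. X t \<omega> \<in> B}" using x by (auto simp: space_P)
  thus "emeasure (distr (P x) borel (X t)) B = emeasure (density m (\<lambda>y. ennreal (p t x y))) B"
    using B emeasure_X[OF t x B] by (simp add: emeasure_distr emeasure_density)
qed

lemma nn_integral_X:
  assumes t: "t > 0" and x: "x \<ge> 0" and [measurable]: "\<phi> \<in> borel_measurable borel"
  shows "(\<integral>\<^sup>+ \<omega>. \<phi> (X t \<omega>) \<partial>P x) = (\<integral>\<^sup>+ y. ennreal (p t x y) * \<phi> y \<partial>m)"
proof -
  have [measurable]: "p t x \<in> borel_measurable borel" using t by (intro measurable_p) auto
  have "(\<integral>\<^sup>+ \<omega>. \<phi> (X t \<omega>) \<partial>P x) = (\<integral>\<^sup>+ y. \<phi> y \<partial>distr (P x) borel (X t))"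
    using measurable_X_P t x by (subst nn_integral_distr) auto
  also have "\<dots> = (\<integral>\<^sup>+ y. ennreal (p t x y) * \<phi> y \<partial>m)"
    unfolding distr_X[OF t x] by (subst nn_integral_density) auto
  finally show ?thesis .
qed

lemma integral_X:
  assumes t: "t > 0" and x: "x \<ge> 0" and [measurable]: "(\<phi> :: real \<Rightarrow> real) \<in> borel_measurable borel"
  shows "(LINT \<omega>|P x. \<phi> (X t \<omega>)) = (LINT y|m. p t x y * \<phi> y)"
    and "integrable (P x) (\<lambda>\<omega>. \<phi> (X t \<omega>)) \<longleftrightarrow> integrable m (\<lambda>y. p t x y * \<phi> y)"
proof -
  have [measurable]: "p t x \<in> borel_measurable borel" using t by (intro measurable_p) auto
  have [measurable]: "X t \<in> borel_measurable (P x)" using measurable_X_P t x by simp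
  have "(LINT \<omega>|P x. \<phi> (X t \<omega>)) = (LINT y|distr (P x) borel (X t). \<phi> y)"
    by (subst integral_distr) auto
  also have "\<dots> = (LINT y|m. p t x y * \<phi> y)"
    unfolding distr_X[OF t x] using p_nonneg[OF t] by (subst integral_density) auto
  finally show "(LINT \<omega>|P x. \<phi> (X t \<omega>)) = (LINT y|m. p t x y * \<phi> y)" .
  have "integrable (P x) (\<lambda>\<omega>. \<phi> (X t \<omega>)) \<longleftrightarrow> integrable (distr (P x) borel (X t)) \<phi>"
    by (subst integrable_distr_eq) auto
  also have "\<dots> \<longleftrightarrow> integrable m (\<lambda>y. p t x y * \<phi> y)"
    unfolding distr_X[OF t x] using p_nonneg[OF t] by (subst integrable_density) auto
  finally show "integrable (P x) (\<lambda>\<omega>. \<phi> (X t \<omega>)) \<longleftrightarrow> integrable m (\<lambda>y. p t x y * \<phi> y)" .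
qed

lemma nn_integral_p: "t > 0 \<Longrightarrow> x \<ge> 0 \<Longrightarrow> (\<integral>\<^sup>+ y. ennreal (p t x y) \<partial>m) = 1"
  using nn_integral_X[of t x "\<lambda>_. 1"] prob_space.emeasure_space_1[OF prob_space_P] by simp

section \<open>The Markov property at a fixed time and the Chapman-Kolmogorov equations\<close>

lemma space_natural_filtration: "space (natural_filtration M X t) = space M"
  unfolding natural_filtration_def by (rule space_measure_of) auto

lemma sets_natural_filtration:
  "sets (natural_filtration M X t) = sigma_sets (space M) {X u -` B \<inter> space M | u B. 0 \<le> u \<and> u \<le> t \<and> B \<in> sets borel}"
  unfolding natural_filtration_def by (rule sets_measure_of) auto

lemma sets_natural_filtration_mono: "r \<le> t \<Longrightarrow> sets (natural_filtration M X r) \<subseteq> sets (natural_filtration M X t)"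
  unfolding sets_natural_filtration by (rule sigma_sets_mono') fastforce

lemma sets_natural_filtration_subset: "sets (natural_filtration M X t) \<subseteq> sets M"
  unfolding sets_natural_filtration
  by (rule sets.sigma_sets_subset) (auto intro: measurable_sets[OF measurable_X])

lemma measurable_X_natural_filtration:
  "0 \<le> u \<Longrightarrow> u \<le> t \<Longrightarrow> X u \<in> borel_measurable (natural_filtration M X t)"
  by (rule measurableI)
     (auto simp: space_natural_filtration sets_natural_filtration intro!: sigma_sets.Basic)

text \<open>The strong Markov property at the constant time \<open>t\<close>, with the transition
  kernel expressed by its density, which exists as \<open>u > 0\<close>.\<close>

lemma emeasure_markov:
  assumes x: "x \<ge> 0" and t: "t \<ge> 0" and u: "u > 0" and A: "A \<in> sets (natural_filtration M X t)"
    and B: "B \<in> sets borel"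
  shows "emeasure (P x) {\<omega> \<in> A. X (t + u) \<omega> \<in> B} =
    (\<integral>\<^sup>+ \<omega>. indicator A \<omega> * (\<integral>\<^sup>+ y. ennreal (p u (X t \<omega>) y) * indicator B y \<partial>m) \<partial>P x)"
proof -
  interpret Px: prob_space "P x" using x by (rule prob_space_P)
  interpret m: sigma_finite_measure m by (rule sigma_finite_m)
  interpret filtration "space M" "natural_filtration M X"
    by unfold_locales (auto simp: space_natural_filtration dest: sets_natural_filtration_mono)
  have AM: "A \<in> sets M" using A sets_natural_filtration_subset by blast
  have AP [measurable]: "A \<in> sets (P x)" using AM x by (simp add: sets_P)
  have [measurable]: "X t \<in> borel_measurable (P x)" using measurable_X_P x t by simp
  have st: "stopping_time (natural_filtration M X) (\<lambda>_. t)" by (rule stopping_time_const)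
  have "A \<in> sets (pre_sigma (\<lambda>_. t))"
  proof (rule sets_pre_sigmaI[OF st])
    show "{\<omega> \<in> A. t \<le> v} \<in> sets (natural_filtration M X v)" for v
      using A sets_natural_filtration_mono[of t v] by (cases "t \<le> v") auto
  qed
  from strong_markov[OF x st _ this _ B, of u] t u
  have eq: "measure (P x) {\<omega> \<in> A. X (t + u) \<omega> \<in> B} =
      (LINT \<omega>:A|P x. measure (P (X t \<omega>)) {\<omega>' \<in> space M. X u \<omega>' \<in> B})" by simp
  have k: "ennreal (measure (P (X t \<omega>)) {\<omega>' \<in> space M. X u \<omega>' \<in> B}) =
      (\<integral>\<^sup>+ y. ennreal (p u (X t \<omega>) y) * indicator B y \<partial>m)" if "\<omega> \<in> space M" for \<omega>
  proof -
    have X0: "X t \<omega> \<ge> 0" using state_space t that by simp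
    interpret Pz: prob_space "P (X t \<omega>)" using X0 by (rule prob_space_P)
    show ?thesis using emeasure_X[OF u X0 B] by (simp add: Pz.emeasure_eq_measure)
  qed
  have [measurable]: "(\<lambda>z. ennreal (p u (X t (fst z)) (snd z)) * indicator B (snd z)) \<in> borel_measurable (P x \<Otimes>\<^sub>M m)"
  proof -
    have "(\<lambda>z. p u (X t (fst z)) (snd z)) \<in> borel_measurable (P x \<Otimes>\<^sub>M m)"
      using u by (intro measurable_p) measurable
    with B show ?thesis by measurable
  qed
  have km [measurable]: "(\<lambda>\<omega>. \<integral>\<^sup>+ y. ennreal (p u (X t \<omega>) y) * indicator B y \<partial>m) \<in> borel_measurable (P x)"
    using m.borel_measurable_nn_integral_fst[of "\<lambda>z. ennreal (p u (X t (fst z)) (snd z)) * indicator B (snd z)" "P x"] by simp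
  \<comment> \<open>The integrand is written through the density because its measurability in
    \<open>\<omega>\<close> then follows from Tonelli's theorem.\<close>
  define f where "f \<omega> = indicator A \<omega> * enn2real (\<integral>\<^sup>+ y. ennreal (p u (X t \<omega>) y) * indicator B y \<partial>m)" for \<omega>
  have [measurable]: "f \<in> borel_measurable (P x)" unfolding f_def by measurable
  have f_eq: "f \<omega> = indicator A \<omega> * measure (P (X t \<omega>)) {\<omega>' \<in> space M. X u \<omega>' \<in> B}" if "\<omega> \<in> space M" for \<omega>
    unfolding f_def k[OF that, symmetric] by simp
  have f_bd: "0 \<le> f \<omega>" "f \<omega> \<le> 1" if "\<omega> \<in> space M" for \<omega>
  proof -
    interpret Pz: prob_space "P (X t \<omega>)" using state_space t that by (intro prob_space_P) simp
    show "0 \<le> f \<omega>" "f \<omega> \<le> 1" unfolding f_eq[OF that] by (auto simp: indicator_def)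
  qed
  have "emeasure (P x) {\<omega> \<in> A. X (t + u) \<omega> \<in> B} = ennreal (LINT \<omega>|P x. f \<omega>)"
    unfolding Px.emeasure_eq_measure eq set_lebesgue_integral_def
    using x by (intro arg_cong[where f=ennreal] Bochner_Integration.integral_cong refl) (simp add: f_eq space_P)
  also have "\<dots> = (\<integral>\<^sup>+ \<omega>. ennreal (f \<omega>) \<partial>P x)"
    using f_bd x by (intro nn_integral_eq_integral[symmetric] Px.integrable_const_bound[where B=1])
      (auto simp: space_P)
  also have "\<dots> = (\<integral>\<^sup>+ \<omega>. indicator A \<omega> * (\<integral>\<^sup>+ y. ennreal (p u (X t \<omega>) y) * indicator B y \<partial>m) \<partial>P x)"
    using x by (intro nn_integral_cong) (auto simp: f_eq k space_P indicator_def)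
  finally show ?thesis .
qed

text \<open>The law of \<open>X (t + u)\<close> on the event \<open>A\<close> has the density
  \<open>d\<close> with respect to \<open>m\<close>, as the case of indicators shows. Both sides are
  then the integral of \<open>\<phi>\<close> against this one measure.\<close>

lemma nn_integral_markov:
  assumes x: "x \<ge> 0" and t: "t \<ge> 0" and u: "u > 0" and A: "A \<in> sets (natural_filtration M X t)"
    and \<phi> [measurable]: "\<phi> \<in> borel_measurable borel"
  shows "(\<integral>\<^sup>+ \<omega>. indicator A \<omega> * \<phi> (X (t + u) \<omega>) \<partial>P x) =
    (\<integral>\<^sup>+ \<omega>. indicator A \<omega> * (\<integral>\<^sup>+ y. ennreal (p u (X t \<omega>) y) * \<phi> y \<partial>m) \<partial>P x)"
proof -
  interpret Px: prob_space "P x" using x by (rule prob_space_P)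
  interpret m: sigma_finite_measure m by (rule sigma_finite_m)
  interpret pair_sigma_finite "P x" m ..
  have AP [measurable]: "A \<in> sets (P x)" using A sets_natural_filtration_subset x by (auto simp: sets_P)
  have [measurable]: "X t \<in> borel_measurable (P x)" "X (t + u) \<in> borel_measurable (P x)"
    using measurable_X_P x t u by simp_all
  have pm [measurable]: "(\<lambda>z. p u (X t (fst z)) (snd z)) \<in> borel_measurable (P x \<Otimes>\<^sub>M m)"
    using u by (intro measurable_p) measurable
  have pm1 [measurable]: "p u z \<in> borel_measurable m" for z using u by (intro measurable_p) measurable
  define d where "d y = (\<integral>\<^sup>+ \<omega>. indicator A \<omega> * ennreal (p u (X t \<omega>) y) \<partial>P x)" for y
  have [measurable]: "(\<lambda>z. p u (X t (snd z)) (fst z)) \<in> borel_measurable (m \<Otimes>\<^sub>M P x)"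
    using u by (intro measurable_p) measurable
  have [measurable]: "d \<in> borel_measurable m" unfolding d_def
    using Px.borel_measurable_nn_integral_fst[of "\<lambda>z. indicator A (snd z) * ennreal (p u (X t (snd z)) (fst z))" m]
    by simp
  have swap: "(\<integral>\<^sup>+ \<omega>. indicator A \<omega> * (\<integral>\<^sup>+ y. ennreal (p u (X t \<omega>) y) * \<psi> y \<partial>m) \<partial>P x) = (\<integral>\<^sup>+ y. d y * \<psi> y \<partial>m)"
    if [measurable]: "\<psi> \<in> borel_measurable borel" for \<psi>
  proof -
    have "(\<integral>\<^sup>+ \<omega>. indicator A \<omega> * (\<integral>\<^sup>+ y. ennreal (p u (X t \<omega>) y) * \<psi> y \<partial>m) \<partial>P x)
      = (\<integral>\<^sup>+ \<omega>. (\<integral>\<^sup>+ y. indicator A \<omega> * ennreal (p u (X t \<omega>) y) * \<psi> y \<partial>m) \<partial>P x)"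
      by (intro nn_integral_cong) (simp add: nn_integral_cmult[symmetric] mult.assoc)
    also have "\<dots> = (\<integral>\<^sup>+ y. (\<integral>\<^sup>+ \<omega>. indicator A \<omega> * ennreal (p u (X t \<omega>) y) * \<psi> y \<partial>P x) \<partial>m)"
      by (rule Fubini'[symmetric]) (simp add: case_prod_unfold)
    also have "\<dots> = (\<integral>\<^sup>+ y. d y * \<psi> y \<partial>m)"
    proof (rule nn_integral_cong)
      fix y
      have "(\<lambda>\<omega>. p u (X t \<omega>) y) \<in> borel_measurable (P x)" using u by (intro measurable_p) measurable
      thus "(\<integral>\<^sup>+ \<omega>. indicator A \<omega> * ennreal (p u (X t \<omega>) y) * \<psi> y \<partial>P x) = d y * \<psi> y"
        unfolding d_def by (subst nn_integral_multc) auto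
    qed
    finally show ?thesis .
  qed
  have eq: "distr (density (P x) (indicator A)) borel (X (t + u)) = density m d"
  proof (rule measure_eqI)
    fix B assume "B \<in> sets (distr (density (P x) (indicator A)) borel (X (t + u)))"
    hence B [measurable]: "B \<in> sets borel" by simp
    have "emeasure (distr (density (P x) (indicator A)) borel (X (t + u))) B =
        (\<integral>\<^sup>+ \<omega>. indicator A \<omega> * indicator (X (t + u) -` B \<inter> space (P x)) \<omega> \<partial>P x)"
      by (simp add: emeasure_distr emeasure_density)
    also have "\<dots> = (\<integral>\<^sup>+ \<omega>. indicator {\<omega> \<in> A. X (t + u) \<omega> \<in> B} \<omega> \<partial>P x)"
      by (intro nn_integral_cong) (auto simp: indicator_def)
    also have "\<dots> = emeasure (P x) {\<omega> \<in> A. X (t + u) \<omega> \<in> B}"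
    proof (rule nn_integral_indicator)
      have "{\<omega> \<in> A. X (t + u) \<omega> \<in> B} = A \<inter> {\<omega> \<in> space (P x). X (t + u) \<omega> \<in> B}"
        using sets.sets_into_space[OF AP] by auto
      also have "\<dots> \<in> sets (P x)" by measurable
      finally show "{\<omega> \<in> A. X (t + u) \<omega> \<in> B} \<in> sets (P x)" .
    qed
    also have "\<dots> = (\<integral>\<^sup>+ y. d y * indicator B y \<partial>m)"
      unfolding emeasure_markov[OF x t u A B] by (rule swap) measurable
    finally show "emeasure (distr (density (P x) (indicator A)) borel (X (t + u))) B = emeasure (density m d) B"
      by (simp add: emeasure_density)
  qed (simp add: sets_m)
  have "(\<integral>\<^sup>+ \<omega>. indicator A \<omega> * \<phi> (X (t + u) \<omega>) \<partial>P x) = (\<integral>\<^sup>+ y. \<phi> y \<partial>distr (density (P x) (indicator A)) borel (X (t + u)))"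
    by (simp add: nn_integral_distr nn_integral_density)
  also have "\<dots> = (\<integral>\<^sup>+ y. d y * \<phi> y \<partial>m)" unfolding eq by (simp add: nn_integral_density)
  finally show ?thesis by (simp add: swap)
qed


text \<open>Both sides are densities of the law of \<open>X (t + u)\<close>. Uniqueness of densities
  gives equality only almost everywhere in \<open>z\<close>, which leaves \<open>z = 0\<close>
  open.\<close>

lemma chapman_kolmogorov_AE:
  assumes t: "t > 0" and u: "u > 0" and x: "x \<ge> 0"
  shows "AE z in m. ennreal (p (t + u) x z) = (\<integral>\<^sup>+ y. ennreal (p t x y * p u y z) \<partial>m)"
proof -
  interpret m: sigma_finite_measure m by (rule sigma_finite_m)
  interpret pair_sigma_finite m m ..
  have [measurable]: "(\<lambda>z. p u (snd z) (fst z)) \<in> borel_measurable (m \<Otimes>\<^sub>M m)"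
    "(\<lambda>z. p t x (snd z)) \<in> borel_measurable (m \<Otimes>\<^sub>M m)" "(\<lambda>z. p t x (fst z)) \<in> borel_measurable (m \<Otimes>\<^sub>M m)"
    "(\<lambda>z. p u (fst z) (snd z)) \<in> borel_measurable (m \<Otimes>\<^sub>M m)"
    using t u by (intro measurable_p; measurable)+
  have [measurable]: "p u z \<in> borel_measurable m" "p t z \<in> borel_measurable m"
    "p u z \<in> borel_measurable borel" "p t z \<in> borel_measurable borel"  for z
    using t u by (intro measurable_p; measurable)+
  have tu: "t + u > 0" using t u by simp
  define I where "I z = (\<integral>\<^sup>+ y. ennreal (p t x y * p u y z) \<partial>m)" for z
  have Im [measurable]: "I \<in> borel_measurable m" unfolding I_def
    using m.borel_measurable_nn_integral_fst[of "\<lambda>z. ennreal (p t x (snd z) * p u (snd z) (fst z))" m] by simp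
  have pm [measurable]: "p (t + u) x \<in> borel_measurable m" using tu by (intro measurable_p) measurable
  have "density m (\<lambda>z. ennreal (p (t + u) x z)) = density m I"
  proof (rule measure_eqI)
    fix B assume "B \<in> sets (density m (\<lambda>z. ennreal (p (t + u) x z)))"
    hence B [measurable]: "B \<in> sets borel" "B \<in> sets m" by (simp_all add: sets_m)
    have "emeasure (density m (\<lambda>z. ennreal (p (t + u) x z))) B = (\<integral>\<^sup>+ y. ennreal (p (t + u) x y) * indicator B y \<partial>m)"
      by (subst emeasure_density) auto
    also have "\<dots> = (\<integral>\<^sup>+ \<omega>. indicator B (X (t + u) \<omega>) \<partial>P x)"
      using tu x by (subst nn_integral_X) auto
    also have "\<dots> = (\<integral>\<^sup>+ \<omega>. indicator (space M) \<omega> * indicator B (X (t + u) \<omega>) \<partial>P x)"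
      using x by (intro nn_integral_cong) (auto simp: space_P)
    also have "\<dots> = (\<integral>\<^sup>+ \<omega>. indicator (space M) \<omega> * (\<integral>\<^sup>+ y. ennreal (p u (X t \<omega>) y) * indicator B y \<partial>m) \<partial>P x)"
      using t u x sets.top[of "natural_filtration M X t"]
      by (subst nn_integral_markov) (auto simp: space_natural_filtration)
    also have "\<dots> = (\<integral>\<^sup>+ \<omega>. (\<integral>\<^sup>+ y. ennreal (p u (X t \<omega>) y) * indicator B y \<partial>m) \<partial>P x)"
      using x by (intro nn_integral_cong) (auto simp: space_P)
    also have "\<dots> = (\<integral>\<^sup>+ z. ennreal (p t x z) * (\<integral>\<^sup>+ y. ennreal (p u z y) * indicator B y \<partial>m) \<partial>m)"
    proof (rule nn_integral_X[OF t x])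
      show "(\<lambda>z. \<integral>\<^sup>+ y. ennreal (p u z y) * indicator B y \<partial>m) \<in> borel_measurable borel"
        using m.borel_measurable_nn_integral_fst[of "\<lambda>z. ennreal (p u (fst z) (snd z)) * indicator B (snd z)" m]
        by (simp cong: measurable_cong_sets add: measurable_cong_sets[OF sets_m refl])
    qed
    also have "\<dots> = (\<integral>\<^sup>+ z. (\<integral>\<^sup>+ y. ennreal (p t x z * p u z y) * indicator B y \<partial>m) \<partial>m)"
      using p_nonneg[OF t] p_nonneg[OF u]
      by (intro nn_integral_cong) (simp add: nn_integral_cmult[symmetric] ennreal_mult mult.assoc)
    also have "\<dots> = (\<integral>\<^sup>+ y. (\<integral>\<^sup>+ z. ennreal (p t x z * p u z y) * indicator B y \<partial>m) \<partial>m)"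
      by (rule Fubini'[symmetric]) (simp add: case_prod_unfold)
    also have "\<dots> = (\<integral>\<^sup>+ y. I y * indicator B y \<partial>m)"
    proof (rule nn_integral_cong)
      fix y
      have "(\<lambda>z. p u z y) \<in> borel_measurable m" using u by (intro measurable_p) measurable
      thus "(\<integral>\<^sup>+ z. ennreal (p t x z * p u z y) * indicator B y \<partial>m) = I y * indicator B y"
        unfolding I_def by (subst nn_integral_multc) auto
    qed
    also have "\<dots> = emeasure (density m I) B" by (simp add: emeasure_density)
    finally show "emeasure (density m (\<lambda>z. ennreal (p (t + u) x z))) B = emeasure (density m I) B" .
  qed simp
  thus ?thesis by (subst (asm) m.density_unique_iff) (auto simp: I_def)
qed

lemma AE_m_sequence:
  assumes "AE y in m. Q y" "0 \<le> z"
  obtains zs where "zs \<longlonglongrightarrow> z" "\<And>n. 0 < zs n" "\<And>n. Q (zs n)"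
proof -
  have "\<forall>n. \<exists>y. z < y \<and> y < z + 1 / real (Suc n) \<and> Q y"
    using AE_m_dense[OF assms] by simp
  then obtain zs where zs: "\<And>n. z < zs n" "\<And>n. zs n < z + 1 / real (Suc n)" "\<And>n. Q (zs n)" by metis
  have lim: "(\<lambda>n. z + 1 / real (Suc n)) \<longlonglongrightarrow> z" by real_asymp
  have "zs \<longlonglongrightarrow> z"
    by (rule tendsto_sandwich[OF _ _ tendsto_const lim]) (use zs in \<open>auto intro!: less_imp_le always_eventually\<close>)
  thus ?thesis using that zs assms(2) by (meson le_less_trans)
qed

text \<open>Fatou's lemma along good points tending to \<open>z\<close>. Integrals of the products
  could drop in the limit, so this yields only an inequality; it already secures integrability, and
  with it the L^2 bounds.\<close>

lemma chapman_kolmogorov_le: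
  assumes t: "t > 0" and u: "u > 0" and x: "x \<ge> 0" and z: "z \<ge> 0"
  shows "(\<integral>\<^sup>+ y. ennreal (p t x y * p u y z) \<partial>m) \<le> ennreal (p (t + u) x z)"
proof -
  obtain zs where zs: "zs \<longlonglongrightarrow> z"
    "\<And>n. ennreal (p (t + u) x (zs n)) = (\<integral>\<^sup>+ y. ennreal (p t x y * p u y (zs n)) \<partial>m)"
    using AE_m_sequence[OF chapman_kolmogorov_AE[OF t u x] z] by metis
  have "(\<integral>\<^sup>+ y. ennreal (p t x y * p u y z) \<partial>m) = (\<integral>\<^sup>+ y. liminf (\<lambda>n. ennreal (p t x y * p u y (zs n))) \<partial>m)"
  proof (rule nn_integral_cong)
    fix y
    have "(\<lambda>n. ennreal (p t x y * p u y (zs n))) \<longlonglongrightarrow> ennreal (p t x y * p u y z)"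
      using zs(1) u by (intro tendsto_ennrealI tendsto_intros tendsto_p)
    from lim_imp_Liminf[OF _ this] 
    show "ennreal (p t x y * p u y z) = liminf (\<lambda>n. ennreal (p t x y * p u y (zs n)))" by simp
  qed
  also have "\<dots> \<le> liminf (\<lambda>n. \<integral>\<^sup>+ y. ennreal (p t x y * p u y (zs n)) \<partial>m)"
    using t u by (intro nn_integral_liminf measurable_compose[OF _ measurable_ennreal] borel_measurable_times measurable_p)
      (auto simp: sets_m cong: measurable_cong_sets)
  also have "(\<lambda>n. \<integral>\<^sup>+ y. ennreal (p t x y * p u y (zs n)) \<partial>m) = (\<lambda>n. ennreal (p (t + u) x (zs n)))"
    using zs(2) by simp
  also have "liminf (\<lambda>n. ennreal (p (t + u) x (zs n))) = ennreal (p (t + u) x z)"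
    using zs(1) t u by (intro lim_imp_Liminf tendsto_ennrealI tendsto_p) auto
  finally show ?thesis .
qed

lemma integrable_p_mult:
  assumes t: "t > 0" and u: "u > 0" and x: "x \<ge> 0" and z: "z \<ge> 0"
  shows "integrable m (\<lambda>y. p t x y * p u y z)"
    and "(LINT y|m. p t x y * p u y z) \<le> p (t + u) x z"
proof -
  have m: "(\<lambda>y. p t x y * p u y z) \<in> borel_measurable m"
    using t u by (intro borel_measurable_times measurable_p) (auto simp: sets_m cong: measurable_cong_sets)
  have nn: "0 \<le> p t x y * p u y z" for y using p_nonneg t u by simp
  show i: "integrable m (\<lambda>y. p t x y * p u y z)"
    using chapman_kolmogorov_le[OF assms] m nn
    by (intro integrableI_nonneg) (auto simp: top.extremum_strict intro: le_less_trans)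
  show "(LINT y|m. p t x y * p u y z) \<le> p (t + u) x z"
    using chapman_kolmogorov_le[OF assms] nn p_nonneg[of "t + u"] t u
    by (subst (asm) nn_integral_eq_integral[OF i]) auto
qed

text \<open>The reverse inequality is Fatou's lemma for \<open>(\<lambda> k\<^sup>2 + k\<^sub>n\<^sup>2 / \<lambda>) / 2 - k k\<^sub>n \<ge> 0\<close>, where
  \<open>k = p t x\<close>, \<open>k\<^sub>n = p u z\<^sub>n\<close> and \<open>z\<^sub>n \<longlonglongrightarrow> z\<close>, followed by \<open>\<lambda> \<longlonglongrightarrow> \<infinity>\<close>: the \<open>k\<^sub>n\<close> are bounded in
  \<open>L\<^sup>2\<close> by the inequality already known.\<close>

lemma chapman_kolmogorov:
  assumes t: "t > 0" and u: "u > 0" and x: "x \<ge> 0" and z: "z \<ge> 0"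
  shows "(LINT y|m. p t x y * p u y z) = p (t + u) x z"
proof (rule antisym[OF integrable_p_mult(2)[OF assms]])
  obtain zs where zs: "zs \<longlonglongrightarrow> z" "\<And>n. 0 < zs n"
    "\<And>n. ennreal (p (t + u) x (zs n)) = (\<integral>\<^sup>+ y. ennreal (p t x y * p u y (zs n)) \<partial>m)"
    using AE_m_sequence[OF chapman_kolmogorov_AE[OF t u x] z] by metis
  have zs0: "0 \<le> zs n" for n using zs(2) by (simp add: less_imp_le)
  have [measurable]: "p t x \<in> borel_measurable m" "(\<lambda>y. p u y w) \<in> borel_measurable m" for w
    using t u by (intro measurable_p; simp add: sets_m cong: measurable_cong_sets)+
  have Isq: "integrable m (\<lambda>y. p r y w * p r y w)" "(LINT y|m. p r y w * p r y w) \<le> p (r + r) w w"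
    if "r > 0" "w \<ge> 0" for r w
    using integrable_p_mult[of r r w w] that by (simp_all add: p_sym[of r w])
  define A where "A = (LINT y|m. p t y x * p t y x)"
  define B where "B w = (LINT y|m. p u y w * p u y w)" for w
  define I where "I w = (LINT y|m. p t x y * p u y w)" for w
  have In: "I (zs n) = p (t + u) x (zs n)" for n
  proof -
    have "ennreal (I (zs n)) = ennreal (p (t + u) x (zs n))"
      unfolding I_def zs(3) using p_nonneg t u
      by (intro nn_integral_eq_integral[symmetric] integrable_p_mult x zs0) auto
    thus ?thesis using p_nonneg t u unfolding I_def by (subst (asm) ennreal_inj) auto
  qed
  have le: "p (t + u) x z \<le> I z + p (u + u) z z / (2 * l)" if l: "l > 0" for l
  proof -
    define g where "g w y = l / 2 * (p t y x * p t y x) + (p u y w * p u y w) / (2 * l) - p t x y * p u y w" for w y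
    have g0: "0 \<le> g w y" for w y
    proof -
      have "g w y = (l * p t y x - p u y w)\<^sup>2 / (2 * l)"
        unfolding g_def using l p_sym[OF t, of x y] by (simp add: power2_eq_square field_simps)
      thus ?thesis using l by simp
    qed
    have gi: "integrable m (g w)" and gI: "(LINT y|m. g w y) = l / 2 * A + B w / (2 * l) - I w" if "0 \<le> w" for w
    proof -
      have i: "integrable m (\<lambda>y. l / 2 * (p t y x * p t y x))" "integrable m (\<lambda>y. (p u y w * p u y w) / (2 * l))"
        "integrable m (\<lambda>y. p t x y * p u y w)"
        using Isq[OF t x] Isq[OF u that] integrable_p_mult[OF t u x that]
        by (auto intro: integrable_mult_right integrable_divide)
      show "integrable m (g w)" unfolding g_def using i by auto
      show "(LINT y|m. g w y) = l / 2 * A + B w / (2 * l) - I w"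
        unfolding g_def A_def B_def I_def using i by simp
    qed
    have "ennreal (l / 2 * A + B z / (2 * l) - I z) = (\<integral>\<^sup>+ y. ennreal (g z y) \<partial>m)"
      unfolding gI[OF z, symmetric] using g0 gi[OF z] by (intro nn_integral_eq_integral[symmetric]) auto
    also have "\<dots> = (\<integral>\<^sup>+ y. liminf (\<lambda>n. ennreal (g (zs n) y)) \<partial>m)"
    proof (rule nn_integral_cong)
      fix y
      have "(\<lambda>n. ennreal (g (zs n) y)) \<longlonglongrightarrow> ennreal (g z y)"
        unfolding g_def using zs(1) u l by (intro tendsto_ennrealI tendsto_intros tendsto_p) auto
      from lim_imp_Liminf[OF _ this] show "ennreal (g z y) = liminf (\<lambda>n. ennreal (g (zs n) y))" by simp
    qed
    also have "\<dots> \<le> liminf (\<lambda>n. \<integral>\<^sup>+ y. ennreal (g (zs n) y) \<partial>m)"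
      using gi[OF zs0] by (intro nn_integral_liminf) (auto intro: borel_measurable_integrable)
    also have "(\<lambda>n. \<integral>\<^sup>+ y. ennreal (g (zs n) y) \<partial>m) = (\<lambda>n. ennreal (l / 2 * A + B (zs n) / (2 * l) - I (zs n)))"
      using g0 gi[OF zs0] gI[OF zs0] by (subst nn_integral_eq_integral) auto
    also have "liminf \<dots> \<le> liminf (\<lambda>n. ennreal (l / 2 * A + p (u + u) (zs n) (zs n) / (2 * l) - p (t + u) x (zs n)))"
    proof (intro Liminf_mono always_eventually allI ennreal_leI)
      fix n
      have "B (zs n) / (2 * l) \<le> p (u + u) (zs n) (zs n) / (2 * l)"
        unfolding B_def using Isq(2)[OF u zs0] l by (intro divide_right_mono) auto
      thus "l / 2 * A + B (zs n) / (2 * l) - I (zs n) \<le> l / 2 * A + p (u + u) (zs n) (zs n) / (2 * l) - p (t + u) x (zs n)"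
        by (simp add: In)
    qed
    also have "\<dots> = ennreal (l / 2 * A + p (u + u) z z / (2 * l) - p (t + u) x z)"
      using zs(1) t u l by (intro lim_imp_Liminf tendsto_ennrealI tendsto_intros tendsto_p) auto
    finally have le: "ennreal (l / 2 * A + B z / (2 * l) - I z) \<le> ennreal (l / 2 * A + p (u + u) z z / (2 * l) - p (t + u) x z)" .
    \<comment> \<open>\<open>ennreal\<close> clips negative numbers to \<open>0\<close>, so
      \<open>le\<close> can be read as an inequality of reals only if its right side is nonnegative.
      That side is a limit of upper bounds for integrals of \<open>g (zs n)\<close>, which is a
      square.\<close>
    have "0 \<le> l / 2 * A + p (u + u) z z / (2 * l) - p (t + u) x z"
    proof (rule LIMSEQ_le_const)
      show "(\<lambda>n. l / 2 * A + p (u + u) (zs n) (zs n) / (2 * l) - p (t + u) x (zs n)) \<longlonglongrightarrow> l / 2 * A + p (u + u) z z / (2 * l) - p (t + u) x z"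
        using zs(1) t u l by (intro tendsto_intros tendsto_p) auto
      have "0 \<le> l / 2 * A + p (u + u) (zs n) (zs n) / (2 * l) - p (t + u) x (zs n)" for n
      proof -
        have "0 \<le> (LINT y|m. g (zs n) y)" using g0 by simp
        moreover have "B (zs n) / (2 * l) \<le> p (u + u) (zs n) (zs n) / (2 * l)"
          unfolding B_def using Isq(2)[OF u zs0] l by (intro divide_right_mono) auto
        ultimately show ?thesis unfolding gI[OF zs0] by (simp add: In)
      qed
      thus "\<exists>N. \<forall>n\<ge>N. 0 \<le> l / 2 * A + p (u + u) (zs n) (zs n) / (2 * l) - p (t + u) x (zs n)" by blast
    qed
    with le have "l / 2 * A + B z / (2 * l) - I z \<le> l / 2 * A + p (u + u) z z / (2 * l) - p (t + u) x z"
      by (simp add: ennreal_le_iff)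
    \<comment> \<open>\<open>A\<close> cancels and \<open>B z\<close> may be discarded, so the
      remaining defect is of order \<open>1 / l\<close>.\<close>
    moreover have "0 \<le> B z / (2 * l)" unfolding B_def using l by simp
    ultimately show ?thesis by linarith
  qed
  have "(\<lambda>n. a + b / (2 * real (Suc n))) \<longlonglongrightarrow> a" for a b :: real by real_asymp
  hence "(\<lambda>n. I z + p (u + u) z z / (2 * real (Suc n))) \<longlonglongrightarrow> I z" .
  moreover have "\<exists>N. \<forall>n\<ge>N. p (t + u) x z \<le> I z + p (u + u) z z / (2 * real (Suc n))"
    by (intro exI[of _ 0] allI impI le) simp
  ultimately show "p (t + u) x z \<le> (LINT y|m. p t x y * p u y z)"
    unfolding I_def by (rule LIMSEQ_le_const)
qed

end

section \<open>Probability flux\<close>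

context linear_diffusion_density begin

definition pt :: "real \<Rightarrow> real \<Rightarrow> real \<Rightarrow> real" where
  "pt t x y = deriv (\<lambda>u. p u x y) t"

text \<open>The derivative of the density with respect to scale instead of position: the rate at
  which mass crosses \<open>b\<close> downwards. It is taken in the first space variable, the one in
  which the evolution equation is stated; the starting point \<open>x\<close> comes first so that
  \<open>flux x t\<close> is a function of position.\<close>

definition flux :: "real \<Rightarrow> real \<Rightarrow> real \<Rightarrow> real" where
  "flux x t b = deriv (\<lambda>z. q t z x) b / deriv s b"

lemma at_within_Ici_pos: "0 < x \<Longrightarrow> at x within {0..} = at (x::real)"
  by (rule at_within_interior) simp

lemma DERIV_p_time: "t > 0 \<Longrightarrow> ((\<lambda>u. p u x y) has_real_derivative pt t x y) (at t)"
proof -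
  assume t: "t > 0"
  from density_C122 obtain qt where "\<forall>t>0. \<forall>x\<ge>0. \<forall>y\<ge>0. ((\<lambda>u. q u x y) has_real_derivative qt t x y) (at t)"
    unfolding C122_def by blast
  with t have "((\<lambda>u. p u x y) has_real_derivative qt t (max 0 x) (max 0 y)) (at t)"
    by (simp add: p_def)
  with DERIV_imp_deriv[OF this] show ?thesis by (simp add: pt_def)
qed

lemma continuous_on_pt [continuous_intros]:
  fixes f g h :: "'b::topological_space \<Rightarrow> real"
  assumes "continuous_on S f" "continuous_on S g" "continuous_on S h" "\<And>w. w \<in> S \<Longrightarrow> 0 < f w"
  shows "continuous_on S (\<lambda>w. pt (f w) (g w) (h w))"
proof -
  from density_C122 obtain qt where c: "continuous_on ({0<..} \<times> {0..} \<times> {0..}) (\<lambda>(t, x, y). qt t x y)"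
    and d: "\<forall>t>0. \<forall>x\<ge>0. \<forall>y\<ge>0. ((\<lambda>u. q u x y) has_real_derivative qt t x y) (at t)"
    unfolding C122_def by blast
  have "continuous_on S (\<lambda>w. (\<lambda>(t, x, y). qt t x y) (f w, max 0 (g w), max 0 (h w)))"
    by (rule continuous_on_compose2[OF c]) (use assms in \<open>auto intro!: continuous_intros\<close>)
  moreover have "pt t x y = qt t (max 0 x) (max 0 y)" if "t > 0" for t x y
    unfolding pt_def p_def using d that by (intro DERIV_imp_deriv) auto
  ultimately show ?thesis using assms(4) by (simp cong: continuous_on_cong)
qed

lemma DERIV_q_space:
  assumes "t > 0" "b > 0" "x \<ge> 0"
  shows "((\<lambda>z. q t z x) has_real_derivative deriv s b * flux x t b) (at b)"
proof -
  from density_C122 obtain qx where "\<forall>t>0. \<forall>x\<ge>0. \<forall>y\<ge>0. ((\<lambda>z. q t z y) has_real_derivative qx t x y) (at x within {0..})"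
    unfolding C122_def by blast
  hence "((\<lambda>z. q t z x) has_real_derivative qx t b x) (at b within {0..})" using assms by simp
  hence "((\<lambda>z. q t z x) has_real_derivative qx t b x) (at b)" by (simp only: at_within_Ici_pos[OF assms(2)])
  moreover from DERIV_imp_deriv[OF this] have "qx t b x = deriv s b * flux x t b"
    using scale_deriv_pos[OF assms(2)] by (simp add: flux_def)
  ultimately show ?thesis by simp
qed

lemma DERIV_s: "x > 0 \<Longrightarrow> (s has_real_derivative deriv s x) (at x)"
  and DERIV_deriv_s: "x > 0 \<Longrightarrow> (deriv s has_real_derivative deriv (deriv s) x) (at x)"
  using scale_C2 by (auto simp: DERIV_deriv_iff_real_differentiable)

lemma continuous_on_deriv_s: "continuous_on {0<..} (deriv s)"
  by (intro continuous_at_imp_continuous_on ballI DERIV_isCont[OF DERIV_deriv_s]) simp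

lemma continuous_on_flux [continuous_intros]:
  fixes f g :: "'b::topological_space \<Rightarrow> real"
  assumes "x \<ge> 0" "continuous_on S f" "continuous_on S g" "\<And>w. w \<in> S \<Longrightarrow> 0 < f w" "\<And>w. w \<in> S \<Longrightarrow> 0 < g w"
  shows "continuous_on S (\<lambda>w. flux x (f w) (g w))"
proof -
  from density_C122 obtain qx where c: "continuous_on ({0<..} \<times> {0..} \<times> {0..}) (\<lambda>(t, x, y). qx t x y)"
    and d: "\<forall>t>0. \<forall>x\<ge>0. \<forall>y\<ge>0. ((\<lambda>z. q t z y) has_real_derivative qx t x y) (at x within {0..})"
    unfolding C122_def by blast
  have "continuous_on S (\<lambda>w. (\<lambda>(t, x, y). qx t x y) (f w, g w, x))"
  proof (rule continuous_on_compose2[OF c])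
    show "continuous_on S (\<lambda>w. (f w, g w, x))" by (intro continuous_on_Pair assms continuous_on_const)
    show "(\<lambda>w. (f w, g w, x)) ` S \<subseteq> {0<..} \<times> {0..} \<times> {0..}" using assms(1,4,5) by (auto intro: less_imp_le)
  qed
  moreover have "continuous_on S (\<lambda>w. deriv s (g w))"
    by (rule continuous_on_compose2[OF continuous_on_deriv_s assms(3)]) (use assms in auto)
  ultimately have "continuous_on S (\<lambda>w. qx (f w) (g w) x / deriv s (g w))"
    using less_imp_neq[OF scale_deriv_pos[OF assms(5)]] by (intro continuous_on_divide) auto
  moreover have "flux x t b = qx t b x / deriv s b" if "t > 0" "b > 0" for t b
  proof -
    have "((\<lambda>z. q t z x) has_real_derivative qx t b x) (at b within {0..})" using d that assms(1) by simp
    hence "((\<lambda>z. q t z x) has_real_derivative qx t b x) (at b)" by (simp only: at_within_Ici_pos[OF that(2)])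
    from DERIV_imp_deriv[OF this] show ?thesis by (simp add: flux_def)
  qed
  ultimately show ?thesis using assms(4,5) by (simp cong: continuous_on_cong)
qed

text \<open>The generator is a speed derivative of a scale derivative, so the evolution equation
  multiplied by \<open>\<rho>\<close> gives the value. That the derivative exists at all has to come
  from the class \<open>C122\<close> and the smoothness of \<open>s\<close>, since
  \<open>deriv\<close> is total.\<close>

lemma DERIV_flux:
  assumes t: "t > 0" and b: "b > 0" and x: "x \<ge> 0"
  shows "(flux x t has_real_derivative \<rho> b * pt t b x) (at b)"
proof -
  from density_C122 obtain qx qxx where
    "\<forall>t>0. \<forall>x\<ge>0. \<forall>y\<ge>0. ((\<lambda>z. q t z y) has_real_derivative qx t x y) (at x within {0..}) \<and>
      ((\<lambda>z. qx t z y) has_real_derivative qxx t x y) (at x within {0..})"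
    unfolding C122_def by blast
  hence d: "((\<lambda>z. q t z x) has_real_derivative qx t z x) (at z within {0..})"
      "((\<lambda>z. qx t z x) has_real_derivative qxx t z x) (at z within {0..})" if "z > 0" for z
    using t x that by auto
  have d1: "deriv (\<lambda>z. q t z x) z = qx t z x" if "z > 0" for z
    using d(1)[OF that] unfolding at_within_Ici_pos[OF that] by (rule DERIV_imp_deriv)
  have d2: "((\<lambda>z. qx t z x) has_real_derivative qxx t b x) (at b)"
    using d(2)[OF b] unfolding at_within_Ici_pos[OF b] .
  have "((\<lambda>z. 1 / deriv s z * qx t z x) has_real_derivative
      (- deriv (deriv s) b / (deriv s b)\<^sup>2) * qx t b x + 1 / deriv s b * qxx t b x) (at b)"
    using scale_deriv_pos[OF b]
    by (auto intro!: derivative_eq_intros DERIV_deriv_s d2 b simp: power2_eq_square field_simps)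
  hence D: "((\<lambda>z. 1 / deriv s z * deriv (\<lambda>w. q t w x) z) has_real_derivative
      (- deriv (deriv s) b / (deriv s b)\<^sup>2) * qx t b x + 1 / deriv s b * qxx t b x) (at b)"
    by (rule has_field_derivative_transform_within_open[where S="{0<..}"]) (use b d1 in auto)
  have "deriv (\<lambda>u. q u b x) t = pt t b x" using b x by (simp add: pt_def p_def)
  with density_pde[OF t b x] have "deriv (\<lambda>z. 1 / deriv s z * deriv (\<lambda>w. q t w x) z) b = \<rho> b * pt t b x"
    using speed_density_pos[OF b] unfolding generator_def by (simp add: field_simps)
  with D DERIV_imp_deriv[OF D] show ?thesis by (simp add: flux_def[abs_def])
qed

text \<open>The fundamental theorem of calculus for the speed measure. As \<open>\<rho>\<close> is
  only measurable, it passes through the gauge integral; differentiability is asked in the open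
  interval only, which admits \<open>a = 0\<close>.\<close>

lemma set_integral_m_eq_diff:
  assumes ab: "0 \<le> a" "a \<le> b" and cont: "continuous_on {a..b} \<psi>"
    and deriv: "\<And>y. a < y \<Longrightarrow> y < b \<Longrightarrow> (\<psi> has_real_derivative \<rho> y * \<phi> y) (at y)"
    and int: "set_integrable m {a<..b} \<phi>" and [measurable]: "\<phi> \<in> borel_measurable borel"
  shows "(LINT y:{a<..b}|m. \<phi> y) = \<psi> b - \<psi> a"
proof -
  have r0: "0 \<le> \<rho> y * indicator {0<..} y" for y using speed_density_pos[of y] by (auto simp: indicator_def)
  have m_eq: "m = density lborel (\<lambda>y. ennreal (\<rho> y * indicator {0<..} y))"
    unfolding speed_measure_def by (intro arg_cong[where f="density lborel"] ext) (auto simp: indicator_def)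
  have eq: "\<rho> y * indicator {0<..} y * (indicator {a<..b} y * \<phi> y) = indicator {a<..b} y * (\<rho> y * \<phi> y)" for y
    using ab by (auto simp: indicator_def)
  have "(LINT y:{a<..b}|m. \<phi> y) = (LINT y|lborel. \<rho> y * indicator {0<..} y * (indicator {a<..b} y * \<phi> y))"
    unfolding m_eq set_lebesgue_integral_def using r0 by (subst integral_density) auto
  also have "\<dots> = (LINT y:{a<..b}|lborel. \<rho> y * \<phi> y)"
    unfolding eq set_lebesgue_integral_def by simp
  finally have 1: "(LINT y:{a<..b}|m. \<phi> y) = (LINT y:{a<..b}|lborel. \<rho> y * \<phi> y)" .
  have "integrable lborel (\<lambda>y. \<rho> y * indicator {0<..} y * (indicator {a<..b} y * \<phi> y))"
    using int r0 unfolding m_eq set_integrable_def by (subst (asm) integrable_density) auto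
  hence i1: "set_integrable lborel {a<..b} (\<lambda>y. \<rho> y * \<phi> y)"
    unfolding eq set_integrable_def by simp
  hence 2: "set_integrable lborel {a..b} (\<lambda>y. \<rho> y * \<phi> y)"
    unfolding set_integrable_def
    by (rule integrable_cong_AE_imp) (use AE_lborel_singleton[of a] in \<open>auto elim!: eventually_mono simp: indicator_def\<close>)
  have "(LINT y:{a<..b}|lborel. \<rho> y * \<phi> y) = (LINT y:{a..b}|lborel. \<rho> y * \<phi> y)"
    unfolding set_lebesgue_integral_def
    by (rule integral_cong_AE) (use AE_lborel_singleton[of a] in \<open>auto elim!: eventually_mono simp: indicator_def\<close>)
  also have "\<dots> = integral {a..b} (\<lambda>y. \<rho> y * \<phi> y)"
    by (rule set_borel_integral_eq_integral(2)[OF 2])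
  also have "\<dots> = \<psi> b - \<psi> a"
    by (intro integral_unique fundamental_theorem_of_calculus_interior ab cont)
       (use deriv in \<open>auto simp: has_real_derivative_iff_has_vector_derivative\<close>)
  finally show ?thesis using 1 by simp
qed


lemma measurable_pt:
  assumes "t > 0" and [measurable]: "f \<in> borel_measurable N" "g \<in> borel_measurable N"
  shows "(\<lambda>w. pt t (f w) (g w)) \<in> borel_measurable N"
proof -
  have "continuous_on UNIV (\<lambda>w. pt t (fst w) (snd w))" using assms by (intro continuous_intros) auto
  hence "(\<lambda>w. pt t (fst w) (snd w)) \<in> borel_measurable borel" by (rule borel_measurable_continuous_onI)
  hence [measurable]: "(\<lambda>w. pt t (fst w) (snd w)) \<in> borel_measurable (borel \<Otimes>\<^sub>M borel)" by (simp add: borel_prod)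
  have "(\<lambda>w. (\<lambda>w. pt t (fst w) (snd w)) (f w, g w)) \<in> borel_measurable N" by measurable
  thus ?thesis by simp
qed

lemma borel_measurable_mI: "f \<in> borel_measurable borel \<Longrightarrow> f \<in> borel_measurable m"
  by (simp add: measurable_cong_sets[OF sets_m refl])

section \<open>Mass balance, and the vanishing of the flux at infinity and at
  \<open>0\<close>\<close>

lemma integrable_p:
  assumes t: "t > 0" and x: "x \<ge> 0"
  shows "integrable m (\<lambda>y. p t y x)" and "(LINT y|m. p t y x) = 1"
proof -
  have eq: "(\<integral>\<^sup>+ y. ennreal (p t y x) \<partial>m) = 1" using nn_integral_p[OF assms] by (simp add: p_sym[OF t, of x])
  have m: "(\<lambda>y. p t y x) \<in> borel_measurable m" using t by (intro borel_measurable_mI measurable_p) auto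
  show i: "integrable m (\<lambda>y. p t y x)"
    by (rule integrableI_nonneg[OF m]) (simp_all add: p_nonneg[OF t] eq)
  have "ennreal (LINT y|m. p t y x) = 1"
    using nn_integral_eq_integral[OF i] p_nonneg[OF t] eq by simp
  thus "(LINT y|m. p t y x) = 1" by (simp add: ennreal_eq_1)
qed

lemma set_integrable_p: "t > 0 \<Longrightarrow> x \<ge> 0 \<Longrightarrow> S \<in> sets borel \<Longrightarrow> set_integrable m S (\<lambda>y. p t y x)"
  unfolding set_integrable_def by (intro integrable_mult_indicator integrable_p) (auto simp: sets_m)

definition mass :: "real \<Rightarrow> real \<Rightarrow> real \<Rightarrow> real" where
  "mass x t b = (LINT y:{0<..b}|m. p t y x)"

lemma mass_tendsto_1:
  assumes t: "t > 0" and x: "x \<ge> 0"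
  shows "(mass x t \<longlongrightarrow> 1) at_top"
proof -
  have "((\<lambda>b. LINT y|m. indicator {..b} y *\<^sub>R p t y x) \<longlongrightarrow> (LINT y|m. p t y x)) at_top"
    by (rule tendsto_integral_at_top) (auto simp: sets_m integrable_p assms)
  moreover have "(LINT y|m. indicator {..b} y *\<^sub>R p t y x) = mass x t b" for b
    unfolding mass_def set_lebesgue_integral_def
  proof (rule integral_cong_AE)
    show "AE y in m. indicator {..b} y *\<^sub>R p t y x = indicator {0<..b} y *\<^sub>R p t y x"
      using AE_m_pos by eventually_elim (auto simp: indicator_def)
  qed (use t in \<open>auto intro!: borel_measurable_mI borel_measurable_times measurable_p\<close>)
  ultimately show ?thesis by (simp add: integrable_p assms)
qed

lemma mass_diff:
  assumes "t > 0" "x \<ge> 0" "0 \<le> a" "a \<le> b"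
  shows "(LINT y:{a<..b}|m. p t y x) = mass x t b - mass x t a"
proof -
  have "{0<..b} = {0<..a} \<union> {a<..b}" using assms by auto
  hence "mass x t b = mass x t a + (LINT y:{a<..b}|m. p t y x)"
    unfolding mass_def using assms by (simp add: set_integral_Un set_integrable_p)
  thus ?thesis by simp
qed

lemma emeasure_m_Ioc_finite:
  assumes "0 < a"
  shows "emeasure m {a<..b} < \<infinity>"
proof (cases "a < b")
  case True
  have "emeasure m {a<..b} \<le> emeasure m {a..b}" by (intro emeasure_mono) (auto simp: sets_m)
  also have "\<dots> < \<infinity>" using speed_locally_finite[OF assms True] .
  finally show ?thesis .
qed simp

lemma DERIV_integral_p:
  assumes t: "t > 0" and x: "x \<ge> 0" and a: "0 \<le> a" and fin: "emeasure m {a<..b} < \<infinity>"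
  shows "((\<lambda>t. LINT y:{a<..b}|m. p t y x) has_real_derivative (LINT y:{a<..b}|m. pt t y x)) (at t)"
    and "set_integrable m {a<..b} (\<lambda>y. pt t y x)"
proof -
  have "\<And>r y. r \<in> {t - t/2..t + t/2} \<Longrightarrow> 0 < r" using t by auto
  note * = has_real_derivative_set_integral[of m "{a<..b}" 0 b "t/2" "\<lambda>t y. pt t y x" t "\<lambda>t y. p t y x"]
  show "((\<lambda>t. LINT y:{a<..b}|m. p t y x) has_real_derivative (LINT y:{a<..b}|m. pt t y x)) (at t)"
    "set_integrable m {a<..b} (\<lambda>y. pt t y x)"
    using t a x fin
    by (intro *; auto simp: sets_m split_beta intro!: continuous_intros DERIV_p_time set_integrable_p measurable_pt)+
qed

text \<open>Mass balance on \<open>]a, b]\<close>: inflow at \<open>b\<close> minus outflow at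
  \<open>a\<close>. A positive \<open>a\<close> guarantees finite speed measure.\<close>

lemma DERIV_mass_diff:
  assumes t: "t > 0" and x: "x \<ge> 0" and a: "0 < a" "a \<le> b"
  shows "((\<lambda>t. mass x t b - mass x t a) has_real_derivative flux x t b - flux x t a) (at t)"
proof -
  have fin: "emeasure m {a<..b} < \<infinity>" by (rule emeasure_m_Ioc_finite[OF a(1)])
  have "(LINT y:{a<..b}|m. pt t y x) = flux x t b - flux x t a"
  proof (rule set_integral_m_eq_diff)
    show "continuous_on {a..b} (flux x t)" using t x a by (intro continuous_intros) auto
    show "set_integrable m {a<..b} (\<lambda>y. pt t y x)" using DERIV_integral_p(2)[OF t x _ fin] a by simp
    show "(\<lambda>y. pt t y x) \<in> borel_measurable borel" using t by (intro measurable_pt) auto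
  qed (use DERIV_flux t x a in auto)
  with DERIV_integral_p(1)[OF t x _ fin] a
  have "((\<lambda>t. LINT y:{a<..b}|m. p t y x) has_real_derivative flux x t b - flux x t a) (at t)" by simp
  thus ?thesis
    by (rule has_field_derivative_transform_within_open[where S="{0<..}"]) (use t x a mass_diff in auto)
qed

lemma continuous_on_flux_time: "x \<ge> 0 \<Longrightarrow> 0 < t1 \<Longrightarrow> 0 < b \<Longrightarrow> continuous_on {t1..t2} (\<lambda>t. flux x t b)"
  by (intro continuous_intros) auto

lemma integral_flux_diff:
  assumes t: "0 < t1" "t1 \<le> t2" and x: "x \<ge> 0" and a: "0 < a" "a \<le> b"
  shows "integral {t1..t2} (\<lambda>t. flux x t b) - integral {t1..t2} (\<lambda>t. flux x t a) =
    (mass x t2 b - mass x t1 b) - (mass x t2 a - mass x t1 a)"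
proof -
  have "((\<lambda>t. flux x t b - flux x t a) has_integral ((mass x t2 b - mass x t2 a) - (mass x t1 b - mass x t1 a))) {t1..t2}"
  proof (rule fundamental_theorem_of_calculus[OF t(2)])
    fix t assume "t \<in> {t1..t2}"
    with t have "t > 0" by auto
    from DERIV_mass_diff[OF this x a]
    show "((\<lambda>t. mass x t b - mass x t a) has_vector_derivative flux x t b - flux x t a) (at t within {t1..t2})"
      by (simp add: has_real_derivative_iff_has_vector_derivative has_vector_derivative_at_within)
  qed
  moreover have "((\<lambda>t. flux x t b - flux x t a) has_integral
      (integral {t1..t2} (\<lambda>t. flux x t b) - integral {t1..t2} (\<lambda>t. flux x t a))) {t1..t2}"
    using continuous_on_flux_time t x a
    by (intro has_integral_diff integrable_integral integrable_continuous_interval) auto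
  ultimately show ?thesis by (auto dest: has_integral_unique)
qed

text \<open>By the mass balance, time-integrated flux minus mass increment is the same for all
  \<open>b\<close>; \<open>L\<close> is this constant. The increments vanish at infinity because the
  total mass is \<open>1\<close> at both times, so \<open>L\<close> is the flow through infinity.
  Integrating in time replaces the time derivative of the mass, whose limit is not controlled, by a
  difference of masses.\<close>

lemma integral_flux_tendsto:
  assumes t: "0 < t1" "t1 \<le> t2" and x: "x \<ge> 0"
  obtains L where "((\<lambda>b. integral {t1..t2} (\<lambda>t. flux x t b)) \<longlongrightarrow> L) at_top"
    and "\<And>b. b > 0 \<Longrightarrow> integral {t1..t2} (\<lambda>t. flux x t b) = L + (mass x t2 b - mass x t1 b)"
proof -
  define L where "L = integral {t1..t2} (\<lambda>t. flux x t 1) - (mass x t2 1 - mass x t1 1)"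
  have eq: "integral {t1..t2} (\<lambda>t. flux x t b) = L + (mass x t2 b - mass x t1 b)" if "b > 0" for b
    using integral_flux_diff[OF t x, of 1 b] integral_flux_diff[OF t x, of b 1] that
    by (cases "1 \<le> b") (auto simp: L_def)
  have "((\<lambda>b. L + (mass x t2 b - mass x t1 b)) \<longlongrightarrow> L + (1 - 1)) at_top"
    using t x by (intro tendsto_intros mass_tendsto_1) auto
  hence "((\<lambda>b. L + (mass x t2 b - mass x t1 b)) \<longlongrightarrow> L) at_top" by simp
  hence "((\<lambda>b. integral {t1..t2} (\<lambda>t. flux x t b)) \<longlongrightarrow> L) at_top"
    by (rule Lim_transform_eventually) (use eventually_gt_at_top[of 0] in \<open>eventually_elim, auto simp: eq\<close>)
  thus ?thesis using that eq by blast
qed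

lemma DERIV_integral_q:
  assumes t: "0 < t1" "t1 \<le> t2" and x: "x \<ge> 0" and b: "b > 0"
  shows "((\<lambda>b. integral {t1..t2} (\<lambda>t. q t b x)) has_real_derivative deriv s b * integral {t1..t2} (\<lambda>t. flux x t b)) (at b)"
proof -
  have "((\<lambda>b. integral (cbox t1 t2) (\<lambda>t. q t b x)) has_field_derivative
      integral (cbox t1 t2) (\<lambda>t. deriv s b * flux x t b)) (at b within {0<..})"
  proof (rule leibniz_rule_field_derivative[where f="\<lambda>b t. q t b x" and fx="\<lambda>b t. deriv s b * flux x t b"])
    show "((\<lambda>b. q t b x) has_field_derivative deriv s b * flux x t b) (at b within {0<..})"
      if "b \<in> {0<..}" "t \<in> cbox t1 t2" for b t
      using that t x by (intro has_field_derivative_at_within[OF DERIV_q_space]) auto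
    show "(\<lambda>t. q t b x) integrable_on cbox t1 t2" if "b \<in> {0<..}" for b
    proof -
      have "continuous_on {t1..t2} (\<lambda>t. p t b x)" using t by (intro continuous_intros) auto
      hence "continuous_on (cbox t1 t2) (\<lambda>t. q t b x)" using that x by (simp add: p_eq)
      thus ?thesis by (rule integrable_continuous)
    qed
    have c: "continuous_on ({0<..} \<times> cbox t1 t2) (\<lambda>w. deriv s (fst w))"
      by (rule continuous_on_compose2[OF continuous_on_deriv_s]) (auto intro!: continuous_on_fst continuous_on_id)
    show "continuous_on ({0<..} \<times> cbox t1 t2) (\<lambda>(b, t). deriv s b * flux x t b)"
      unfolding split_beta using t x
      by (intro continuous_on_mult c continuous_on_flux continuous_on_fst continuous_on_snd continuous_on_id) auto
  qed (use b in auto)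
  thus ?thesis using b by (simp add: at_within_open[of b "{0<..}"])
qed

text \<open>Tonelli's theorem with total mass \<open>1\<close> at each time. In its proof
  \<open>max t1 t\<close> keeps the time argument positive on the whole line, so that the integrand
  is continuous, hence jointly measurable, on the plane.\<close>

lemma nn_integral_integral_q:
  assumes t: "0 < t1" "t1 \<le> t2" and x: "x \<ge> 0"
  shows "(\<lambda>y. integral {t1..t2} (\<lambda>t. p t y x)) \<in> borel_measurable borel"
    and "(\<integral>\<^sup>+ y. ennreal (integral {t1..t2} (\<lambda>t. p t y x)) \<partial>m) = ennreal (t2 - t1)"
proof -
  interpret m: sigma_finite_measure m by (rule sigma_finite_m)
  interpret pair_sigma_finite lborel m ..
  define f where "f y = (\<integral>\<^sup>+ t. ennreal (indicator {t1..t2} t * p (max t1 t) y x) \<partial>lborel)" for y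
  have "continuous_on UNIV (\<lambda>w::real \<times> real. p (max t1 (fst w)) (snd w) x)"
    using t by (intro continuous_intros) (auto simp: less_max_iff_disj)
  hence "(\<lambda>w::real \<times> real. p (max t1 (fst w)) (snd w) x) \<in> borel_measurable borel"
    by (rule borel_measurable_continuous_onI)
  hence [measurable]: "(\<lambda>w::real \<times> real. p (max t1 (fst w)) (snd w) x) \<in> borel_measurable (borel \<Otimes>\<^sub>M borel)"
    by (simp add: borel_prod)
  have "continuous_on UNIV (\<lambda>w::real \<times> real. p (max t1 (snd w)) (fst w) x)"
    using t by (intro continuous_intros) (auto simp: less_max_iff_disj)
  hence "(\<lambda>w::real \<times> real. p (max t1 (snd w)) (fst w) x) \<in> borel_measurable borel"
    by (rule borel_measurable_continuous_onI)
  hence [measurable]: "(\<lambda>w::real \<times> real. p (max t1 (snd w)) (fst w) x) \<in> borel_measurable (borel \<Otimes>\<^sub>M borel)"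
    by (simp add: borel_prod)
  have f_eq: "f y = ennreal (integral {t1..t2} (\<lambda>t. p t y x))" for y
  proof -
    have c: "continuous_on {t1..t2} (\<lambda>t. p t y x)" using t by (intro continuous_intros) auto
    have si: "set_integrable lborel {t1..t2} (\<lambda>t. p t y x)" by (rule borel_integrable_atLeastAtMost'[OF c])
    have "f y = (\<integral>\<^sup>+ t. ennreal (indicator {t1..t2} t * p t y x) \<partial>lborel)"
      unfolding f_def by (intro nn_integral_cong) (auto simp: indicator_def)
    also have "\<dots> = ennreal (LINT t:{t1..t2}|lborel. p t y x)"
      using si t p_nonneg unfolding set_integrable_def set_lebesgue_integral_def
      by (subst nn_integral_eq_integral) (auto simp: indicator_def)
    finally show ?thesis by (simp add: set_borel_integral_eq_integral(2)[OF si])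
  qed
  have fm: "f \<in> borel_measurable borel" unfolding f_def
    using lborel.borel_measurable_nn_integral_fst[of "\<lambda>w. ennreal (indicator {t1..t2} (snd w) * p (max t1 (snd w)) (fst w) x)" borel]
    by simp
  have nn: "0 \<le> integral {t1..t2} (\<lambda>t. p t y x)" for y
    using t p_nonneg by (intro integral_nonneg integrable_continuous_interval continuous_intros) auto
  have "(\<lambda>y. enn2real (f y)) \<in> borel_measurable borel" using fm by measurable
  thus "(\<lambda>y. integral {t1..t2} (\<lambda>t. p t y x)) \<in> borel_measurable borel" using nn by (simp add: f_eq)
  have "(\<integral>\<^sup>+ y. ennreal (integral {t1..t2} (\<lambda>t. p t y x)) \<partial>m) = (\<integral>\<^sup>+ y. f y \<partial>m)" by (simp add: f_eq)
  also have "\<dots> = (\<integral>\<^sup>+ t. (\<integral>\<^sup>+ y. ennreal (indicator {t1..t2} t * p (max t1 t) y x) \<partial>m) \<partial>lborel)"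
    unfolding f_def by (rule Fubini') (simp add: case_prod_unfold measurable_cong_sets[OF sets_pair_measure_cong[OF refl sets_m] refl])
  also have "\<dots> = (\<integral>\<^sup>+ t. indicator {t1..t2} t \<partial>lborel)"
  proof (rule nn_integral_cong)
    fix r
    show "(\<integral>\<^sup>+ y. ennreal (indicator {t1..t2} r * p (max t1 r) y x) \<partial>m) = indicator {t1..t2} r"
    proof (cases "r \<in> {t1..t2}")
      case True
      hence "r > 0" using t by auto
      with True show ?thesis using nn_integral_p[of r x] x by (simp add: p_sym[of r x] max_def)
    qed simp
  qed
  also have "\<dots> = ennreal (t2 - t1)" using t by simp
  finally show "(\<integral>\<^sup>+ y. ennreal (integral {t1..t2} (\<lambda>t. p t y x)) \<partial>m) = ennreal (t2 - t1)" .
qed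


text \<open>Monotone convergence over \<open>{y..y + n}\<close>, where the integral is an increment
  of \<open>s\<close>. The indicator shields against the unspecified values of
  \<open>deriv s\<close> outside \<open>]0, \<infinity>[\<close>.\<close>

lemma nn_integral_deriv_s_Ioi_le:
  assumes y: "0 < y" and bd: "\<And>w. y \<le> w \<Longrightarrow> s w - s y \<le> B"
  shows "(\<integral>\<^sup>+ a\<in>{y<..}. ennreal (indicator {0<..} a * deriv s a) \<partial>lborel) \<le> ennreal B"
proof -
  have [measurable]: "(\<lambda>a. indicator {0<..} a * deriv s a) \<in> borel_measurable borel"
    using borel_measurable_continuous_on_indicator[OF _ continuous_on_deriv_s] by simp
  let ?f = "\<lambda>a. ennreal (indicator {0<..} a * deriv s a)"
  define N where "N = density lborel ?f"
  have N: "emeasure N S = (\<integral>\<^sup>+ a\<in>S. ?f a \<partial>lborel)" if "S \<in> sets borel" for S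
    unfolding N_def using that by (subst emeasure_density) auto
  have "emeasure N {y<..} \<le> emeasure N (\<Union>n::nat. {y..y + real n})"
  proof (rule emeasure_mono)
    show "{y<..} \<subseteq> (\<Union>n::nat. {y..y + real n})"
    proof
      fix a assume "a \<in> {y<..}"
      obtain n :: nat where "a - y \<le> real n" using real_arch_simple by blast
      with \<open>a \<in> {y<..}\<close> show "a \<in> (\<Union>n::nat. {y..y + real n})" by (auto intro!: exI[of _ n])
    qed
  qed (auto simp: N_def)
  also have "\<dots> = (SUP n. emeasure N {y..y + real n})"
    by (rule SUP_emeasure_incseq[symmetric]) (auto simp: N_def incseq_def)
  also have "\<dots> \<le> ennreal B"
  proof (rule SUP_least)
    fix n :: nat
    have "emeasure N {y..y + real n} = (\<integral>\<^sup>+ a. ?f a * indicator {y..y + real n} a \<partial>lborel)"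
      by (rule N) simp
    also have "\<dots> = ennreal (s (y + real n) - s y)"
    proof (rule nn_integral_FTC_Icc)
      fix a assume "a \<in> {y..y + real n}"
      with y have a: "0 < a" by simp
      show "(s has_real_derivative indicator {0<..} a * deriv s a) (at a)"
        using DERIV_s[OF a] a by simp
      show "0 \<le> indicator {0<..} a * deriv s a" using scale_deriv_pos[OF a] by simp
    qed (fact, simp)
    also have "\<dots> \<le> ennreal B" using bd[of "y + real n"] by (intro ennreal_leI) simp
    finally show "emeasure N {y..y + real n} \<le> ennreal B" .
  qed
  finally show ?thesis by (simp add: N)
qed

text \<open>Tonelli's theorem on the wedge \<open>z < y < a\<close>. Feller's exit integral becomes
  a speed integral of the total scale increment above \<open>y\<close>, which can be compared with a
  function known to be \<open>m\<close>-integrable.\<close>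

lemma nn_integral_speed_scale_eq:
  assumes z: "z > 0"
  shows "(\<integral>\<^sup>+ a\<in>{z<..}. emeasure m {z<..<a} * ennreal (deriv s a) \<partial>lborel) =
    (\<integral>\<^sup>+ y. (\<integral>\<^sup>+ a\<in>{y<..}. ennreal (indicator {0<..} a * deriv s a) \<partial>lborel) * indicator {z<..} y \<partial>m)"
proof -
  interpret m: sigma_finite_measure m by (rule sigma_finite_m)
  interpret pair_sigma_finite lborel m ..
  have [measurable]: "(\<lambda>a. indicator {0<..} a * deriv s a) \<in> borel_measurable borel"
    using borel_measurable_continuous_on_indicator[OF _ continuous_on_deriv_s] by simp
  define g where "g w = (if z < snd w \<and> snd w < fst w then ennreal (indicator {0<..} (fst w) * deriv s (fst w)) else 0)"
    for w :: "real \<times> real"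
  have [measurable]: "g \<in> borel_measurable (borel \<Otimes>\<^sub>M borel)" unfolding g_def by measurable
  have "(\<integral>\<^sup>+ a\<in>{z<..}. emeasure m {z<..<a} * ennreal (deriv s a) \<partial>lborel) = (\<integral>\<^sup>+ a. (\<integral>\<^sup>+ y. g (a, y) \<partial>m) \<partial>lborel)"
  proof (rule nn_integral_cong)
    fix a
    show "emeasure m {z<..<a} * ennreal (deriv s a) * indicator {z<..} a = (\<integral>\<^sup>+ y. g (a, y) \<partial>m)"
    proof (cases "z < a")
      case True
      have "(\<integral>\<^sup>+ y. g (a, y) \<partial>m) = (\<integral>\<^sup>+ y. ennreal (deriv s a) * indicator {z<..<a} y \<partial>m)"
        using True z by (intro nn_integral_cong) (auto simp: g_def indicator_def)
      also have "\<dots> = ennreal (deriv s a) * emeasure m {z<..<a}"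
        by (rule nn_integral_cmult_indicator) (simp add: sets_m)
      finally show ?thesis using True by (simp add: mult.commute)
    next
      case False
      hence "g (a, y) = 0" for y by (auto simp: g_def)
      thus ?thesis using False by simp
    qed
  qed
  also have "\<dots> = (\<integral>\<^sup>+ y. (\<integral>\<^sup>+ a. g (a, y) \<partial>lborel) \<partial>m)"
    by (rule Fubini'[symmetric])
       (simp add: case_prod_unfold measurable_cong_sets[OF sets_pair_measure_cong[OF refl sets_m] refl])
  also have "\<dots> = (\<integral>\<^sup>+ y. (\<integral>\<^sup>+ a\<in>{y<..}. ennreal (indicator {0<..} a * deriv s a) \<partial>lborel) * indicator {z<..} y \<partial>m)"
  proof (rule nn_integral_cong)
    fix y
    show "(\<integral>\<^sup>+ a. g (a, y) \<partial>lborel) =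
      (\<integral>\<^sup>+ a\<in>{y<..}. ennreal (indicator {0<..} a * deriv s a) \<partial>lborel) * indicator {z<..} y"
      by (cases "z < y") (auto simp: g_def indicator_def intro!: nn_integral_cong)
  qed
  finally show ?thesis .
qed

text \<open>No mass flows through infinity: a positive limit of the time-integrated flux \<open>\<Phi>\<close> would contradict
  that \<open>\<infinity>\<close> is not an entrance boundary, a negative one that it is not an exit boundary, since
  \<open>Q y = integral {t1..t2} (\<lambda>t. q t y x)\<close> satisfies \<open>Q' = s' \<Phi>\<close> and has \<open>m\<close>-integral \<open>t2 - t1\<close>.\<close>

lemma integral_flux_eq_mass:
  assumes t: "0 < t1" "t1 \<le> t2" and x: "x \<ge> 0" and b: "b > 0"
  shows "integral {t1..t2} (\<lambda>t. flux x t b) = mass x t2 b - mass x t1 b"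
proof -
  define \<Phi> where "\<Phi> b = integral {t1..t2} (\<lambda>t. flux x t b)" for b
  define Q where "Q y = integral {t1..t2} (\<lambda>t. q t y x)" for y
  \<comment> \<open>Not a derivative: the version of \<open>Q\<close> built from the extended
    density, measurable on the whole line.\<close>
  define Q' where "Q' y = integral {t1..t2} (\<lambda>t. p t y x)" for y
  obtain L where L: "(\<Phi> \<longlongrightarrow> L) at_top" and eq: "\<And>b. b > 0 \<Longrightarrow> \<Phi> b = L + (mass x t2 b - mass x t1 b)"
    using integral_flux_tendsto[OF t x] unfolding \<Phi>_def by blast
  have Q'_m [measurable]: "Q' \<in> borel_measurable borel"
    and Q'_I: "(\<integral>\<^sup>+ y. ennreal (Q' y) \<partial>m) = ennreal (t2 - t1)"
    using nn_integral_integral_q[OF t x] unfolding Q'_def by auto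
  have Q_eq: "Q y = Q' y" if "y > 0" for y
    unfolding Q_def Q'_def using that x by (simp add: p_eq)
  have Q'_nn: "0 \<le> Q' y" for y unfolding Q'_def
    using t p_nonneg by (intro integral_nonneg integrable_continuous_interval continuous_intros) auto
  have DQ: "(Q has_real_derivative deriv s y * \<Phi> y) (at y)" if "y > 0" for y
    using DERIV_integral_q[OF t x that] unfolding Q_def[abs_def] \<Phi>_def .
  have not_pos: False if "L > 0"
  proof -
    have "eventually (\<lambda>y. L / 2 < \<Phi> y) at_top" using order_tendstoD(1)[OF L, of "L / 2"] that by simp
    hence "eventually (\<lambda>y. L / 2 < \<Phi> y \<and> 0 < y) at_top" using eventually_gt_at_top by (rule eventually_conj)
    then obtain z where z: "\<And>y. z \<le> y \<Longrightarrow> L / 2 < \<Phi> y \<and> 0 < y" by (auto simp: eventually_at_top_linorder)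
    have z0: "0 < z" using z by blast
    \<comment> \<open>Beyond \<open>z\<close>, \<open>Q\<close> grows at least \<open>L / 2\<close>
      times as fast as \<open>s\<close>, so integrability of \<open>Q\<close> would make
      \<open>s - s z\<close> integrable.\<close>
    have bd: "L / 2 * (s y - s z) \<le> Q' y" if "z \<le> y" for y
    proof -
      have "Q z - L / 2 * s z \<le> Q y - L / 2 * s y"
      proof (rule DERIV_nonneg_imp_nondecreasing[OF that])
        fix w assume w: "z \<le> w" "w \<le> y"
        have "((\<lambda>w. Q w - L / 2 * s w) has_real_derivative deriv s w * \<Phi> w - L / 2 * deriv s w) (at w)"
          using z[OF w(1)] by (auto intro!: derivative_eq_intros DQ DERIV_s)
        moreover have "0 \<le> deriv s w * \<Phi> w - L / 2 * deriv s w"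
          using mult_left_mono[of "L / 2" "\<Phi> w" "deriv s w"] z[OF w(1)] scale_deriv_pos[of w]
          by (simp add: mult.commute)
        ultimately show "\<exists>d. ((\<lambda>w. Q w - L / 2 * s w) has_real_derivative d) (at w) \<and> 0 \<le> d" by blast
      qed
      moreover have "Q y = Q' y" "Q z = Q' z" using z[OF that] z0 by (auto intro: Q_eq)
      ultimately show ?thesis using Q'_nn[of z] by (simp add: algebra_simps)
    qed
    have "(\<integral>\<^sup>+ a\<in>{z<..}. ennreal (s a - s z) \<partial>m) \<le> (\<integral>\<^sup>+ a. ennreal (2 / L) * ennreal (Q' a) \<partial>m)"
    proof (rule nn_integral_mono)
      fix a
      show "ennreal (s a - s z) * indicator {z<..} a \<le> ennreal (2 / L) * ennreal (Q' a)"
      proof (cases "z < a")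
        case True
        hence "s a - s z \<le> 2 / L * Q' a" using bd[of a] \<open>L > 0\<close> by (simp add: field_simps)
        thus ?thesis using True Q'_nn \<open>L > 0\<close> by (simp add: ennreal_mult[symmetric] ennreal_leI)
      qed simp
    qed
    also have "\<dots> = ennreal (2 / L) * ennreal (t2 - t1)"
      by (subst nn_integral_cmult) (auto simp: Q'_I intro: borel_measurable_mI)
    also have "\<dots> < \<infinity>" by (simp add: ennreal_mult_less_top)
    finally show False using natural_infinity z0 unfolding natural_at_infinity_def by simp
  qed
  have not_neg: False if "L < 0"
  proof -
    define k where "k = - L / 2"
    have k: "k > 0" using that by (simp add: k_def)
    have "eventually (\<lambda>y. \<Phi> y < - k) at_top" using order_tendstoD(2)[OF L, of "- k"] that by (simp add: k_def)
    hence "eventually (\<lambda>y. \<Phi> y < - k \<and> 0 < y) at_top" using eventually_gt_at_top by (rule eventually_conj)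
    then obtain z where z: "\<And>y. z \<le> y \<Longrightarrow> \<Phi> y < - k \<and> 0 < y" by (auto simp: eventually_at_top_linorder)
    have z0: "0 < z" using z by blast
    \<comment> \<open>\<open>Q + k * s\<close> is nonincreasing while \<open>Q\<close> stays
      nonnegative, so above \<open>y\<close> the scale can grow by at most \<open>Q y / k\<close>,
      an \<open>m\<close>-integrable bound.\<close>
    have bd: "s w - s y \<le> Q' y / k" if "z \<le> y" "y \<le> w" for y w
    proof -
      have "Q w + k * s w \<le> Q y + k * s y"
      proof (rule DERIV_nonpos_imp_nonincreasing[OF that(2)])
        fix v assume v: "y \<le> v" "v \<le> w"
        hence zv: "\<Phi> v < - k" "0 < v" using z[of v] that by auto
        have "((\<lambda>w. Q w + k * s w) has_real_derivative deriv s v * \<Phi> v + k * deriv s v) (at v)"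
          using zv by (auto intro!: derivative_eq_intros DQ DERIV_s)
        moreover have "deriv s v * \<Phi> v + k * deriv s v \<le> 0"
          using mult_left_mono[of "\<Phi> v" "- k" "deriv s v"] zv scale_deriv_pos[of v]
          by (simp add: mult.commute)
        ultimately show "\<exists>d. ((\<lambda>w. Q w + k * s w) has_real_derivative d) (at v) \<and> d \<le> 0" by blast
      qed
      moreover have "Q y = Q' y" "Q w = Q' w" using z[of y] z[of w] that by (auto intro: Q_eq)
      ultimately have "k * (s w - s y) \<le> Q' y" using Q'_nn[of w] by (simp add: algebra_simps)
      thus ?thesis using k by (simp add: field_simps)
    qed
    have "(\<integral>\<^sup>+ a\<in>{z<..}. emeasure m {z<..<a} * ennreal (deriv s a) \<partial>lborel) \<le> (\<integral>\<^sup>+ y. ennreal (1 / k) * ennreal (Q' y) \<partial>m)"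
      unfolding nn_integral_speed_scale_eq[OF z0]
    proof (rule nn_integral_mono)
      fix y
      show "(\<integral>\<^sup>+ a\<in>{y<..}. ennreal (indicator {0<..} a * deriv s a) \<partial>lborel) * indicator {z<..} y \<le> ennreal (1 / k) * ennreal (Q' y)"
      proof (cases "z < y")
        case True
        have "(\<integral>\<^sup>+ a\<in>{y<..}. ennreal (indicator {0<..} a * deriv s a) \<partial>lborel) \<le> ennreal (Q' y / k)"
          by (rule nn_integral_deriv_s_Ioi_le) (use True z0 bd in auto)
        also have "\<dots> = ennreal (1 / k) * ennreal (Q' y)" using k Q'_nn by (simp add: ennreal_mult[symmetric])
        finally show ?thesis using True by simp
      qed simp
    qed
    also have "\<dots> = ennreal (1 / k) * ennreal (t2 - t1)"
      by (subst nn_integral_cmult) (auto simp: Q'_I intro: borel_measurable_mI)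
    also have "\<dots> < \<infinity>" by (simp add: ennreal_mult_less_top)
    finally show False using natural_infinity z0 unfolding natural_at_infinity_def by simp
  qed
  have "L = 0" using not_pos not_neg by (meson linorder_neqE_linordered_idom)
  thus ?thesis using eq[OF b] by (simp add: \<Phi>_def)
qed

text \<open>By continuity the density started at \<open>0\<close> exceeds a positive constant near
  \<open>0\<close>, and its total mass \<open>1\<close> then bounds the speed measure there. Away
  from \<open>0\<close> the measure is locally finite.\<close>

lemma emeasure_m_finite_near_0:
  assumes t: "t > 0" and pos: "q t 0 0 > 0"
  shows "emeasure m {0<..b} < \<infinity>"
proof -
  define c where "c = p t 0 0 / 2"
  have c: "c > 0" "c < p t 0 0" using pos by (auto simp: c_def p_def)
  have "((\<lambda>y. p t 0 y) \<longlongrightarrow> p t 0 0) (at_right 0)"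
    using t by (intro tendsto_p tendsto_intros) auto
  from order_tendstoD(1)[OF this c(2)] obtain e where e: "e > 0" "\<And>y. 0 < y \<Longrightarrow> y < e \<Longrightarrow> c < p t 0 y"
    unfolding eventually_at_right_field by auto
  have [measurable]: "p t 0 \<in> borel_measurable m" using t by (intro borel_measurable_mI measurable_p) auto
  have "ennreal c * emeasure m {0<..e/2} = (\<integral>\<^sup>+ y. ennreal c * indicator {0<..e/2} y \<partial>m)"
    by (rule nn_integral_cmult_indicator[symmetric]) (simp add: sets_m)
  also have "\<dots> \<le> (\<integral>\<^sup>+ y. ennreal (p t 0 y) \<partial>m)"
    using e by (intro nn_integral_mono) (auto simp: indicator_def intro!: ennreal_leI less_imp_le[OF e(2)])
  also have "\<dots> = 1" by (rule nn_integral_p) (use t in auto)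
  finally have "ennreal c * emeasure m {0<..e/2} < \<infinity>" by (rule le_less_trans) simp
  hence 1: "emeasure m {0<..e/2} < \<infinity>" using c by (auto simp: ennreal_mult_less_top)
  have "emeasure m {0<..b} \<le> emeasure m ({0<..e/2} \<union> {e/2<..b})"
    by (intro emeasure_mono) (auto simp: sets_m)
  also have "\<dots> \<le> emeasure m {0<..e/2} + emeasure m {e/2<..b}"
    by (intro emeasure_subadditive) (auto simp: sets_m)
  also have "\<dots> < \<infinity>" using 1 emeasure_m_Ioc_finite[of "e/2" b] e by simp
  finally show ?thesis .
qed

text \<open>\<open>mass x t b\<close> is differentiated in time in two ways: under the integral
  sign, which needs finite measure down to \<open>0\<close>, and through the time-integrated flux.
  The absence of a second boundary term says that nothing flows through \<open>0\<close>.\<close>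

lemma flux_eq_integral:
  assumes fin: "emeasure m {0<..b} < \<infinity>" and t: "t > 0" and x: "x \<ge> 0" and b: "b > 0"
  shows "flux x t b = (LINT y:{0<..b}|m. pt t y x)"
proof -
  have 1: "((\<lambda>t. mass x t b) has_real_derivative (LINT y:{0<..b}|m. pt t y x)) (at t)"
    unfolding mass_def by (rule DERIV_integral_p(1)) (use t x fin in auto)
  have "((\<lambda>u. integral {t/2..u} (\<lambda>t. flux x t b)) has_real_derivative flux x t b) (at t within {t/2..2*t})"
    by (rule integral_has_real_derivative) (use t x b in \<open>auto intro: continuous_on_flux_time\<close>)
  hence "((\<lambda>u. integral {t/2..u} (\<lambda>t. flux x t b)) has_real_derivative flux x t b) (at t)"
    using t by (simp add: at_within_interior[of t "{t/2..2*t}"])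
  hence "((\<lambda>u. integral {t/2..u} (\<lambda>t. flux x t b) + mass x (t/2) b) has_real_derivative flux x t b + 0) (at t)"
    by (intro DERIV_add DERIV_const)
  hence "((\<lambda>u. integral {t/2..u} (\<lambda>t. flux x t b) + mass x (t/2) b) has_real_derivative flux x t b) (at t)"
    by simp
  hence "((\<lambda>t. mass x t b) has_real_derivative flux x t b) (at t)"
    by (rule has_field_derivative_transform_within_open[where S="{t/2<..}"])
       (use t x b integral_flux_eq_mass[of "t/2" _ x b] in auto)
  from DERIV_unique[OF this 1] show ?thesis .
qed

text \<open>The flux at \<open>b\<close> is an integral over \<open>]0, b]\<close>, and these sets
  shrink to the empty set.\<close>

lemma flux_tendsto_0:
  assumes fin: "\<And>b. emeasure m {0<..b} < \<infinity>" and t: "t > 0" and x: "x \<ge> 0"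
  shows "(flux x t \<longlongrightarrow> 0) (at_right 0)"
proof (rule tendsto_at_right_sequentially[of 0 1])
  fix S :: "nat \<Rightarrow> real" assume S: "\<And>n. 0 < S n" "\<And>n. S n < 1" "S \<longlonglongrightarrow> 0"
  have i: "integrable m (\<lambda>y. indicator {0<..b} y * pt t y x)" for b
    using DERIV_integral_p(2)[OF t x _ fin, of b] by (simp add: set_integrable_def)
  have "(\<lambda>n. LINT y|m. indicator {0<..S n} y * pt t y x) \<longlonglongrightarrow> (LINT y|m. 0)"
  proof (rule integral_dominated_convergence[where w="\<lambda>y. norm (indicator {0<..1} y * pt t y x)"])
    show "integrable m (\<lambda>y. norm (indicator {0<..1} y * pt t y x))" using i by (rule integrable_norm)
    show "(\<lambda>y. indicator {0<..S n} y * pt t y x) \<in> borel_measurable m" for n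
      using i by (rule borel_measurable_integrable)
    show "AE y in m. (\<lambda>n. indicator {0<..S n} y * pt t y x) \<longlonglongrightarrow> 0"
    proof (rule AE_I2)
      fix y
      show "(\<lambda>n. indicator {0<..S n} y * pt t y x) \<longlonglongrightarrow> 0"
      proof (cases "0 < y")
        case True
        have "eventually (\<lambda>n. S n < y) sequentially" using order_tendstoD(2)[OF S(3) True] .
        hence "eventually (\<lambda>n. indicator {0<..S n} y * pt t y x = 0) sequentially"
          by eventually_elim auto
        thus ?thesis by (rule tendsto_eventually)
      qed simp
    qed
    show "AE y in m. norm (indicator {0<..S n} y * pt t y x) \<le> norm (indicator {0<..1} y * pt t y x)" for n
      using S(2)[of n] by (intro AE_I2) (auto simp: indicator_def)
  qed simp
  thus "(\<lambda>n. flux x t (S n)) \<longlonglongrightarrow> 0"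
    using flux_eq_integral[OF fin t x S(1)] by (simp add: set_lebesgue_integral_def)
qed simp

end

section \<open>The excess over the level\<close>

text \<open>\<open>f_pos\<close> stems from \<open>\<zeta>\<close> being the infimum of the zeros of
  \<open>f\<close>, and \<open>q_pos\<close> from the bound on \<open>c\<close>.
  \<open>boundary\<close> determines \<open>f\<close> before \<open>\<zeta>\<close> only, so the
  value \<open>f \<zeta>\<close> has to be handled apart.\<close>

locale density_level_curve = linear_diffusion_density M P X s \<rho> q
  for M :: "'w measure" and P :: "real \<Rightarrow> 'w measure" and X :: "real \<Rightarrow> 'w \<Rightarrow> real"
    and s \<rho> :: "real \<Rightarrow> real" and q :: "real \<Rightarrow> real \<Rightarrow> real \<Rightarrow> real" +
  fixes \<zeta> c x :: real and f :: "real \<Rightarrow> real"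
  assumes x: "x \<ge> 0" and \<zeta>: "\<zeta> > 0" and c: "c > 0"
    and q_pos: "q \<zeta> 0 0 > 0"
    and boundary: "boundary_defined_by q \<zeta> c f"
    and f_pos: "\<And>t. 0 \<le> t \<Longrightarrow> t < \<zeta> \<Longrightarrow> f t > 0"
begin

lemma fin_m: "emeasure m {0<..b} < \<infinity>"
  by (rule emeasure_m_finite_near_0[OF \<zeta> q_pos])

text \<open>The density is only weakly decreasing in \<open>y\<close>, but uniqueness of the
  solution makes the comparison with \<open>c\<close> strict on both sides of the curve.\<close>

lemma
  assumes t: "0 \<le> t" "t < \<zeta>"
  shows level_eq: "p (\<zeta> - t) (f t) 0 = c"
    and level_gt: "0 \<le> y \<Longrightarrow> y < f t \<Longrightarrow> c < p (\<zeta> - t) y 0"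
    and level_lt: "f t < y \<Longrightarrow> p (\<zeta> - t) y 0 < c"
proof -
  have b: "0 \<le> y \<Longrightarrow> q (\<zeta> - t) y 0 = c \<longleftrightarrow> y = f t" for y
    using boundary t unfolding boundary_defined_by_def by auto
  have anti: "0 \<le> a \<Longrightarrow> a \<le> b \<Longrightarrow> q (\<zeta> - t) b 0 \<le> q (\<zeta> - t) a 0" for a b
    using density_decreasing[of "\<zeta> - t"] t by (auto simp: monotone_on_def)
  have f0: "0 < f t" by (rule f_pos[OF t])
  show "p (\<zeta> - t) (f t) 0 = c" using b[of "f t"] f0 by (simp add: p_eq)
  show "c < p (\<zeta> - t) y 0" if "0 \<le> y" "y < f t"
    using b[of y] b[of "f t"] anti[of y "f t"] that f0 by (simp add: p_eq)
  show "p (\<zeta> - t) y 0 < c" if "f t < y"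
    using b[of y] b[of "f t"] anti[of "f t" y] that f0 by (simp add: p_eq)
qed

lemma level_eq_iff: "0 \<le> t \<Longrightarrow> t < \<zeta> \<Longrightarrow> 0 \<le> y \<Longrightarrow> p (\<zeta> - t) y 0 = c \<longleftrightarrow> y = f t"
  using level_gt[of t y] level_lt[of t y] level_eq[of t] by (metis linorder_neqE_linordered_idom less_irrefl)

text \<open>For \<open>a \<ge> 0\<close>, comparing \<open>f r\<close> with \<open>a\<close> amounts
  to comparing \<open>p (\<zeta> - r) a 0\<close> with \<open>c\<close>, and a strict inequality
  there persists for nearby \<open>r\<close>.\<close>

lemma isCont_f: 
  assumes t: "0 < t" "t < \<zeta>"
  shows "isCont f t"
  unfolding isCont_def
proof (rule order_tendstoI)
  have ev: "eventually (\<lambda>r. r \<in> {0<..<\<zeta>}) (at t)"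
    using t by (intro eventually_at_in_open') auto
  have lim: "((\<lambda>r. p (\<zeta> - r) a 0) \<longlongrightarrow> p (\<zeta> - t) a 0) (at t)" for a
  proof -
    have "continuous_on {0<..<\<zeta>} (\<lambda>r. p (\<zeta> - r) a 0)" by (intro continuous_intros) auto
    hence "isCont (\<lambda>r. p (\<zeta> - r) a 0) t" using t by (simp add: continuous_on_eq_continuous_at)
    thus ?thesis by (simp add: isCont_def)
  qed
  show "eventually (\<lambda>r. a < f r) (at t)" if a: "a < f t" for a
  proof (cases "0 \<le> a")
    case True
    have "c < p (\<zeta> - t) a 0" using level_gt[of t a] t True a by simp
    from order_tendstoD(1)[OF lim this] ev show ?thesis
    proof eventually_elim
      case (elim r)
      hence "\<not> f r < a" "f r \<noteq> a" using level_lt[of r a] level_eq[of r] by auto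
      thus ?case by simp
    qed
  next
    case False
    show ?thesis using ev
    proof eventually_elim
      case (elim r)
      with f_pos[of r] False show ?case by simp
    qed
  qed
  show "eventually (\<lambda>r. f r < a) (at t)" if a: "f t < a" for a
  proof -
    have a0: "0 \<le> a" using f_pos[of t] t a by simp
    have "p (\<zeta> - t) a 0 < c" using level_lt[of t a] t a by simp
    from order_tendstoD(2)[OF lim this] ev show ?thesis
    proof eventually_elim
      case (elim r)
      hence "\<not> a < f r" "f r \<noteq> a" using level_gt[of r a] level_eq[of r] a0 by auto
      thus ?case by simp
    qed
  qed
qed

text \<open>The Wronskian, with respect to scale, of \<open>p (\<zeta> - t) y 0 - c\<close> and
  \<open>p t y x\<close> at \<open>y = R\<close>: the boundary term in Green's formula. The constant
  \<open>c\<close> has no flux of its own.\<close>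

definition excess_rate :: "real \<Rightarrow> real \<Rightarrow> real" where
  "excess_rate t R = (p (\<zeta> - t) R 0 - c) * flux x t R - p t R x * flux 0 (\<zeta> - t) R"

text \<open>Without the positive part, and with \<open>R\<close> independent of \<open>t\<close>,
  the integral can be differentiated in \<open>t\<close>. For \<open>R = f t\<close> the positive
  part makes no difference.\<close>

definition excess_upto :: "real \<Rightarrow> real \<Rightarrow> real" where
  "excess_upto t R = (LINT y:{0<..R}|m. (p (\<zeta> - t) y 0 - c) * p t y x)"

definition excess :: "real \<Rightarrow> real" where
  "excess t = (LINT y|m. max 0 (p (\<zeta> - t) y 0 - c) * p t y x)"

lemma isCont_excess_rate:
  assumes "0 < t" "t < \<zeta>" "0 < R"
  shows "isCont (\<lambda>w. excess_rate (fst w) (snd w)) (t, R)"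
proof -
  have "continuous_on ({0<..<\<zeta>} \<times> {0<..}) (\<lambda>w. excess_rate (fst w) (snd w))"
    unfolding excess_rate_def using x by (intro continuous_intros) auto
  moreover have "open ({0<..<\<zeta>} \<times> {0::real<..})" by (intro open_Times) auto
  ultimately show ?thesis using assms by (simp add: continuous_on_eq_continuous_at)
qed

lemma DERIV_p_space:
  assumes "t > 0" "y > 0" "z \<ge> 0"
  shows "((\<lambda>y. p t y z) has_real_derivative deriv s y * flux z t y) (at y)"
  using DERIV_q_space[OF assms]
  by (rule has_field_derivative_transform_within_open[where S="{0<..}"]) (use assms in \<open>auto simp: p_eq\<close>)

text \<open>The two cross terms, each the product of both fluxes and \<open>deriv s\<close>, cancel.
  What is left is \<open>\<rho>\<close> times the time derivative of the integrand of
  \<open>excess_upto\<close>; the minus sign comes from the reversed time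
  \<open>\<zeta> - t\<close>.\<close>

lemma DERIV_excess_rate:
  assumes t: "0 < t" "t < \<zeta>" and y: "0 < y"
  shows "(excess_rate t has_real_derivative
    \<rho> y * (- pt (\<zeta> - t) y 0 * p t y x + (p (\<zeta> - t) y 0 - c) * pt t y x)) (at y)"
proof -
  have t': "0 < \<zeta> - t" using t by simp
  show ?thesis unfolding excess_rate_def
    by (rule derivative_eq_intros DERIV_p_space DERIV_flux t t' y x order_refl refl)+
       (simp add: algebra_simps)
qed

lemma excess_rate_tendsto_0:
  assumes t: "0 < t" "t < \<zeta>"
  shows "(excess_rate t \<longlongrightarrow> 0) (at_right 0)"
proof -
  have "((\<lambda>R. (p (\<zeta> - t) R 0 - c) * flux x t R - p t R x * flux 0 (\<zeta> - t) R) \<longlongrightarrow>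
      (p (\<zeta> - t) 0 0 - c) * 0 - p t 0 x * 0) (at_right 0)"
    using t x by (intro tendsto_intros tendsto_p flux_tendsto_0 fin_m) auto
  thus ?thesis by (simp add: excess_rate_def[abs_def])
qed

lemma integrable_level_diff:
  assumes t: "0 < t" "t < \<zeta>"
  shows "integrable m (\<lambda>y. (p (\<zeta> - t) y 0 - c) * p t y x)"
proof -
  have "integrable m (\<lambda>y. p t x y * p (\<zeta> - t) y 0 - c * p t y x)"
    using t x by (intro Bochner_Integration.integrable_diff integrable_mult_right integrable_p integrable_p_mult) auto
  thus ?thesis using t by (simp add: p_sym[of t x] algebra_simps)
qed

lemma DERIV_excess_upto:
  assumes t: "0 < t" "t < \<zeta>" and R: "0 < R"
  shows "((\<lambda>t. excess_upto t R) has_real_derivative excess_rate t R) (at t)"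
proof -
  \<comment> \<open>Half the distance to the nearer end keeps the window \<open>{t-e..t+e}\<close>
    inside \<open>]0, \<zeta>[\<close>.\<close>
  define e where "e = min t (\<zeta> - t) / 2"
  have e: "e > 0" "\<And>r. r \<in> {t-e..t+e} \<Longrightarrow> 0 < r \<and> r < \<zeta>"
    using t by (auto simp: e_def min_def field_simps split: if_splits)
  let ?vt = "\<lambda>t y. - pt (\<zeta> - t) y 0 * p t y x + (p (\<zeta> - t) y 0 - c) * pt t y x"
  have meas: "?vt t \<in> borel_measurable borel"
    using t by (intro borel_measurable_add borel_measurable_times borel_measurable_uminus borel_measurable_diff
      measurable_p measurable_pt) auto
  have d: "((\<lambda>r. (p (\<zeta> - r) y 0 - c) * p r y x) has_real_derivative ?vt r y) (at r)"
    if "r \<in> {t-e..t+e}" for r y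
  proof -
    have r: "0 < r" "0 < \<zeta> - r" using e(2)[OF that] by auto
    have "((\<lambda>r. \<zeta> - r) has_real_derivative - 1) (at r)" by (auto intro!: derivative_eq_intros)
    from DERIV_chain2[OF DERIV_p_time[OF r(2)] this, of y 0]
    have "((\<lambda>r. p (\<zeta> - r) y 0) has_real_derivative - pt (\<zeta> - r) y 0) (at r)" by simp
    from DERIV_mult[OF DERIV_diff[OF this DERIV_const[of c]] DERIV_p_time[OF r(1), of y x]]
    show ?thesis by (simp add: algebra_simps)
  qed
  have cont: "continuous_on ({t-e..t+e} \<times> {0..R}) (\<lambda>(r, y). ?vt r y)"
    unfolding split_beta using e(2) by (intro continuous_intros) (auto simp: less_diff_eq)
  have int: "set_integrable m {0<..R} (\<lambda>y. (p (\<zeta> - r) y 0 - c) * p r y x)" if "r \<in> {t-e..t+e}" for r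
    unfolding set_integrable_def using e(2)[OF that]
    by (intro integrable_mult_indicator integrable_level_diff) (auto simp: sets_m)
  note * = has_real_derivative_set_integral[where \<mu>=m and S="{0<..R}" and a=0 and b=R and e=e and t=t
      and vt="?vt" and v="\<lambda>r y. (p (\<zeta> - r) y 0 - c) * p r y x",
      OF sets_m _ _ fin_m e(1) meas cont d int]
  \<comment> \<open>The value of \<open>excess_rate\<close> at \<open>0\<close> is replaced by its
    limit \<open>0\<close> from the right, giving a primitive continuous on \<open>{0..R}\<close>
    whose lower boundary term is zero.\<close>
  have "(LINT y:{0<..R}|m. ?vt t y) = (\<lambda>y. if y = 0 then 0 else excess_rate t y) R - (\<lambda>y. if y = 0 then 0 else excess_rate t y) 0"
  proof (rule set_integral_m_eq_diff)
    have D: "((\<lambda>y. if y = 0 then 0 else excess_rate t y) has_real_derivative \<rho> y * ?vt t y) (at y)" if "0 < y" for y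
      using DERIV_excess_rate[OF t that]
      by (rule has_field_derivative_transform_within_open[where S="{0<..}"]) (use that in auto)
    show "((\<lambda>y. if y = 0 then 0 else excess_rate t y) has_real_derivative \<rho> y * ?vt t y) (at y)" if "0 < y" "y < R" for y
      using D that by simp
    have "((\<lambda>y. if y = 0 then 0 else excess_rate t y) \<longlongrightarrow> 0) (at_right 0)"
      using excess_rate_tendsto_0[OF t] by (rule Lim_transform_eventually) (simp add: eventually_at_filter)
    moreover have "isCont (\<lambda>y. if y = 0 then 0 else excess_rate t y) y" if "0 < y" for y
      using D[OF that] by (rule DERIV_isCont)
    ultimately show "continuous_on {0..R} (\<lambda>y. if y = 0 then 0 else excess_rate t y)"
      using R by (intro continuous_on_IccI) (auto simp: isCont_def intro: tendsto_mono[OF at_le] filterlim_at_split[THEN iffD1, THEN conjunct1])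
    show "set_integrable m {0<..R} (?vt t)" by (rule *(2)) auto
  qed (use R meas in auto)
  also have "\<dots> = excess_rate t R" using R by simp
  finally have "(LINT y:{0<..R}|m. ?vt t y) = excess_rate t R" .
  moreover have "((\<lambda>r. LINT y:{0<..R}|m. (p (\<zeta> - r) y 0 - c) * p r y x) has_real_derivative (LINT y:{0<..R}|m. ?vt t y)) (at t)"
    by (rule *(1)) auto
  ultimately show ?thesis by (simp add: excess_upto_def)
qed

lemma integrable_level_pos:
  assumes t: "0 < t" "t < \<zeta>"
  shows "integrable m (\<lambda>y. max 0 (p (\<zeta> - t) y 0 - c) * p t y x)"
proof (rule Bochner_Integration.integrable_bound[OF integrable_level_diff[OF t]])
  show "(\<lambda>y. max 0 (p (\<zeta> - t) y 0 - c) * p t y x) \<in> borel_measurable m"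
    using t by (intro borel_measurable_mI borel_measurable_times borel_measurable_max borel_measurable_diff measurable_p) auto
qed (use p_nonneg[OF t(1)] in \<open>auto simp: abs_mult intro!: mult_right_mono\<close>)

lemma excess_eq_excess_upto:
  assumes t: "0 < t" "t < \<zeta>"
  shows "excess t = excess_upto t (f t)"
  unfolding excess_def excess_upto_def set_lebesgue_integral_def
proof (rule integral_cong_AE)
  show "AE y in m. max 0 (p (\<zeta> - t) y 0 - c) * p t y x = indicator {0<..f t} y *\<^sub>R ((p (\<zeta> - t) y 0 - c) * p t y x)"
    using AE_m_pos
  proof eventually_elim
    case (elim y)
    then show ?case using level_gt[of t y] level_lt[of t y] level_eq[of t] t
      by (cases y "f t" rule: linorder_cases) (auto simp: indicator_def)
  qed
qed (use integrable_level_pos[OF t] integrable_level_diff[OF t] in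
      \<open>auto intro!: borel_measurable_integrable integrable_mult_indicator[where 'b=real, simplified] simp: sets_m\<close>)

lemma excess_upto_le_excess:
  assumes t: "0 < t" "t < \<zeta>"
  shows "excess_upto t R \<le> excess t"
  unfolding excess_def excess_upto_def set_lebesgue_integral_def
proof (rule integral_mono)
  show "integrable m (\<lambda>y. indicator {0<..R} y *\<^sub>R ((p (\<zeta> - t) y 0 - c) * p t y x))"
    by (intro integrable_mult_indicator integrable_level_diff t) (simp add: sets_m)
  show "indicator {0<..R} y *\<^sub>R ((p (\<zeta> - t) y 0 - c) * p t y x) \<le> max 0 (p (\<zeta> - t) y 0 - c) * p t y x" for y
    using p_nonneg[OF t(1), of y x] by (auto simp: indicator_def intro!: mult_right_mono)
qed (rule integrable_level_pos[OF t])

text \<open>Envelope argument: \<open>excess t\<close> is the maximum of \<open>excess_upto t\<close>, attained at \<open>f t\<close>, so \<open>f\<close> need not be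
  differentiable.\<close>

lemma DERIV_excess:
  assumes t: "0 < t" "t < \<zeta>"
  shows "(excess has_real_derivative excess_rate t (f t)) (at t)"
  unfolding has_field_derivative_iff
proof (rule tendstoI)
  fix \<epsilon> :: real assume \<epsilon>: "\<epsilon> > 0"
  have f0: "f t > 0" using f_pos t by simp
  have "(\<lambda>w. excess_rate (fst w) (snd w)) \<midarrow>(t, f t)\<rightarrow> excess_rate t (f t)"
    using isCont_excess_rate[OF t f0] by (simp add: isCont_def)
  from tendstoD[OF this \<epsilon>] obtain d where d: "d > 0"
    "\<And>w. w \<noteq> (t, f t) \<Longrightarrow> dist w (t, f t) < d \<Longrightarrow> dist (excess_rate (fst w) (snd w)) (excess_rate t (f t)) < \<epsilon>"
    unfolding eventually_at by auto
  have G: "\<bar>excess_rate r R - excess_rate t (f t)\<bar> < \<epsilon>" if "\<bar>r - t\<bar> < d / 2" "\<bar>R - f t\<bar> < d / 2" for r R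
  proof (cases "(r, R) = (t, f t)")
    case False
    have "dist (r, R) (t, f t) \<le> \<bar>r - t\<bar> + \<bar>R - f t\<bar>"
      unfolding dist_prod_def fst_conv snd_conv dist_real_def
      using sqrt_sum_squares_le_sum_abs[of "\<bar>r - t\<bar>" "\<bar>R - f t\<bar>"] by simp
    also have "\<dots> < d" using that by simp
    finally show ?thesis using d(2)[OF False] by (simp add: dist_real_def)
  qed (use \<epsilon> in auto)
  have "eventually (\<lambda>r. dist (f r) (f t) < d / 2) (at t)"
    using isCont_f[OF t] d(1) unfolding isCont_def by (intro tendstoD) auto
  moreover have "eventually (\<lambda>r. dist r t < d / 2) (at t)"
    using d(1) by (intro tendstoD[OF tendsto_ident_at]) auto
  moreover have "eventually (\<lambda>r. r \<in> {0<..<\<zeta>}) (at t)"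
    using t by (intro eventually_at_in_open') auto
  moreover have "eventually (\<lambda>r. r \<noteq> t) (at t)" by (simp add: eventually_at_filter)
  ultimately show "eventually (\<lambda>r. dist ((excess r - excess t) / (r - t)) (excess_rate t (f t)) < \<epsilon>) (at t)"
  proof eventually_elim
    case (elim r)
    hence r: "0 < r" "r < \<zeta>" by auto
    \<comment> \<open>The mean value theorem in time with the end point \<open>R\<close> frozen, in
      a form that covers \<open>r\<close> on either side of \<open>t\<close>.\<close>
    have mvt: "\<exists>\<xi>. \<bar>\<xi> - t\<bar> < d / 2 \<and> excess_upto r R - excess_upto t R = (r - t) * excess_rate \<xi> R" if R0: "R > 0" for R
    proof (cases "t < r")
      case True
      obtain \<xi> where "t < \<xi>" "\<xi> < r" "excess_upto r R - excess_upto t R = (r - t) * excess_rate \<xi> R"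
        using MVT2[OF True, of "\<lambda>t. excess_upto t R" "\<lambda>t. excess_rate t R"] DERIV_excess_upto[OF _ _ R0] t r by force
      thus ?thesis using elim by (intro exI[of _ \<xi>]) (auto simp: dist_real_def)
    next
      case False
      hence "r < t" using elim by simp
      then obtain \<xi> where "r < \<xi>" "\<xi> < t" "excess_upto t R - excess_upto r R = (t - r) * excess_rate \<xi> R"
        using MVT2[of r t "\<lambda>t. excess_upto t R" "\<lambda>t. excess_rate t R"] DERIV_excess_upto[OF _ _ R0] t r by force
      thus ?thesis using elim by (intro exI[of _ \<xi>]) (auto simp: dist_real_def algebra_simps)
    qed
    obtain \<xi> where xi: "\<bar>\<xi> - t\<bar> < d / 2" "excess_upto r (f t) - excess_upto t (f t) = (r - t) * excess_rate \<xi> (f t)" using mvt[OF f0] by blast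
    obtain \<eta> where eta: "\<bar>\<eta> - t\<bar> < d / 2" "excess_upto r (f r) - excess_upto t (f r) = (r - t) * excess_rate \<eta> (f r)"
      using mvt[of "f r"] f_pos[of r] r by auto
    have g1: "\<bar>excess_rate \<xi> (f t) - excess_rate t (f t)\<bar> < \<epsilon>" using G[OF xi(1), of "f t"] d(1) by simp
    have g2: "\<bar>excess_rate \<eta> (f r) - excess_rate t (f t)\<bar> < \<epsilon>" using G[OF eta(1), of "f r"] elim by (simp add: dist_real_def)
    \<comment> \<open>An end point frozen at \<open>f t\<close> is exact at time \<open>t\<close>
      and underestimates at time \<open>r\<close>; frozen at \<open>f r\<close> it is the other way
      round. By continuity of \<open>f\<close> both bounds have the same rate in the limit.\<close>
    have lo: "(r - t) * excess_rate \<xi> (f t) \<le> excess r - excess t"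
      using excess_upto_le_excess[OF r, of "f t"] excess_eq_excess_upto[OF t] xi(2) by simp
    have hi: "excess r - excess t \<le> (r - t) * excess_rate \<eta> (f r)"
      using excess_upto_le_excess[OF t, of "f r"] excess_eq_excess_upto[OF r] eta(2) by simp
    show ?case
    proof (cases "t < r")
      case True
      hence "excess_rate \<xi> (f t) \<le> (excess r - excess t) / (r - t)" "(excess r - excess t) / (r - t) \<le> excess_rate \<eta> (f r)"
        using lo hi by (simp_all add: le_divide_eq divide_le_eq mult.commute)
      thus ?thesis using g1 g2 by (simp add: dist_real_def abs_less_iff)
    next
      case False
      hence "r < t" using elim by simp
      hence "(excess r - excess t) / (r - t) \<le> excess_rate \<xi> (f t)" "excess_rate \<eta> (f r) \<le> (excess r - excess t) / (r - t)"
        using lo hi by (simp_all add: le_divide_eq divide_le_eq mult.commute)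
      thus ?thesis using g1 g2 by (simp add: dist_real_def abs_less_iff)
    qed
  qed
qed

end

section \<open>Last passage time\<close>

context linear_diffusion_density begin

lemma AE_X:
  assumes t: "t > 0" and x: "x \<ge> 0" and Q: "AE y in m. Q y" and [measurable]: "Measurable.pred borel Q"
  shows "AE \<omega> in P x. Q (X t \<omega>)"
proof -
  have [measurable]: "p t x \<in> borel_measurable m" using t by (intro borel_measurable_mI measurable_p) auto
  have [measurable]: "X t \<in> borel_measurable (P x)" using measurable_X_P t x by simp
  have "AE y in distr (P x) borel (X t). Q y"
    unfolding distr_X[OF t x] using Q by (subst AE_density) auto
  thus ?thesis by (subst (asm) AE_distr_iff) auto
qed

lemma AE_X_pos: "t > 0 \<Longrightarrow> x \<ge> 0 \<Longrightarrow> AE \<omega> in P x. 0 < X t \<omega>"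
  by (rule AE_X[OF _ _ AE_m_pos]) auto

lemma AE_X_neq: 
  assumes "t > 0" "x \<ge> 0"
  shows "AE \<omega> in P x. X t \<omega> \<noteq> r"
proof (rule AE_X[OF assms])
  show "AE y in m. y \<noteq> r" unfolding AE_m_iff using AE_lborel_singleton[of r] by eventually_elim simp
qed auto

lemma continuous_on_path_p:
  assumes "\<omega> \<in> space M" "S \<subseteq> {0..<\<zeta>}"
  shows "continuous_on S (\<lambda>u. p (\<zeta> - u) (X u \<omega>) 0)"
proof -
  have "continuous_on S (\<lambda>u. X u \<omega>)"
    using continuous_paths[OF assms(1)] by (rule continuous_on_subset) (use assms(2) in auto)
  thus ?thesis by (intro continuous_on_p) (use assms(2) in \<open>auto intro!: continuous_intros\<close>)
qed

end

context density_level_curve begin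

text \<open>The conditional density of \<open>X \<zeta>\<close> at \<open>0\<close> given the path
  up to time \<open>u\<close>, which is why it should be a martingale.\<close>

definition level_value :: "real \<Rightarrow> 'w \<Rightarrow> real" where
  "level_value u \<omega> = p (\<zeta> - u) (X u \<omega>) 0"

lemma level_value_nonneg: "u < \<zeta> \<Longrightarrow> 0 \<le> level_value u \<omega>"
  unfolding level_value_def by (rule p_nonneg) simp

lemma integrable_level_value:
  assumes "0 < u" "u < \<zeta>"
  shows "integrable (P x) (level_value u)" and "(LINT \<omega>|P x. level_value u \<omega>) = p \<zeta> x 0"
proof -
  have [measurable]: "(\<lambda>y. p (\<zeta> - u) y 0) \<in> borel_measurable borel" using assms by (intro measurable_p) auto
  show "integrable (P x) (level_value u)"
    unfolding level_value_def using integrable_p_mult(1)[of u "\<zeta> - u" x 0] assms x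
    by (subst integral_X(2)[of u x "\<lambda>y. p (\<zeta> - u) y 0"]) auto
  show "(LINT \<omega>|P x. level_value u \<omega>) = p \<zeta> x 0"
    unfolding level_value_def using chapman_kolmogorov[of u "\<zeta> - u" x 0] assms x
    by (subst integral_X(1)[of u x "\<lambda>y. p (\<zeta> - u) y 0"]) auto
qed

text \<open>The Markov property from \<open>u\<close> to \<open>v\<close>, then Chapman-Kolmogorov
  with end point exactly \<open>0\<close>. The computation is done with nonnegative integrals, and
  integrability brings it back to real ones.\<close>

lemma level_value_martingale:
  assumes uv: "0 < u" "u \<le> v" "v < \<zeta>" and A: "A \<in> sets (natural_filtration M X u)"
  shows "(LINT \<omega>:A|P x. level_value v \<omega>) = (LINT \<omega>:A|P x. level_value u \<omega>)"
proof (cases "u = v")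
  case False
  hence uv': "u < v" using uv by simp
  have [measurable]: "A \<in> sets (P x)" using A sets_natural_filtration_subset x by (auto simp: sets_P)
  have [measurable]: "(\<lambda>y. p (\<zeta> - v) y 0) \<in> borel_measurable borel" using uv by (intro measurable_p) auto
  have CK: "(\<integral>\<^sup>+ y. ennreal (p (v - u) z y) * ennreal (p (\<zeta> - v) y 0) \<partial>m) = ennreal (p (\<zeta> - u) z 0)" if "z \<ge> 0" for z
  proof -
    have "(\<integral>\<^sup>+ y. ennreal (p (v - u) z y * p (\<zeta> - v) y 0) \<partial>m) = ennreal (LINT y|m. p (v - u) z y * p (\<zeta> - v) y 0)"
      using uv uv' that p_nonneg by (intro nn_integral_eq_integral integrable_p_mult) auto
    also have "(LINT y|m. p (v - u) z y * p (\<zeta> - v) y 0) = p ((v - u) + (\<zeta> - v)) z 0"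
      using uv uv' that by (intro chapman_kolmogorov) auto
    finally show ?thesis using uv uv' p_nonneg by (simp add: ennreal_mult)
  qed
  have "(\<integral>\<^sup>+ \<omega>. indicator A \<omega> * ennreal (level_value v \<omega>) \<partial>P x) =
      (\<integral>\<^sup>+ \<omega>. indicator A \<omega> * (\<integral>\<^sup>+ y. ennreal (p (v - u) (X u \<omega>) y) * ennreal (p (\<zeta> - v) y 0) \<partial>m) \<partial>P x)"
    using nn_integral_markov[OF x _ _ A, of "v - u" "\<lambda>y. ennreal (p (\<zeta> - v) y 0)"] uv uv'
    by (simp add: level_value_def)
  also have "\<dots> = (\<integral>\<^sup>+ \<omega>. indicator A \<omega> * ennreal (level_value u \<omega>) \<partial>P x)"
  proof (rule nn_integral_cong)
    fix \<omega> assume "\<omega> \<in> space (P x)"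
    hence "X u \<omega> \<ge> 0" using state_space[of u] uv x by (simp add: space_P)
    thus "indicator A \<omega> * (\<integral>\<^sup>+ y. ennreal (p (v - u) (X u \<omega>) y) * ennreal (p (\<zeta> - v) y 0) \<partial>m) = indicator A \<omega> * ennreal (level_value u \<omega>)"
      by (simp add: CK level_value_def)
  qed
  finally have eq: "(\<integral>\<^sup>+ \<omega>. indicator A \<omega> * ennreal (level_value v \<omega>) \<partial>P x) = (\<integral>\<^sup>+ \<omega>. indicator A \<omega> * ennreal (level_value u \<omega>) \<partial>P x)" .
  have nn: "(\<integral>\<^sup>+ \<omega>. indicator A \<omega> * ennreal (level_value r \<omega>) \<partial>P x) = ennreal (LINT \<omega>:A|P x. level_value r \<omega>)"
    and nonneg: "0 \<le> (LINT \<omega>:A|P x. level_value r \<omega>)" if "0 < r" "r < \<zeta>" for r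
  proof -
    have i: "integrable (P x) (\<lambda>\<omega>. indicator A \<omega> *\<^sub>R level_value r \<omega>)"
      using integrable_level_value(1)[OF that] by (intro integrable_mult_indicator) auto
    have "(\<integral>\<^sup>+ \<omega>. indicator A \<omega> * ennreal (level_value r \<omega>) \<partial>P x) = (\<integral>\<^sup>+ \<omega>. ennreal (indicator A \<omega> *\<^sub>R level_value r \<omega>) \<partial>P x)"
      by (intro nn_integral_cong) (auto simp: indicator_def)
    also have "\<dots> = ennreal (LINT \<omega>|P x. indicator A \<omega> *\<^sub>R level_value r \<omega>)"
      using level_value_nonneg that by (intro nn_integral_eq_integral[OF i]) auto
    finally show "(\<integral>\<^sup>+ \<omega>. indicator A \<omega> * ennreal (level_value r \<omega>) \<partial>P x) = ennreal (LINT \<omega>:A|P x. level_value r \<omega>)"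
      unfolding set_lebesgue_integral_def .
    show "0 \<le> (LINT \<omega>:A|P x. level_value r \<omega>)"
      unfolding set_lebesgue_integral_def using level_value_nonneg that by (intro Bochner_Integration.integral_nonneg) auto
  qed
  show ?thesis using eq nn[of u] nn[of v] nonneg[of u] nonneg[of v] uv by (simp add: ennreal_inj)
qed simp

text \<open>Shortly before \<open>\<zeta>\<close> the path stays above some \<open>r > 0\<close>. By
  monotonicity the density at \<open>r\<close> then dominates, and it vanishes in small time. Paths
  that are at \<open>0\<close> at time \<open>\<zeta>\<close> form a null event, because
  \<open>m\<close> does not charge \<open>0\<close>.\<close>

lemma level_value_tendsto_0:
  assumes w: "\<omega> \<in> space M" and pos: "0 < X \<zeta> \<omega>"
  shows "((\<lambda>u. level_value u \<omega>) \<longlongrightarrow> 0) (at_left \<zeta>)"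
proof -
  define r where "r = X \<zeta> \<omega> / 2"
  have r: "r > 0" "r < X \<zeta> \<omega>" using pos by (auto simp: r_def)
  have "continuous (at \<zeta> within {0..}) (\<lambda>u. X u \<omega>)"
    using continuous_paths[OF w] \<zeta> by (simp add: continuous_on_eq_continuous_within)
  hence "((\<lambda>u. X u \<omega>) \<longlongrightarrow> X \<zeta> \<omega>) (at \<zeta>)"
    using \<zeta> by (simp add: continuous_within at_within_Ici_pos)
  hence "((\<lambda>u. X u \<omega>) \<longlongrightarrow> X \<zeta> \<omega>) (at_left \<zeta>)" by (rule filterlim_mono) (auto simp: at_le)
  from order_tendstoD(1)[OF this r(2)] have ev: "eventually (\<lambda>u. r < X u \<omega>) (at_left \<zeta>)" .
  have "filterlim (\<lambda>u. \<zeta> - u) (at_right 0) (at_left \<zeta>)"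
    unfolding filterlim_at by (auto intro!: tendsto_eq_intros simp: eventually_at_filter)
  with density_small_time[OF r(1)] have lim: "((\<lambda>u. q (\<zeta> - u) r 0) \<longlongrightarrow> 0) (at_left \<zeta>)"
    by (rule filterlim_compose)
  have lt: "eventually (\<lambda>u. u < \<zeta>) (at_left \<zeta>)" by (simp add: eventually_at_filter)
  show ?thesis
  proof (rule tendsto_sandwich[OF _ _ tendsto_const lim])
    show "eventually (\<lambda>u. 0 \<le> level_value u \<omega>) (at_left \<zeta>)" using lt by eventually_elim (rule level_value_nonneg)
    show "eventually (\<lambda>u. level_value u \<omega> \<le> q (\<zeta> - u) r 0) (at_left \<zeta>)"
      using lt ev
    proof eventually_elim
      case (elim u)
      thus ?case using density_decreasing[of "\<zeta> - u"] r by (auto simp: level_value_def p_def monotone_on_def)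
    qed
  qed
qed

text \<open>The maximal equality combined with \<open>min c y = y - max 0 (y - c)\<close> and the
  constant mean \<open>p \<zeta> x 0\<close> of the martingale.\<close>

lemma prob_level_reached:
  assumes t: "0 < t" "t < \<zeta>"
  shows "{\<omega>\<in>space (P x). \<exists>u\<in>{t..<\<zeta>}. c \<le> level_value u \<omega>} \<in> sets (P x)"
    and "c * measure (P x) {\<omega>\<in>space (P x). \<exists>u\<in>{t..<\<zeta>}. c \<le> level_value u \<omega>} = p \<zeta> x 0 - excess t"
proof -
  interpret prob_space "P x" using x by (rule prob_space_P)
  have sub: "subalgebra (P x) (natural_filtration M X u)" for u
    unfolding subalgebra_def using x sets_natural_filtration_subset
    by (simp add: space_P sets_P space_natural_filtration)
  have meas: "level_value u \<in> borel_measurable (natural_filtration M X v)" if "t \<le> u" "u \<le> v" "v < \<zeta>" for u v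
    unfolding level_value_def using that t by (intro measurable_p measurable_X_natural_filtration) auto
  have cont: "continuous_on {t..<\<zeta>} (\<lambda>u. level_value u \<omega>)" if "\<omega> \<in> space (P x)" for \<omega>
    unfolding level_value_def using that t x by (intro continuous_on_path_p) (auto simp: space_P)
  have lim: "AE \<omega> in P x. ((\<lambda>u. level_value u \<omega>) \<longlongrightarrow> 0) (at_left \<zeta>)"
    using AE_X_pos[OF \<zeta> x] AE_space by eventually_elim (use x in \<open>auto intro!: level_value_tendsto_0 simp: space_P\<close>)
  have nonneg: "0 \<le> level_value u \<omega>" if "t \<le> u" "u < \<zeta>" "\<omega> \<in> space (P x)" for u \<omega> using that by (intro level_value_nonneg)
  have int: "integrable (P x) (level_value u)" if "t \<le> u" "u < \<zeta>" for u using that t by (intro integrable_level_value) auto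
  have mart: "(LINT \<omega>:A|P x. level_value v \<omega>) = (LINT \<omega>:A|P x. level_value u \<omega>)"
    if "t \<le> u" "u \<le> v" "v < \<zeta>" "A \<in> sets (natural_filtration M X u)" for u v A
    using that t by (intro level_value_martingale) auto
  note max_eq = continuous_maximal_equality[OF t(2) c sub meas nonneg int mart cont lim]
  show "{\<omega>\<in>space (P x). \<exists>u\<in>{t..<\<zeta>}. c \<le> level_value u \<omega>} \<in> sets (P x)" by (rule max_eq(1))
  have 1: "excess t = (LINT \<omega>|P x. max 0 (level_value t \<omega> - c))"
  proof -
    have [measurable]: "(\<lambda>y. p (\<zeta> - t) y 0) \<in> borel_measurable borel" using t by (intro measurable_p) auto
    have "(LINT \<omega>|P x. max 0 (level_value t \<omega> - c)) = (LINT y|m. p t x y * max 0 (p (\<zeta> - t) y 0 - c))"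
      unfolding level_value_def by (rule integral_X(1)[OF t(1) x]) measurable
    thus ?thesis unfolding excess_def using t by (simp add: p_sym[of t x] mult.commute)
  qed
  have 2: "(LINT \<omega>|P x. min c (level_value t \<omega>)) = (LINT \<omega>|P x. level_value t \<omega> - max 0 (level_value t \<omega> - c))"
    by (intro Bochner_Integration.integral_cong) auto
  have 3: "(LINT \<omega>|P x. level_value t \<omega> - max 0 (level_value t \<omega> - c)) = (LINT \<omega>|P x. level_value t \<omega>) - (LINT \<omega>|P x. max 0 (level_value t \<omega> - c))"
    using integrable_level_value(1)[OF t] by (intro Bochner_Integration.integral_diff) auto
  have 4: "c * measure (P x) {\<omega>\<in>space (P x). \<exists>u\<in>{t..<\<zeta>}. c \<le> level_value u \<omega>} = (LINT \<omega>|P x. min c (level_value t \<omega>))"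
    by (rule max_eq(2))
  show "c * measure (P x) {\<omega>\<in>space (P x). \<exists>u\<in>{t..<\<zeta>}. c \<le> level_value u \<omega>} = p \<zeta> x 0 - excess t"
    unfolding 4 2 3 integrable_level_value(2)[OF t] 1 ..
qed

text \<open>For \<open>t \<ge> 0\<close> the default value \<open>0\<close> never exceeds
  \<open>t\<close>, so it agrees with the right side being false for an empty set.\<close>

lemma last_passage_time_greater_iff:
  assumes "0 \<le> t"
  shows "t < last_passage_time X f \<zeta> \<omega> \<longleftrightarrow> (\<exists>u. t < u \<and> u \<le> \<zeta> \<and> X u \<omega> = f u)"
proof -
  define S where "S = {t \<in> {0..\<zeta>}. X t \<omega> = f t}"
  have "bdd_above S" unfolding S_def by (rule bdd_aboveI[of _ \<zeta>]) auto
  hence "S \<noteq> {} \<Longrightarrow> t < Sup S \<longleftrightarrow> (\<exists>u\<in>S. t < u)" by (rule less_cSup_iff[rotated])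
  moreover have "(\<exists>u. t < u \<and> u \<le> \<zeta> \<and> X u \<omega> = f u) \<longleftrightarrow> (\<exists>u\<in>S. t < u)"
    using assms unfolding S_def by (auto intro: less_imp_le le_less_trans)
  ultimately show ?thesis using assms
    unfolding last_passage_time_def S_def[symmetric] Let_def by auto
qed

lemma last_passage_time_bounds: "0 \<le> last_passage_time X f \<zeta> \<omega>" "last_passage_time X f \<zeta> \<omega> \<le> \<zeta>"
proof -
  define S where "S = {t \<in> {0..\<zeta>}. X t \<omega> = f t}"
  have "Sup S \<le> \<zeta>" if "S \<noteq> {}" using that by (intro cSup_least) (auto simp: S_def)
  moreover have "0 \<le> Sup S" if "S \<noteq> {}"
  proof -
    obtain u where u: "u \<in> S" using \<open>S \<noteq> {}\<close> by blast
    have "u \<le> Sup S" by (rule cSup_upper[OF u]) (auto simp: S_def intro!: bdd_aboveI[of _ \<zeta>])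
    thus ?thesis using u by (simp add: S_def)
  qed
  ultimately show "0 \<le> last_passage_time X f \<zeta> \<omega>" "last_passage_time X f \<zeta> \<omega> \<le> \<zeta>"
    using \<zeta> unfolding last_passage_time_def S_def[symmetric] Let_def by auto
qed

lemma X_eq_f_iff: "\<omega> \<in> space M \<Longrightarrow> 0 \<le> u \<Longrightarrow> u < \<zeta> \<Longrightarrow> X u \<omega> = f u \<longleftrightarrow> level_value u \<omega> = c"
  unfolding level_value_def using level_eq_iff[of u "X u \<omega>"] state_space[of u \<omega>] by simp

text \<open>A meeting at time \<open>\<zeta>\<close> is a separate event, since the level equation
  describes \<open>f\<close> only earlier. Before \<open>\<zeta>\<close>, meeting the curve means
  that the continuous path of \<open>level_value\<close> attains \<open>c\<close>, which is
  measurable on each of the compact intervals exhausting \<open>]t, \<zeta>[\<close>.\<close>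

lemma last_passage_time_measurable: "last_passage_time X f \<zeta> \<in> borel_measurable (P x)"
proof -
  have "last_passage_time X f \<zeta> \<in> borel_measurable M"
  proof (rule borel_measurableI_greater)
    fix t
    consider "t < 0" | "\<zeta> \<le> t" | "0 \<le> t" "t < \<zeta>" by linarith
    thus "{\<omega>\<in>space M. t < last_passage_time X f \<zeta> \<omega>} \<in> sets M"
    proof cases
      case 1
      hence "{\<omega>\<in>space M. t < last_passage_time X f \<zeta> \<omega>} = space M"
        using last_passage_time_bounds(1) by (auto intro: less_le_trans)
      thus ?thesis by simp
    next
      case 2
      hence eq: "{\<omega>\<in>space M. t < last_passage_time X f \<zeta> \<omega>} = {}"
        using last_passage_time_bounds(2) by (auto simp: not_less intro: order_trans)
      show ?thesis unfolding eq by simp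
    next
      case 3
      define d where "d = \<zeta> - t"
      have d: "d > 0" using 3 by (simp add: d_def)
      \<comment> \<open>With \<open>n + 3\<close> each margin is at most a third of
        \<open>d\<close>, so \<open>a n < b n\<close> already for \<open>n = 0\<close>.\<close>
      define a where "a n = t + d / real (n + 3)" for n
      define b where "b n = \<zeta> - d / real (n + 3)" for n
      have ab: "t < a n" "a n < b n" "b n < \<zeta>" for n
      proof -
        have "d / real (n + 3) \<le> d / 3" using d by (intro divide_left_mono) auto
        moreover have "0 < d / real (n + 3)" using d by simp
        moreover have "\<zeta> = t + d" by (simp add: d_def)
        ultimately show "t < a n" "a n < b n" "b n < \<zeta>" using d unfolding a_def b_def by linarith+
      qed
      have [measurable]: "X \<zeta> \<in> borel_measurable M" using measurable_X \<zeta> by simp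
      have "{\<omega>\<in>space M. \<exists>u\<in>{a n..b n}. level_value u \<omega> = c} \<in> sets M" for n
      proof (rule sets_path_attains[OF ab(2)])
        show "level_value u \<in> borel_measurable M" if "u \<in> {a n..b n}" for u
          unfolding level_value_def using that ab(1,3)[of n] 3 by (intro measurable_p measurable_X) auto
        show "continuous_on {a n..b n} (\<lambda>u. level_value u \<omega>)" if "\<omega> \<in> space M" for \<omega>
          unfolding level_value_def using ab(1,3)[of n] 3 by (intro continuous_on_path_p that) auto
      qed
      moreover have "{\<omega>\<in>space M. X \<zeta> \<omega> = f \<zeta>} \<in> sets M" by measurable
      moreover have "{\<omega>\<in>space M. t < last_passage_time X f \<zeta> \<omega>} =
          {\<omega>\<in>space M. X \<zeta> \<omega> = f \<zeta>} \<union> (\<Union>n. {\<omega>\<in>space M. \<exists>u\<in>{a n..b n}. level_value u \<omega> = c})"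
      proof (intro equalityI subsetI)
        fix \<omega> assume "\<omega> \<in> {\<omega>\<in>space M. t < last_passage_time X f \<zeta> \<omega>}"
        then obtain u where w: "\<omega> \<in> space M" and u: "t < u" "u \<le> \<zeta>" "X u \<omega> = f u"
          using last_passage_time_greater_iff[OF 3(1)] by auto
        show "\<omega> \<in> {\<omega>\<in>space M. X \<zeta> \<omega> = f \<zeta>} \<union> (\<Union>n. {\<omega>\<in>space M. \<exists>u\<in>{a n..b n}. level_value u \<omega> = c})"
        proof (cases "u = \<zeta>")
          case False
          hence u': "u < \<zeta>" using u by simp
          define e where "e = min (u - t) (\<zeta> - u)"
          have "e > 0" using u u' by (simp add: e_def)
          have "(\<lambda>n. d / real (n + 3)) \<longlonglongrightarrow> 0" by real_asymp
          from order_tendstoD(2)[OF this \<open>e > 0\<close>] obtain n where "d / real (n + 3) < e"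
            by (auto dest: eventually_happens)
          hence "u \<in> {a n..b n}" unfolding a_def b_def e_def by auto
          moreover have "level_value u \<omega> = c" using X_eq_f_iff[OF w, of u] u u' 3 by simp
          ultimately show ?thesis using w by blast
        qed (use u w in auto)
      next
        fix \<omega> assume "\<omega> \<in> {\<omega>\<in>space M. X \<zeta> \<omega> = f \<zeta>} \<union> (\<Union>n. {\<omega>\<in>space M. \<exists>u\<in>{a n..b n}. level_value u \<omega> = c})"
        then consider "\<omega> \<in> space M" "X \<zeta> \<omega> = f \<zeta>" | n u where "\<omega> \<in> space M" "u \<in> {a n..b n}" "level_value u \<omega> = c"
          by blast
        thus "\<omega> \<in> {\<omega>\<in>space M. t < last_passage_time X f \<zeta> \<omega>}"
        proof cases
          case 1
          thus ?thesis using last_passage_time_greater_iff[OF \<open>0 \<le> t\<close>] \<open>t < \<zeta>\<close> by auto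
        next
          case 2
          hence "t < u" "u < \<zeta>" using ab(1,3)[of n] by auto
          thus ?thesis using 2 X_eq_f_iff[of \<omega> u] last_passage_time_greater_iff[OF \<open>0 \<le> t\<close>, of \<omega>] \<open>0 \<le> t\<close>
            by (auto intro!: exI[of _ u])
        qed
      qed
      ultimately show ?thesis by auto
    qed
  qed
  thus ?thesis using measurable_cong_sets[OF sets_P[OF x] refl] by blast
qed

text \<open>A path of \<open>level_value\<close> that is at least \<open>c\<close> at some time must
  still come down to \<open>0\<close> at \<open>\<zeta>\<close>, so it takes the value
  \<open>c\<close> at that time or later. The events \<open>X \<zeta> = 0\<close>,
  \<open>X \<zeta> = f \<zeta>\<close> and \<open>X t = f t\<close> are null, which settles the
  limit at \<open>\<zeta>\<close> and the two end points.\<close>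

lemma prob_last_passage_time_greater:
  assumes t: "0 < t" "t < \<zeta>"
  shows "measure (P x) {\<omega>\<in>space (P x). t < last_passage_time X f \<zeta> \<omega>} = (p \<zeta> x 0 - excess t) / c"
proof -
  interpret prob_space "P x" using x by (rule prob_space_P)
  have G [measurable]: "last_passage_time X f \<zeta> \<in> borel_measurable (P x)" by (rule last_passage_time_measurable)
  have "measure (P x) {\<omega>\<in>space (P x). t < last_passage_time X f \<zeta> \<omega>} =
      measure (P x) {\<omega>\<in>space (P x). \<exists>u\<in>{t..<\<zeta>}. c \<le> level_value u \<omega>}"
  proof (rule finite_measure_eq_AE)
    show "AE \<omega> in P x. \<omega> \<in> {\<omega>\<in>space (P x). t < last_passage_time X f \<zeta> \<omega>} \<longleftrightarrow>
        \<omega> \<in> {\<omega>\<in>space (P x). \<exists>u\<in>{t..<\<zeta>}. c \<le> level_value u \<omega>}"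
      using AE_X_pos[OF \<zeta> x] AE_X_neq[OF \<zeta> x, of "f \<zeta>"] AE_X_neq[OF t(1) x, of "f t"] AE_space
    proof eventually_elim
      case (elim \<omega>)
      hence w: "\<omega> \<in> space M" using x by (simp add: space_P)
      have Yt: "level_value t \<omega> \<noteq> c" using X_eq_f_iff[OF w, of t] elim t by simp
      have "t < last_passage_time X f \<zeta> \<omega> \<longleftrightarrow> (\<exists>u. t < u \<and> u \<le> \<zeta> \<and> X u \<omega> = f u)"
        using t by (intro last_passage_time_greater_iff) simp
      also have "\<dots> \<longleftrightarrow> (\<exists>u. t < u \<and> u < \<zeta> \<and> level_value u \<omega> = c)"
        using elim X_eq_f_iff[OF w] t by (metis le_less less_imp_le order_less_trans)
      also have "\<dots> \<longleftrightarrow> (\<exists>u\<in>{t..<\<zeta>}. c \<le> level_value u \<omega>)"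
      proof
        assume "\<exists>u\<in>{t..<\<zeta>}. c \<le> level_value u \<omega>"
        then obtain u where u: "t \<le> u" "u < \<zeta>" "c \<le> level_value u \<omega>" by auto
        have "eventually (\<lambda>v. level_value v \<omega> < c) (at_left \<zeta>)"
          using order_tendstoD(2)[OF level_value_tendsto_0[OF w elim(1)] c] .
        moreover have "eventually (\<lambda>v. v \<in> {u<..<\<zeta>}) (at_left \<zeta>)"
          using u by (intro eventually_at_leftI[of u]) auto
        ultimately have "eventually (\<lambda>v. level_value v \<omega> < c \<and> v \<in> {u<..<\<zeta>}) (at_left \<zeta>)" by (rule eventually_conj)
        then obtain v where v: "level_value v \<omega> < c" "u < v" "v < \<zeta>"
          using eventually_happens'[of "at_left \<zeta>"] by (auto simp: trivial_limit_at_left_real)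
        have "continuous_on {u..v} (\<lambda>u. level_value u \<omega>)"
          unfolding level_value_def using u v t by (intro continuous_on_path_p w) auto
        then obtain r where r: "u \<le> r" "r \<le> v" "level_value r \<omega> = c"
          using IVT2'[of "\<lambda>u. level_value u \<omega>" v c u] u v by auto
        moreover have "t < r" using r u Yt by (cases "r = t") auto
        ultimately show "\<exists>u. t < u \<and> u < \<zeta> \<and> level_value u \<omega> = c" using v by (intro exI[of _ r]) auto
      qed (auto intro!: bexI)
      finally show ?case by simp
    qed
    show "{\<omega>\<in>space (P x). t < last_passage_time X f \<zeta> \<omega>} \<in> sets (P x)" by measurable
    show "{\<omega>\<in>space (P x). \<exists>u\<in>{t..<\<zeta>}. c \<le> level_value u \<omega>} \<in> sets (P x)" by (rule prob_level_reached(1)[OF t])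
  qed
  also have "\<dots> = (p \<zeta> x 0 - excess t) / c" using prob_level_reached(2)[OF t] c by (simp add: field_simps)
  finally show ?thesis .
qed

lemma last_passage_time_density:
  shows "set_integrable lborel {0<..<\<zeta>} (\<lambda>t. excess_rate t (f t) / c)"
    and "A \<in> sets borel \<Longrightarrow> A \<subseteq> {0<..<\<zeta>} \<Longrightarrow>
      measure (P x) {\<omega>\<in>space (P x). last_passage_time X f \<zeta> \<omega> \<in> A} = (LINT t:A|lborel. excess_rate t (f t) / c)"
proof -
  interpret prob_space "P x" using x by (rule prob_space_P)
  have d: "((\<lambda>t. (p \<zeta> x 0 - excess t) / c) has_real_derivative - (excess_rate t (f t) / c)) (at t)" if "0 < t" "t < \<zeta>" for t
    using DERIV_cdivide[OF DERIV_diff[OF DERIV_const DERIV_excess[OF that]]] by simp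
  have "continuous_on {0<..<\<zeta>} (\<lambda>t. excess_rate t (f t))"
  proof (intro continuous_at_imp_continuous_on ballI)
    fix t assume "t \<in> {0<..<\<zeta>}"
    hence t: "0 < t" "t < \<zeta>" by auto
    have "((\<lambda>t. (t, f t)) \<longlongrightarrow> (t, f t)) (at t)"
      using isCont_f[OF t] unfolding isCont_def by (intro tendsto_intros)
    from isCont_tendsto_compose[OF isCont_excess_rate[OF t f_pos] this] t
    show "isCont (\<lambda>t. excess_rate t (f t)) t" by (simp add: isCont_def)
  qed
  hence "continuous_on {0<..<\<zeta>} (\<lambda>t. excess_rate t (f t) / c)" using c by (intro continuous_intros) auto
  hence m: "(\<lambda>t. indicator {0<..<\<zeta>} t * (excess_rate t (f t) / c)) \<in> borel_measurable borel"
    using borel_measurable_continuous_on_indicator[of "{0<..<\<zeta>}" "\<lambda>t. excess_rate t (f t) / c"] by simp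
  note * = density_from_survival_function[OF last_passage_time_measurable prob_last_passage_time_greater d m]
  show "set_integrable lborel {0<..<\<zeta>} (\<lambda>t. excess_rate t (f t) / c)" by (rule *(1))
  show "measure (P x) {\<omega>\<in>space (P x). last_passage_time X f \<zeta> \<omega> \<in> A} = (LINT t:A|lborel. excess_rate t (f t) / c)"
    if "A \<in> sets borel" "A \<subseteq> {0<..<\<zeta>}" by (rule *(2)[OF _ _ _ _ that])
qed

text \<open>On the curve the density equals \<open>c\<close>, so the first half of the Wronskian
  vanishes; symmetry of the density puts the other half into the required form.\<close>

lemma excess_rate_on_curve:
  assumes t: "0 < t" "t < \<zeta>"
  shows "excess_rate t (f t) / c = - (q t x (f t) / (c * deriv s (f t))) * deriv (\<lambda>y. q (\<zeta> - t) y 0) (f t)"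
proof -
  have "p t (f t) x = q t x (f t)" using p_sym[OF t(1), of "f t" x] f_pos[of t] t x by (simp add: p_eq)
  thus ?thesis using level_eq[of t] t by (simp add: excess_rate_def flux_def)
qed

end

theorem proposition15:
  fixes M :: "'w measure" and P :: "real \<Rightarrow> 'w measure" and X :: "real \<Rightarrow> 'w \<Rightarrow> real"
    and s \<rho> f :: "real \<Rightarrow> real" and q :: "real \<Rightarrow> real \<Rightarrow> real \<Rightarrow> real" and \<zeta> c x :: real
  defines "G \<equiv> last_passage_time X f \<zeta>"
    and "g \<equiv> (\<lambda>t. - (q t x (f t) / (c * deriv s (f t))) * deriv (\<lambda>y. q (\<zeta> - t) y 0) (f t))"
  assumes "linear_diffusion_density M P X s \<rho> q"
    and "x \<ge> 0" and "\<zeta> > 0" and "c > 0"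
    and "c < (INF t\<in>{0..<\<zeta>}. q (\<zeta> - t) 0 0)"
    and "boundary_defined_by q \<zeta> c f"
    and "{t. 0 \<le> t \<and> f t = 0} \<noteq> {}" and "\<zeta> = Inf {t. 0 \<le> t \<and> f t = 0}"
  shows "G \<in> borel_measurable (P x) \<and>
    set_integrable lborel {0<..<\<zeta>} g \<and>
    (\<forall>A\<in>sets borel. A \<subseteq> {0<..<\<zeta>} \<longrightarrow>
       measure (P x) {\<omega> \<in> space (P x). G \<omega> \<in> A} = (LINT t:A|lborel. g t))"
proof -
  interpret linear_diffusion_density M P X s \<rho> q by fact
  \<comment> \<open>The value at \<open>t = 0\<close> is an upper bound for the infimum; being above
    \<open>c > 0\<close>, it is positive.\<close>
  have "(INF t\<in>{0..<\<zeta>}. q (\<zeta> - t) 0 0) \<le> q (\<zeta> - 0) 0 0"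
    using \<open>\<zeta> > 0\<close> by (intro cINF_lower bdd_belowI2[of _ 0] density_nonneg) auto
  hence q_pos: "q \<zeta> 0 0 > 0" using assms(6,7) by simp
  have f_pos: "f t > 0" if t: "0 \<le> t" "t < \<zeta>" for t
  proof -
    have "f t \<noteq> 0"
    proof
      assume "f t = 0"
      hence "Inf {t. 0 \<le> t \<and> f t = 0} \<le> t" using t by (intro cInf_lower bdd_belowI[of _ 0]) auto
      thus False using t assms(10) by simp
    qed
    moreover have "f t \<ge> 0" using assms(8) t by (simp add: boundary_defined_by_def)
    ultimately show ?thesis by simp
  qed
  interpret density_level_curve M P X s \<rho> q \<zeta> c x f
    by unfold_locales (fact assms q_pos | rule f_pos; assumption)+
  have g: "g t = excess_rate t (f t) / c" if "t \<in> {0<..<\<zeta>}" for t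
    using excess_rate_on_curve[of t] that by (simp add: g_def)
  have "set_integrable lborel {0<..<\<zeta>} g"
    using last_passage_time_density(1) g
    by (subst set_integrable_cong[OF refl refl, of _ g "\<lambda>t. excess_rate t (f t) / c"]) auto
  moreover have "measure (P x) {\<omega> \<in> space (P x). G \<omega> \<in> A} = (LINT t:A|lborel. g t)"
    if A: "A \<in> sets borel" "A \<subseteq> {0<..<\<zeta>}" for A
    unfolding G_def last_passage_time_density(2)[OF A] set_lebesgue_integral_def
    using A by (intro Bochner_Integration.integral_cong) (auto simp: g indicator_def)
  ultimately show ?thesis using last_passage_time_measurable unfolding G_def by blast
qed

end
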